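(* Let $E,A\in\mathbb{R}^{m\times n}$, $B,C\in\mathbb{R}^{l\times n}$, $d\in\mathbb{R}^l$, $T>0$, and let $f:[0,T]\to\mathbb{R}^m$ be $C^1$ on $(0,T)$. Let $W\in\mathbb{R}^{m\times m}$ and $V\in\mathbb{R}^{n\times n}$ be invertible matrices transforming $(E,A)$ into the quasi-Kronecker form $$WEV=\operatorname{diag}(I_{n_0},N_\alpha,L_\beta,L_\gamma^\top),\qquad WAV=\operatorname{diag}(A_0,I_{|\alpha|},K_\beta,K_\gamma^\top).$$ Suppose that the components $f_0,f_1,f_3$ of $Wf$ satisfy the regularity assumptions (A0), (A1), (A3) listed in the context. Then the boundary value problem $$E\dot x(t)=Ax(t)+f(t),\ t\in(0,T),\qquad Bx(0)+Cx(T)=d$$ has a unique solution $x\in C^1([0,T],\mathbb{R}^n)$ if and only if all of the following hold: (a) the block $(L_\beta,K_\beta)$ is not present in $(WEV,WAV)$ (i.e. $n_\beta=0$); (b) $\sum_{i=1}^{\gamma_k} f_{\gamma_k,i}^{(\gamma_k-i)}(t)=0$ for all $t\in[0,T]$ and $k=1,\dots,n_\gamma$; (c) $\widehat d\in\operatorname{ran}Q$; (d) $\operatorname{rank}Q=n_0$. The unique solution is then given by $$x(t)=V\begin{bmatrix}e^{A_0t}(Q^\top Q)^{-1}Q^\top\widehat d+\int_0^te^{A_0(t-s)}f_0(s)\,ds\\ -\sum_{i=0}^{\nu_\alpha-1}N_\alpha^if_1^{(i)}(t)\\ -K_\gamma\sum_{i=0}^{\nu_\gamma-1}N_\gamma^if_3^{(i)}(t)\end{bmatrix}.$$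 If $|\gamma|=n_\gamma$, the third component is omitted.
   Context: A solution of the boundary value problem is a function $x\in C^1([0,T],\mathbb{R}^n)$ satisfying the equation on $(0,T)$ and the boundary condition; $\operatorname{ran}$ denotes the range (column space). Canonical blocks. For $k\in\mathbb{N}$, $k\ge1$: $N_k\in\mathbb{R}^{k\times k}$ is the nilpotent matrix with ones on the first subdiagonal and zeros elsewhere; $K_k=[I_{k-1}\ \ 0]$ and $L_k=[0\ \ I_{k-1}]$ in $\mathbb{R}^{(k-1)\times k}$ (for $k=1$ these are $0\times1$ matrices: in a block diagonal matrix they contribute a zero column and no row, and their transposes contribute a zero row and no column). For a multi-index $\alpha=(\alpha_1,\dots,\alpha_{n_\alpha})$ of positive integers, $|\alpha|=\sum_i\alpha_i$, $N_\alpha=\operatorname{diag}(N_{\alpha_1},\dots,N_{\alpha_{n_\alpha}})$, $K_\alpha=\operatorname{diag}(K_{\alpha_1},\dots,K_{\alpha_{n_\alpha}})$, $L_\alpha=\operatorname{diag}(L_{\alpha_1},\dots,L_{\alpha_{n_\alpha}})$. In the quasi-Kronecker form, $A_0\in\mathbb{R}^{n_0\times n_0}$ and $\alpha,\beta,\gamma$ are multi-indices of lengths $n_\alpha,n_\beta,n_\gamma$; any of $n_0,n_\alpha,n_\beta,n_\gamma$ may be $0$, in which case the corresponding block is absent, and all components and terms belonging to an absent block are omitted (zero). Splitting. $V^{-1}x=(x_0^\top,x_1^\top,x_2^\top,x_3^\top)^\top$ with sizes $n_0,|\alpha|,|\beta|,|\gamma|-n_\gamma$; $Wf=(f_0^\top,f_1^\top,f_2^\top,f_3^\top)^\top$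 with sizes $n_0,|\alpha|,|\beta|-n_\beta,|\gamma|$; $BV=[B_0,B_1,B_2,B_3]$ and $CV=[C_0,C_1,C_2,C_3]$ with column blocks of sizes $n_0,|\alpha|,|\beta|,|\gamma|-n_\gamma$. Further $f_1=(f_{\alpha_1}^\top,\dots,f_{\alpha_{n_\alpha}}^\top)^\top$ with $f_{\alpha_k}$ valued in $\mathbb{R}^{\alpha_k}$, $f_3=(f_{\gamma_1}^\top,\dots,f_{\gamma_{n_\gamma}}^\top)^\top$ with $f_{\gamma_k}$ valued in $\mathbb{R}^{\gamma_k}$ (the index $k$ identifies the block), and $f_{\gamma_k,i}$ is the $i$-th component of $f_{\gamma_k}$. Regularity assumptions: (A0) $f_0\in C([0,T],\mathbb{R}^{n_0})$; (A1) $f_{\alpha_k}\in C^{\alpha_k}([0,T],\mathbb{R}^{\alpha_k})$ for $k=1,\dots,n_\alpha$; (A3) $f_{\gamma_k}\in C^{\gamma_k}([0,T],\mathbb{R}^{\gamma_k})$ for $k=1,\dots,n_\gamma$. Put $\nu_\alpha=\max_k\alpha_k$, $\nu_\gamma=\max_k\gamma_k$. Expressions such as $N_\alpha^if_1^{(i)}$ and $N_\gamma^i f_3^{(i)}$ are read blockwise, the block $N_{\alpha_k}^if_{\alpha_k}^{(i)}$ being $0$ for $i\ge\alpha_k$ (where $N_{\alpha_k}^i=0$), and similarly for $\gamma$. $Q$ and $\widehat d$ are needed only when condition (a) holds, in which case they are $$Q=B_0+C_0e^{A_0T}\in\mathbb{R}^{l\times n_0},\qquad \widehat d=d-\bar d_0-\bar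 d_1-\bar d_3,$$ $\bar d_0=C_0\int_0^Te^{A_0(T-s)}f_0(s)ds$; $\bar d_1=-\sum_{i=0}^{\nu_\alpha-1}\big(B_1N_\alpha^if_1^{(i)}(0)+C_1N_\alpha^if_1^{(i)}(T)\big)$; $\bar d_3=-\sum_{i=0}^{\nu_\gamma-1}\big(B_3K_\gamma N_\gamma^if_3^{(i)}(0)+C_3K_\gamma N_\gamma^if_3^{(i)}(T)\big)$ if $|\gamma|>n_\gamma$, and $\bar d_3=0$ if $|\gamma|=n_\gamma$. If $n_0=0$, then $Q$ is the empty $l\times0$ matrix, with rank $0$ and range $\{0\}$. *)

theory Defs
  imports
    "HOL-Analysis.Analysis"
    "HOL-Library.FuncSet"
    "Jordan_Normal_Form.DL_Rank"
    "Jordan_Normal_Form.Gauss_Jordan_Elimination"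
begin

unbundle no vec_syntax
hide_type (open) Finite_Cartesian_Product.vec
hide_const (open) Finite_Cartesian_Product.vec

text \<open>Matrices and vectors are those of \<open>Jordan_Normal_Form\<close>, whose dimensions are values and
  may be zero.\<close>

section \<open>Differentiation on a compact interval\<close>

text \<open>At the end points \<open>0\<close> and \<open>T\<close> derivatives are one-sided. Only the values of the
  function on the interval matter.\<close>

definition deriv_on :: "real \<Rightarrow> (real \<Rightarrow> real) \<Rightarrow> real \<Rightarrow> real" where
  "deriv_on T g t = vector_derivative g (at t within {0..T})"

fun Ck_on :: "real \<Rightarrow> nat \<Rightarrow> (real \<Rightarrow> real) \<Rightarrow> bool" where
  "Ck_on T 0 g \<longleftrightarrow> continuous_on {0..T} g"
| "Ck_on T (Suc k) g \<longleftrightarrow> g differentiable_on {0..T} \<and> Ck_on T k (deriv_on T g)"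

text \<open>The type of vectors carries no topology, so analytic notions for vector-valued functions
  are componentwise.\<close>

definition Ck_vec_on :: "real \<Rightarrow> nat \<Rightarrow> nat \<Rightarrow> (real \<Rightarrow> real vec) \<Rightarrow> bool" where
  "Ck_vec_on T k n g \<longleftrightarrow>
     (\<forall>t\<in>{0..T}. g t \<in> carrier_vec n) \<and> (\<forall>j<n. Ck_on T k (\<lambda>t. g t $ j))"

definition nderiv_vec :: "real \<Rightarrow> nat \<Rightarrow> (real \<Rightarrow> real vec) \<Rightarrow> real \<Rightarrow> real vec" where
  "nderiv_vec T i g t = vec (dim_vec (g t)) (\<lambda>j. (deriv_on T ^^ i) (\<lambda>s. g s $ j) t)"

definition integral_vec :: "nat \<Rightarrow> real set \<Rightarrow> (real \<Rightarrow> real vec) \<Rightarrow> real vec" where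
  "integral_vec n S g = vec n (\<lambda>j. integral S (\<lambda>s. g s $ j))"

definition mat_exp :: "real mat \<Rightarrow> real mat" where
  "mat_exp M = mat (dim_row M) (dim_col M) (\<lambda>(i, j). \<Sum>k. (M ^\<^sub>m k) $$ (i, j) / fact k)"

section \<open>The quasi-Kronecker form\<close>

definition N_block :: "nat \<Rightarrow> real mat" where
  "N_block k = mat k k (\<lambda>(i, j). if i = Suc j then 1 else 0)"

definition K_block :: "nat \<Rightarrow> real mat" where
  "K_block k = mat (k - 1) k (\<lambda>(i, j). if j = i then 1 else 0)"

definition L_block :: "nat \<Rightarrow> real mat" where
  "L_block k = mat (k - 1) k (\<lambda>(i, j). if j = Suc i then 1 else 0)"

text \<open>Multi-indices are lists, and \<open>|\<alpha>|\<close> is \<^const>\<open>sum_list\<close>.\<close>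

definition N_mat :: "nat list \<Rightarrow> real mat" where
  "N_mat \<alpha> = diag_block_mat (map N_block \<alpha>)"

definition K_mat :: "nat list \<Rightarrow> real mat" where
  "K_mat \<alpha> = diag_block_mat (map K_block \<alpha>)"

definition L_mat :: "nat list \<Rightarrow> real mat" where
  "L_mat \<alpha> = diag_block_mat (map L_block \<alpha>)"

definition multi_index :: "nat list \<Rightarrow> bool" where
  "multi_index \<alpha> \<longleftrightarrow> (\<forall>a\<in>set \<alpha>. 1 \<le> a)"

text \<open>The value \<open>0\<close> for the empty multi-index makes the sums over \<open>i < \<nu>\<close> empty.\<close>

definition max_index :: "nat list \<Rightarrow> nat" where
  "max_index \<alpha> = Max (insert 0 (set \<alpha>))"

definition quasi_Kronecker_form ::
  "real mat \<Rightarrow> real mat \<Rightarrow> nat \<Rightarrow> real mat \<Rightarrow> nat list \<Rightarrow> nat list \<Rightarrow> nat list \<Rightarrow> bool" where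
  "quasi_Kronecker_form E' A' n0 A0 \<alpha> \<beta> \<gamma> \<longleftrightarrow>
     A0 \<in> carrier_mat n0 n0 \<and> multi_index \<alpha> \<and> multi_index \<beta> \<and> multi_index \<gamma> \<and>
     E' = diag_block_mat [1\<^sub>m n0, N_mat \<alpha>, L_mat \<beta>, transpose_mat (L_mat \<gamma>)] \<and>
     A' = diag_block_mat [A0, 1\<^sub>m (sum_list \<alpha>), K_mat \<beta>, transpose_mat (K_mat \<gamma>)]"

section \<open>Splitting\<close>

text \<open>The \<open>k\<close> entries (columns) starting at the zero-based position \<open>p\<close>.\<close>

definition subvec :: "nat \<Rightarrow> nat \<Rightarrow> real vec \<Rightarrow> real vec" where
  "subvec p k v = vec k (\<lambda>i. v $ (p + i))"

definition subcols :: "nat \<Rightarrow> nat \<Rightarrow> real mat \<Rightarrow> real mat" where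
  "subcols p k M = mat (dim_row M) k (\<lambda>(i, j). M $$ (i, p + j))"

text \<open>The \<open>k\<close>-th block (counted from \<open>0\<close>) of a vector partitioned according to a multi-index.\<close>

definition block_vec :: "nat list \<Rightarrow> nat \<Rightarrow> real vec \<Rightarrow> real vec" where
  "block_vec \<alpha> k v = subvec (sum_list (take k \<alpha>)) (\<alpha> ! k) v"

text \<open>The \<open>i\<close>-th summand \<open>N\<^sub>\<alpha>\<^sup>i g\<^sup>(\<^sup>i\<^sup>)(t)\<close>. The \<open>k\<close>-th diagonal block of \<open>N\<^sub>\<alpha>\<^sup>i\<close> vanishes for
  \<open>i \<ge> \<alpha>\<^sub>k\<close>, and \<^const>\<open>nderiv_vec\<close> is total, so the product agrees with the blockwise reading
  even where higher derivatives of some blocks do not exist.\<close>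

definition N_term :: "real \<Rightarrow> nat list \<Rightarrow> (real \<Rightarrow> real vec) \<Rightarrow> nat \<Rightarrow> real \<Rightarrow> real vec" where
  "N_term T \<alpha> g i t = (N_mat \<alpha> ^\<^sub>m i) *\<^sub>v nderiv_vec T i g t"

section \<open>The boundary value problem\<close>

text \<open>A solution is a function with domain \<open>[0,T]\<close>, encoded as an extensional function so that
  equality of solutions is equality on \<open>[0,T]\<close>.\<close>

definition bvp_solution ::
  "real mat \<Rightarrow> real mat \<Rightarrow> real mat \<Rightarrow> real mat \<Rightarrow> real vec \<Rightarrow> real \<Rightarrow> (real \<Rightarrow> real vec)
     \<Rightarrow> (real \<Rightarrow> real vec) \<Rightarrow> bool" where
  "bvp_solution E A B C d T f x \<longleftrightarrow>
     x \<in> {0..T} \<rightarrow>\<^sub>E carrier_vec (dim_col E) \<and>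
     Ck_vec_on T 1 (dim_col E) x \<and>
     (\<forall>t\<in>{0<..<T}. E *\<^sub>v nderiv_vec T 1 x t = A *\<^sub>v x t + f t) \<and>
     B *\<^sub>v x 0 + C *\<^sub>v x T = d"

end

theory Submission
  imports Defs
begin

text \<open>The coordinates \<open>x = V y\<close> decouple the problem into the canonical blocks. The nilpotent block
  \<open>N y' = y + f\<close> has exactly one solution, computed component by component. The overdetermined
  block becomes a nilpotent one for \<open>z = K\<^sup>T y\<close>, with the constraint that the last component of each
  sub-block of \<open>z\<close> vanishes, which is (b). An underdetermined block admits a nonzero homogeneous
  solution vanishing at both end points, so it excludes uniqueness. The ordinary differential
  equation leaves a free initial value \<open>c\<close>, for which the boundary condition reads \<open>Q c = dhat\<close>.\<close>

section \<open>Calculus on a compact interval\<close>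

text \<open>The equation is imposed only on the open interval, while the values of a solution are
  compared on the closed one. The scalar equations of the differential and the nilpotent blocks are
  therefore extended to the end points by continuity, with one-sided derivatives there. Vectors
  carry no topology, so the analysis is done entry by entry and the block structure is flattened:
  each row index has an offset inside its block and the size of that block. The regularity
  assumptions force this bookkeeping. A block of size a is only a times differentiable, but the sums
  run up to the size of the largest block, so every term beyond a block's own size must be seen to
  vanish before anything is differentiated. Necessity of (a) rests on uniqueness alone: a given
  solution is perturbed, and the underdetermined blocks are never solved. Once they are absent,
  their component has length 0. Under (b), solutions then correspond bijectively to the admissible
  initial values c, so that (c) and (d) are existence and uniqueness for a linear system.\<close>

lemma deriv_on_eqI:
  assumes "0 < T" "t \<in> {0..T}" "(g has_real_derivative D) (at t within {0..T})"
  shows "deriv_on T g t = D"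
  unfolding deriv_on_def using assms
  by (intro vector_derivative_within_closed_interval)
    (auto simp: has_real_derivative_iff_has_vector_derivative)

lemma has_derivative_deriv_on:
  assumes "g differentiable_on {0..T}" "t \<in> {0..T}"
  shows "(g has_real_derivative deriv_on T g t) (at t within {0..T})"
  using assms unfolding deriv_on_def has_real_derivative_iff_has_vector_derivative
    differentiable_on_def by (simp add: vector_derivative_works)

text \<open>Holds even where no derivative exists: \<open>vector_derivative\<close> chooses from a
  predicate that depends only on the values on the interval.\<close>

lemma deriv_on_cong:
  assumes "\<And>s. s \<in> {0..T} \<Longrightarrow> g s = h s" "t \<in> {0..T}"
  shows "deriv_on T g t = deriv_on T h t"
proof -
  have "(g has_vector_derivative D) (at t within {0..T}) \<longleftrightarrow>
    (h has_vector_derivative D) (at t within {0..T})" for D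
    using assms by (metis has_vector_derivative_transform)
  then show ?thesis
    unfolding deriv_on_def vector_derivative_def by simp
qed

lemma deriv_on_funpow_cong:
  assumes "\<And>s. s \<in> {0..T} \<Longrightarrow> g s = h s" "t \<in> {0..T}"
  shows "(deriv_on T ^^ i) g t = (deriv_on T ^^ i) h t"
  using assms(2) by (induction i arbitrary: t) (auto simp: assms(1) intro: deriv_on_cong)

lemma Ck_on_cong:
  assumes "\<And>s. s \<in> {0..T} \<Longrightarrow> g s = h s"
  shows "Ck_on T k g \<longleftrightarrow> Ck_on T k h"
  using assms
proof (induction k arbitrary: g h)
  case 0
  then show ?case using continuous_on_cong[of "{0..T}" "{0..T}" g h] by simp
next
  case (Suc k)
  have "g differentiable_on {0..T} \<longleftrightarrow> h differentiable_on {0..T}"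
    using Suc.prems unfolding differentiable_on_def differentiable_def
    by (metis has_derivative_transform)
  moreover have "Ck_on T k (deriv_on T g) \<longleftrightarrow> Ck_on T k (deriv_on T h)"
    using Suc.prems by (intro Suc.IH deriv_on_cong) auto
  ultimately show ?case by simp
qed

lemma Ck_on_mono: "Ck_on T k g \<Longrightarrow> j \<le> k \<Longrightarrow> Ck_on T j g"
proof (induction k arbitrary: j g)
  case (Suc k)
  then show ?case
    by (cases j) (auto intro: differentiable_imp_continuous_on)
qed simp

lemma Ck_on_imp_continuous_on: "Ck_on T k g \<Longrightarrow> continuous_on {0..T} g"
  using Ck_on_mono[of T k g 0] by simp

text \<open>Since \<open>0 < T\<close>, derivatives within the interval are unique, so continuity of
  \<open>deriv_on\<close> can be read off any explicit formula for the derivative.\<close>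

lemma Ck_on_1I:
  assumes "0 < T" and "continuous_on {0..T} g'"
    and "\<And>t. t \<in> {0..T} \<Longrightarrow> (g has_real_derivative g' t) (at t within {0..T})"
  shows "Ck_on T 1 g"
proof -
  have "deriv_on T g t = g' t" if "t \<in> {0..T}" for t
    using deriv_on_eqI[OF assms(1) that assms(3)[OF that]] .
  then have "continuous_on {0..T} (deriv_on T g)"
    using assms(2) continuous_on_cong[of "{0..T}" "{0..T}" "deriv_on T g" g'] by simp
  moreover have "g differentiable_on {0..T}"
    using assms(3) unfolding differentiable_on_def
    by (metis real_differentiable_def)
  ultimately show ?thesis by simp
qed

lemma Ck_on_funpow: "Ck_on T (i + k) g \<Longrightarrow> Ck_on T k ((deriv_on T ^^ i) g)"
proof (induction i arbitrary: g)
  case (Suc i)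
  then show ?case by (auto simp: funpow_swap1)
qed simp

lemma has_derivative_funpow_deriv_on:
  assumes "Ck_on T k g" "i < k" "t \<in> {0..T}"
  shows "((deriv_on T ^^ i) g has_real_derivative (deriv_on T ^^ Suc i) g t) (at t within {0..T})"
proof -
  have "Ck_on T 1 ((deriv_on T ^^ i) g)"
    using assms(1,2) Ck_on_mono[of T k g "i + 1"] by (intro Ck_on_funpow) auto
  then show ?thesis
    using has_derivative_deriv_on[OF _ assms(3)] by simp
qed

lemma continuous_on_funpow_deriv_on:
  assumes "Ck_on T k g" "i \<le> k"
  shows "continuous_on {0..T} ((deriv_on T ^^ i) g)"
  using assms Ck_on_funpow[of T i 0 g] Ck_on_mono[of T k g i] by simp

lemma deriv_on_sum:
  assumes "0 < T" "t \<in> {0..T}" "\<And>j. j \<in> J \<Longrightarrow> Ck_on T 1 (g j)"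
  shows "deriv_on T (\<lambda>s. \<Sum>j\<in>J. a j * g j s) t = (\<Sum>j\<in>J. a j * deriv_on T (g j) t)"
  using assms by (intro deriv_on_eqI DERIV_sum DERIV_cmult has_derivative_deriv_on) auto

lemma Ck_on_1_sum:
  assumes "0 < T" "\<And>j. j \<in> J \<Longrightarrow> Ck_on T 1 (g j)"
  shows "Ck_on T 1 (\<lambda>s. \<Sum>j\<in>J. a j * g j s)"
  using assms
  by (intro Ck_on_1I[where g' = "\<lambda>t. \<Sum>j\<in>J. a j * deriv_on T (g j) t"]
      DERIV_sum DERIV_cmult has_derivative_deriv_on continuous_intros) auto

text \<open>Carries equations required only on the open interval to the end points, because that
  interval is dense in the closed one.\<close>

lemma eq_on_closed_interval:
  fixes g h :: "real \<Rightarrow> real"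
  assumes T: "0 < T" and "continuous_on {0..T} g" "continuous_on {0..T} h"
    and "\<And>t. t \<in> {0<..<T} \<Longrightarrow> g t = h t" and t: "t \<in> {0..T}"
  shows "g t = h t"
proof -
  have *: "closure {0<..<T} = {0..T}" using T by simp
  have "g t - h t = 0"
    by (rule continuous_constant_on_closure[of "{0<..<T}" "\<lambda>t. g t - h t"])
      (use assms in \<open>auto simp: * intro!: continuous_intros\<close>)
  then show ?thesis by simp
qed

lemma has_real_derivative_transform:
  assumes "(g has_real_derivative D) (at t within S)" "t \<in> S" "\<And>s. s \<in> S \<Longrightarrow> g s = h s"
  shows "(h has_real_derivative D) (at t within S)"
  by (rule has_field_derivative_transform_within[OF assms(1), of 1]) (use assms in auto)

section \<open>Vector-valued functions, componentwise\<close>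

lemma Ck_vec_on_carrier: "Ck_vec_on T k n g \<Longrightarrow> t \<in> {0..T} \<Longrightarrow> g t \<in> carrier_vec n"
  unfolding Ck_vec_on_def by auto

lemma Ck_vec_on_cong:
  assumes "\<And>t. t \<in> {0..T} \<Longrightarrow> g t = h t"
  shows "Ck_vec_on T k n g \<longleftrightarrow> Ck_vec_on T k n h"
proof -
  have "Ck_on T k (\<lambda>t. g t $ j) \<longleftrightarrow> Ck_on T k (\<lambda>t. h t $ j)" for j
    by (rule Ck_on_cong) (simp add: assms)
  then show ?thesis
    unfolding Ck_vec_on_def by (auto simp: assms)
qed

lemma nderiv_vec_carrier [simp]: "g t \<in> carrier_vec n \<Longrightarrow> nderiv_vec T i g t \<in> carrier_vec n"
  unfolding nderiv_vec_def by auto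

lemma dim_nderiv_vec [simp]: "dim_vec (nderiv_vec T i g t) = dim_vec (g t)"
  unfolding nderiv_vec_def by auto

lemma nderiv_vec_1_index [simp]:
  "j < dim_vec (g t) \<Longrightarrow> nderiv_vec T (Suc 0) g t $ j = deriv_on T (\<lambda>s. g s $ j) t"
  unfolding nderiv_vec_def by auto

lemma nderiv_vec_cong:
  assumes "\<And>s. s \<in> {0..T} \<Longrightarrow> g s = h s" "t \<in> {0..T}"
  shows "nderiv_vec T i g t = nderiv_vec T i h t"
proof -
  have "(deriv_on T ^^ i) (\<lambda>s. g s $ j) t = (deriv_on T ^^ i) (\<lambda>s. h s $ j) t" for j
    using assms by (intro deriv_on_funpow_cong) auto
  then show ?thesis
    unfolding nderiv_vec_def using assms by simp
qed

lemma mult_mat_vec_index: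
  "M \<in> carrier_mat p q \<Longrightarrow> v \<in> carrier_vec q \<Longrightarrow> i < p \<Longrightarrow>
    (M *\<^sub>v v) $ i = (\<Sum>j<q. M $$ (i, j) * v $ j)"
  by (auto simp: scalar_prod_def lessThan_atLeast0 intro!: sum.cong)

text \<open>Constant matrices commute with differentiation. This serves the coordinate change V as
  well as the passage between y and its image under the transposed K.\<close>

lemma mult_mat_vec_Ck:
  assumes T: "0 < T" and M: "M \<in> carrier_mat p q" and g: "Ck_vec_on T 1 q g"
  shows "Ck_vec_on T 1 p (\<lambda>t. M *\<^sub>v g t)"
    and "t \<in> {0..T} \<Longrightarrow> nderiv_vec T 1 (\<lambda>t. M *\<^sub>v g t) t = M *\<^sub>v nderiv_vec T 1 g t"
proof -
  have eq: "(M *\<^sub>v g t) $ i = (\<Sum>j<q. M $$ (i, j) * g t $ j)" if "i < p" "t \<in> {0..T}" for i t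
    using mult_mat_vec_index[OF M Ck_vec_on_carrier[OF g]] that by simp
  have gj: "Ck_on T 1 (\<lambda>t. g t $ j)" if "j < q" for j
    using g that unfolding Ck_vec_on_def by auto
  show "Ck_vec_on T 1 p (\<lambda>t. M *\<^sub>v g t)"
    unfolding Ck_vec_on_def
  proof (intro conjI ballI allI impI)
    fix i assume i: "i < p"
    have "Ck_on T 1 (\<lambda>t. \<Sum>j<q. M $$ (i, j) * g t $ j)"
      using gj T by (intro Ck_on_1_sum) auto
    then show "Ck_on T 1 (\<lambda>t. (M *\<^sub>v g t) $ i)"
      using Ck_on_cong[of T "\<lambda>t. (M *\<^sub>v g t) $ i", OF eq[OF i]] by blast
  qed (use mult_mat_vec_carrier[OF M Ck_vec_on_carrier[OF g]] in auto)
  assume t: "t \<in> {0..T}"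
  show "nderiv_vec T 1 (\<lambda>t. M *\<^sub>v g t) t = M *\<^sub>v nderiv_vec T 1 g t"
  proof (rule eq_vecI)
    fix i assume "i < dim_vec (M *\<^sub>v nderiv_vec T 1 g t)"
    then have i: "i < p" using M by simp
    have "nderiv_vec T 1 (\<lambda>t. M *\<^sub>v g t) t $ i = deriv_on T (\<lambda>t. (M *\<^sub>v g t) $ i) t"
      using i M by simp
    also have "\<dots> = deriv_on T (\<lambda>t. \<Sum>j<q. M $$ (i, j) * g t $ j) t"
      using eq[OF i] t by (rule deriv_on_cong)
    also have "\<dots> = (\<Sum>j<q. M $$ (i, j) * deriv_on T (\<lambda>t. g t $ j) t)"
      using gj T t by (intro deriv_on_sum) auto
    also have "\<dots> = (M *\<^sub>v nderiv_vec T 1 g t) $ i"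
      using mult_mat_vec_index[OF M nderiv_vec_carrier[of g t q T 1, OF Ck_vec_on_carrier[OF g t]] i]
        Ck_vec_on_carrier[OF g t] by simp
    finally show "nderiv_vec T 1 (\<lambda>t. M *\<^sub>v g t) t $ i = (M *\<^sub>v nderiv_vec T 1 g t) $ i" .
  qed (use M in simp)
qed

lemma mult_mat_index:
  "M \<in> carrier_mat p q \<Longrightarrow> M' \<in> carrier_mat q r \<Longrightarrow> i < p \<Longrightarrow> j < r \<Longrightarrow>
    (M * M') $$ (i, j) = (\<Sum>k<q. M $$ (i, k) * M' $$ (k, j))"
  by (auto simp: scalar_prod_def lessThan_atLeast0 intro!: sum.cong)

lemma pow_mat_Suc_left:
  assumes "M \<in> carrier_mat n n"
  shows "M ^\<^sub>m Suc k = M * M ^\<^sub>m k"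
proof (induction k)
  case (Suc k)
  have "M ^\<^sub>m Suc (Suc k) = (M * M ^\<^sub>m k) * M"
    using Suc by simp
  also have "\<dots> = M * (M ^\<^sub>m k * M)"
    using assms by (intro assoc_mult_mat) auto
  finally show ?case by simp
qed (use assms in simp)

section \<open>The matrix exponential and linear differential equations\<close>

text \<open>Turns each entry of \<open>mat_exp (t \<cdot>\<^sub>m M)\<close> into a real power
  series in t, to which termwise differentiation applies.\<close>

lemma pow_mat_smult_index:
  fixes t :: real
  assumes "M \<in> carrier_mat n n" "i < n" "j < n"
  shows "((t \<cdot>\<^sub>m M) ^\<^sub>m k) $$ (i, j) = t ^ k * (M ^\<^sub>m k) $$ (i, j)"
  using assms(3)
proof (induction k arbitrary: j)
  case 0
  then show ?case using assms by (simp add: one_mat_def)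
next
  case (Suc k)
  have "((t \<cdot>\<^sub>m M) ^\<^sub>m Suc k) $$ (i, j) =
    (\<Sum>l<n. ((t \<cdot>\<^sub>m M) ^\<^sub>m k) $$ (i, l) * (t \<cdot>\<^sub>m M) $$ (l, j))"
    unfolding pow_mat.simps using assms Suc.prems by (intro mult_mat_index pow_carrier_mat) auto
  also have "\<dots> = t ^ Suc k * (\<Sum>l<n. (M ^\<^sub>m k) $$ (i, l) * M $$ (l, j))"
    using assms Suc by (simp add: sum_distrib_left mult_ac)
  also have "(\<Sum>l<n. (M ^\<^sub>m k) $$ (i, l) * M $$ (l, j)) = (M ^\<^sub>m Suc k) $$ (i, j)"
    unfolding pow_mat.simps using assms Suc.prems
    by (intro mult_mat_index[symmetric] pow_carrier_mat) auto
  finally show ?case .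
qed

text \<open>The sum of the absolute values of all entries dominates every column sum, so one
  constant serves all entries and all powers.\<close>

lemma pow_mat_bound:
  fixes M :: "real mat"
  assumes M: "M \<in> carrier_mat n n"
  obtains c where "\<And>k i j. i < n \<Longrightarrow> j < n \<Longrightarrow> \<bar>(M ^\<^sub>m k) $$ (i, j)\<bar> \<le> c ^ k"
proof
  let ?c = "\<Sum>j<n. \<Sum>i<n. \<bar>M $$ (i, j)\<bar>"
  show "\<bar>(M ^\<^sub>m k) $$ (i, j)\<bar> \<le> ?c ^ k" if "i < n" "j < n" for k i j
    using that
  proof (induction k arbitrary: j)
    case 0
    then show ?case using M by (simp add: one_mat_def)
  next
    case (Suc k)
    have "(M ^\<^sub>m Suc k) $$ (i, j) = (\<Sum>l<n. (M ^\<^sub>m k) $$ (i, l) * M $$ (l, j))"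
      unfolding pow_mat.simps using M Suc.prems by (intro mult_mat_index pow_carrier_mat) auto
    also have "\<bar>\<dots>\<bar> \<le> (\<Sum>l<n. ?c ^ k * \<bar>M $$ (l, j)\<bar>)"
      using Suc by (intro sum_abs[THEN order_trans] sum_mono) (auto simp: abs_mult intro!: mult_right_mono)
    also have "\<dots> \<le> ?c ^ k * ?c"
      unfolding sum_distrib_left[symmetric]
      by (intro mult_left_mono member_le_sum[where f = "\<lambda>j. \<Sum>i<n. \<bar>M $$ (i, j)\<bar>"])
        (use Suc.prems in \<open>auto intro!: sum_nonneg zero_le_power\<close>)
    finally show ?case by (simp add: mult.commute)
  qed
qed

lemma mat_exp_carrier [simp]: "M \<in> carrier_mat n n \<Longrightarrow> mat_exp M \<in> carrier_mat n n"
  unfolding mat_exp_def by auto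

text \<open>The geometric bound on the powers makes the exponential series of
  \<open>c * \<bar>t\<bar>\<close> a majorant, so the series converges for every t.\<close>

lemma mat_exp_power_series:
  fixes M :: "real mat"
  assumes M: "M \<in> carrier_mat n n" and ij: "i < n" "j < n"
  shows "summable (\<lambda>k. (M ^\<^sub>m k) $$ (i, j) / fact k * t ^ k)"
    and "mat_exp (t \<cdot>\<^sub>m M) $$ (i, j) = (\<Sum>k. (M ^\<^sub>m k) $$ (i, j) / fact k * t ^ k)"
proof -
  obtain c where c: "\<And>k i j. i < n \<Longrightarrow> j < n \<Longrightarrow> \<bar>(M ^\<^sub>m k) $$ (i, j)\<bar> \<le> c ^ k"
    using pow_mat_bound[OF M] by blast
  show "summable (\<lambda>k. (M ^\<^sub>m k) $$ (i, j) / fact k * t ^ k)"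
  proof (rule summable_comparison_test')
    show "summable (\<lambda>k. inverse (fact k) * (c * \<bar>t\<bar>) ^ k)"
      by (rule summable_exp)
    show "norm ((M ^\<^sub>m k) $$ (i, j) / fact k * t ^ k) \<le> inverse (fact k) * (c * \<bar>t\<bar>) ^ k" for k
      using mult_right_mono[OF c[OF ij], of "\<bar>t\<bar> ^ k / fact k" k]
      by (simp add: abs_mult power_mult_distrib power_abs field_simps)
  qed
  show "mat_exp (t \<cdot>\<^sub>m M) $$ (i, j) = (\<Sum>k. (M ^\<^sub>m k) $$ (i, j) / fact k * t ^ k)"
    unfolding mat_exp_def using M ij by (simp add: pow_mat_smult_index[OF M ij] mult_ac)
qed

lemma mat_exp_0:
  fixes M :: "real mat"
  assumes M: "M \<in> carrier_mat n n"
  shows "mat_exp (0 \<cdot>\<^sub>m M) = 1\<^sub>m n"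
proof (rule eq_matI)
  fix i j assume "i < dim_row (1\<^sub>m n :: real mat)" "j < dim_col (1\<^sub>m n :: real mat)"
  then have "i < n" "j < n" by auto
  then show "mat_exp (0 \<cdot>\<^sub>m M) $$ (i, j) = 1\<^sub>m n $$ (i, j)"
    using mat_exp_power_series(2)[OF M, of i j 0] M
      powser_zero[of "\<lambda>k. (M ^\<^sub>m k) $$ (i, j) / fact k"] by simp
qed (use M in \<open>auto simp: mat_exp_def\<close>)

text \<open>Termwise differentiation cancels one factor of the factorial, so only the power of M is
  shifted. The next two lemmas split this power on either side.\<close>

lemma mat_exp_derivative_series:
  fixes M :: "real mat"
  assumes M: "M \<in> carrier_mat n n" and ij: "i < n" "j < n"
  shows "((\<lambda>t. mat_exp (t \<cdot>\<^sub>m M) $$ (i, j)) has_real_derivative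
    (\<Sum>k. (M ^\<^sub>m Suc k) $$ (i, j) / fact k * t ^ k)) (at t)"
proof -
  let ?c = "\<lambda>k. (M ^\<^sub>m k) $$ (i, j) / fact k"
  have "diffs ?c = (\<lambda>k. (M ^\<^sub>m Suc k) $$ (i, j) / fact k)"
    by (rule ext) (simp add: diffs_def del: pow_mat.simps of_nat_Suc)
  moreover have "((\<lambda>t. \<Sum>k. ?c k * t ^ k) has_real_derivative (\<Sum>k. diffs ?c k * t ^ k)) (at t)"
    using mat_exp_power_series(1)[OF M ij] by (intro termdiffs_strong_converges_everywhere)
  ultimately show ?thesis
    using mat_exp_power_series(2)[OF M ij] by simp
qed

text \<open>Both factorizations of \<open>M ^\<^sub>m Suc k\<close> are used. With M on the right,
  the derivative of an integrating factor cancels against the term \<open>M y\<close> of the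
  equation; with M on the left, the exponential itself satisfies the equation.\<close>

lemma mat_exp_derivative_right:
  fixes M :: "real mat"
  assumes M: "M \<in> carrier_mat n n" and ij: "i < n" "j < n"
  shows "((\<lambda>t. mat_exp (t \<cdot>\<^sub>m M) $$ (i, j)) has_real_derivative
    (\<Sum>l<n. mat_exp (t \<cdot>\<^sub>m M) $$ (i, l) * M $$ (l, j))) (at t)"
proof -
  have "(M ^\<^sub>m Suc k) $$ (i, j) / fact k * t ^ k =
    (\<Sum>l<n. (M ^\<^sub>m k) $$ (i, l) / fact k * t ^ k * M $$ (l, j))" for k
    unfolding pow_mat.simps using mult_mat_index[OF pow_carrier_mat[OF M] M ij, of k]
    by (simp add: sum_distrib_left sum_distrib_right sum_divide_distrib mult_ac)
  then have "(\<Sum>k. (M ^\<^sub>m Suc k) $$ (i, j) / fact k * t ^ k) =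
    (\<Sum>k. \<Sum>l<n. (M ^\<^sub>m k) $$ (i, l) / fact k * t ^ k * M $$ (l, j))"
    by simp
  also have "\<dots> = (\<Sum>l<n. \<Sum>k. (M ^\<^sub>m k) $$ (i, l) / fact k * t ^ k * M $$ (l, j))"
    using mat_exp_power_series(1)[OF M] ij by (intro suminf_sum summable_mult2) auto
  also have "\<dots> = (\<Sum>l<n. mat_exp (t \<cdot>\<^sub>m M) $$ (i, l) * M $$ (l, j))"
  proof (rule sum.cong[OF refl])
    fix l assume "l \<in> {..<n}"
    then have l: "l < n" by simp
    show "(\<Sum>k. (M ^\<^sub>m k) $$ (i, l) / fact k * t ^ k * M $$ (l, j)) =
        mat_exp (t \<cdot>\<^sub>m M) $$ (i, l) * M $$ (l, j)"
      unfolding mat_exp_power_series(2)[OF M ij(1) l]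
      by (rule suminf_mult2[symmetric, OF mat_exp_power_series(1)[OF M ij(1) l]])
  qed
  finally show ?thesis
    using mat_exp_derivative_series[OF M ij, of t] by simp
qed

lemma mat_exp_derivative_left:
  fixes M :: "real mat"
  assumes M: "M \<in> carrier_mat n n" and ij: "i < n" "j < n"
  shows "((\<lambda>t. mat_exp (t \<cdot>\<^sub>m M) $$ (i, j)) has_real_derivative
    (\<Sum>l<n. M $$ (i, l) * mat_exp (t \<cdot>\<^sub>m M) $$ (l, j))) (at t)"
proof -
  have "(M ^\<^sub>m Suc k) $$ (i, j) / fact k * t ^ k =
    (\<Sum>l<n. M $$ (i, l) * ((M ^\<^sub>m k) $$ (l, j) / fact k * t ^ k))" for k
    unfolding pow_mat_Suc_left[OF M] using mult_mat_index[OF M pow_carrier_mat[OF M] ij, of k]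
    by (simp add: sum_distrib_left sum_distrib_right sum_divide_distrib mult_ac)
  then have "(\<Sum>k. (M ^\<^sub>m Suc k) $$ (i, j) / fact k * t ^ k) =
    (\<Sum>k. \<Sum>l<n. M $$ (i, l) * ((M ^\<^sub>m k) $$ (l, j) / fact k * t ^ k))"
    by simp
  also have "\<dots> = (\<Sum>l<n. \<Sum>k. M $$ (i, l) * ((M ^\<^sub>m k) $$ (l, j) / fact k * t ^ k))"
    using mat_exp_power_series(1)[OF M] ij by (intro suminf_sum summable_mult) auto
  also have "\<dots> = (\<Sum>l<n. M $$ (i, l) * mat_exp (t \<cdot>\<^sub>m M) $$ (l, j))"
  proof (rule sum.cong[OF refl])
    fix l assume "l \<in> {..<n}"
    then have l: "l < n" by simp
    show "(\<Sum>k. M $$ (i, l) * ((M ^\<^sub>m k) $$ (l, j) / fact k * t ^ k)) =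
        M $$ (i, l) * mat_exp (t \<cdot>\<^sub>m M) $$ (l, j)"
      unfolding mat_exp_power_series(2)[OF M l ij(2)]
      by (rule suminf_mult[OF mat_exp_power_series(1)[OF M l ij(2)]])
  qed
  finally show ?thesis
    using mat_exp_derivative_series[OF M ij, of t] by simp
qed

lemma mat_exp_continuous_on:
  fixes M :: "real mat"
  assumes "M \<in> carrier_mat n n" "i < n" "j < n"
  shows "continuous_on S (\<lambda>t. mat_exp (t \<cdot>\<^sub>m M) $$ (i, j))"
  using mat_exp_derivative_right[OF assms]
  by (meson DERIV_isCont continuous_at_imp_continuous_on)

section \<open>Addition law and variation of constants\<close>

lemma mat_exp_derivative_reflect:
  fixes M :: "real mat"
  assumes M: "M \<in> carrier_mat n n" and ij: "i < n" "j < n"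
  shows "((\<lambda>s. mat_exp ((t - s) \<cdot>\<^sub>m M) $$ (i, j)) has_real_derivative
    - (\<Sum>l<n. mat_exp ((t - s) \<cdot>\<^sub>m M) $$ (i, l) * M $$ (l, j))) (at s within S)"
proof -
  have "((\<lambda>s. t - s) has_real_derivative -1) (at s within S)"
    by (auto intro!: derivative_eq_intros)
  from DERIV_chain2[OF mat_exp_derivative_right[OF M ij] this]
  show ?thesis by simp
qed

text \<open>The product of the exponentials at \<open>a + b - r\<close> and \<open>r\<close> does
  not depend on r. The values r = 0 and r = b give the two sides.\<close>

lemma mat_exp_add:
  fixes M :: "real mat"
  assumes M: "M \<in> carrier_mat n n" and ij: "i < n" "j < n"
  shows "mat_exp ((a + b) \<cdot>\<^sub>m M) $$ (i, j) =
    (\<Sum>l<n. mat_exp (a \<cdot>\<^sub>m M) $$ (i, l) * mat_exp (b \<cdot>\<^sub>m M) $$ (l, j))"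
proof -
  let ?P = "\<lambda>i j t. mat_exp (t \<cdot>\<^sub>m M) $$ (i, j)"
  let ?g = "\<lambda>r. \<Sum>l<n. ?P i l (a + b - r) * ?P l j r"
  have "(?g has_real_derivative 0) (at r)" for r
  proof -
    have "(?g has_real_derivative (\<Sum>l<n. - (\<Sum>k<n. ?P i k (a + b - r) * M $$ (k, l)) * ?P l j r
        + (\<Sum>k<n. M $$ (l, k) * ?P k j r) * ?P i l (a + b - r))) (at r)"
      using ij by (intro DERIV_sum DERIV_mult mat_exp_derivative_left[OF M]
          mat_exp_derivative_reflect[OF M]) auto
    \<comment> \<open>Both terms of the product rule are the same entry of a triple product with M
      in the middle, so they cancel after the summation indices are exchanged.\<close>
    moreover have "(\<Sum>l<n. \<Sum>k<n. ?P i k (a + b - r) * M $$ (k, l) * ?P l j r) =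
      (\<Sum>l<n. \<Sum>k<n. ?P i l (a + b - r) * M $$ (l, k) * ?P k j r)"
      by (rule sum.swap)
    ultimately show ?thesis
      by (simp add: sum.distrib sum_negf sum_subtractf sum_distrib_right sum_distrib_left mult_ac)
  qed
  then have "?g 0 = ?g b"
    using DERIV_isconst_all[of ?g] by blast
  then show ?thesis
    using ij mat_exp_0[OF M] by (simp add: one_mat_def if_distrib sum.delta cong: if_cong)
qed

text \<open>Integrating factor: for fixed t, the function s \<mapsto> exp((t - s) M) y(s) has
  derivative exp((t - s) M) g(s). Integration from 0 to t gives the formula, with y(t) as the value
  at s = t.\<close>

lemma linear_ode_unique:
  fixes M :: "real mat"
  assumes T: "0 < T" and M: "M \<in> carrier_mat n n"
    and g: "Ck_vec_on T 0 n g" and y: "Ck_vec_on T 1 n y"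
    and ode: "\<And>t. t \<in> {0<..<T} \<Longrightarrow> nderiv_vec T 1 y t = M *\<^sub>v y t + g t"
    and t: "t \<in> {0..T}"
  shows "y t = mat_exp (t \<cdot>\<^sub>m M) *\<^sub>v y 0 +
    integral_vec n {0..t} (\<lambda>s. mat_exp ((t - s) \<cdot>\<^sub>m M) *\<^sub>v g s)"
proof (rule eq_vecI)
  let ?P = "\<lambda>i j t. mat_exp (t \<cdot>\<^sub>m M) $$ (i, j)"
  have gc: "g s \<in> carrier_vec n" and yc: "y s \<in> carrier_vec n" if "s \<in> {0..T}" for s
    using g y that unfolding Ck_vec_on_def by auto
  have gj: "continuous_on {0..T} (\<lambda>s. g s $ j)" and yj: "Ck_on T 1 (\<lambda>s. y s $ j)" if "j < n" for j
    using g y that unfolding Ck_vec_on_def by auto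
  \<comment> \<open>The equation is known on the open interval only; both sides are continuous, so
    it also gives the one-sided derivatives at the ends.\<close>
  have dy: "((\<lambda>s. y s $ j) has_real_derivative (\<Sum>k<n. M $$ (j, k) * y s $ k) + g s $ j)
    (at s within {0..T})" if j: "j < n" and s: "s \<in> {0..T}" for j s
  proof -
    have "deriv_on T (\<lambda>s. y s $ j) s = (\<Sum>k<n. M $$ (j, k) * y s $ k) + g s $ j"
    proof (rule eq_on_closed_interval[OF T _ _ _ s])
      show "continuous_on {0..T} (\<lambda>s. (\<Sum>k<n. M $$ (j, k) * y s $ k) + g s $ j)"
        using gj j Ck_on_imp_continuous_on[OF yj] by (intro continuous_intros) auto
      fix u assume u: "u \<in> {0<..<T}"
      then have u': "u \<in> {0..T}" by simp
      have "nderiv_vec T 1 y u $ j = (M *\<^sub>v y u + g u) $ j"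
        using ode[OF u] by simp
      then show "deriv_on T (\<lambda>s. y s $ j) u = (\<Sum>k<n. M $$ (j, k) * y u $ k) + g u $ j"
        using gc[OF u'] yc[OF u'] j M mult_mat_vec_index[OF M yc[OF u'] j] by simp
    qed (use yj[OF j] in simp)
    then show ?thesis
      using has_derivative_deriv_on[of "\<lambda>s. y s $ j" T s] yj[OF j] s by simp
  qed
  have sub: "{0..t} \<subseteq> {0..T}" using t by auto
  have 0: "0 \<in> {0..T}" using T by simp
  show "dim_vec (y t) = dim_vec (mat_exp (t \<cdot>\<^sub>m M) *\<^sub>v y 0 +
    integral_vec n {0..t} (\<lambda>s. mat_exp ((t - s) \<cdot>\<^sub>m M) *\<^sub>v g s))"
    using yc[OF t] by (simp add: integral_vec_def)
  fix i assume "i < dim_vec (mat_exp (t \<cdot>\<^sub>m M) *\<^sub>v y 0 +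
    integral_vec n {0..t} (\<lambda>s. mat_exp ((t - s) \<cdot>\<^sub>m M) *\<^sub>v g s))"
  then have i: "i < n" by (simp add: integral_vec_def)
  let ?h = "\<lambda>s. \<Sum>j<n. ?P i j (t - s) * y s $ j"
  have "(?h has_real_derivative (\<Sum>j<n. ?P i j (t - s) * g s $ j)) (at s within {0..t})"
    if s: "s \<in> {0..t}" for s
  proof -
    have "(?h has_real_derivative (\<Sum>j<n. - (\<Sum>k<n. ?P i k (t - s) * M $$ (k, j)) * y s $ j
        + ((\<Sum>k<n. M $$ (j, k) * y s $ k) + g s $ j) * ?P i j (t - s))) (at s within {0..t})"
      using i s sub by (intro DERIV_sum DERIV_mult mat_exp_derivative_reflect[OF M]
          DERIV_subset[OF dy sub]) auto
    moreover have "(\<Sum>j<n. \<Sum>k<n. ?P i k (t - s) * M $$ (k, j) * y s $ j) =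
        (\<Sum>j<n. \<Sum>k<n. ?P i j (t - s) * M $$ (j, k) * y s $ k)"
      by (rule sum.swap)
    ultimately show ?thesis
      by (simp add: sum.distrib sum_negf sum_subtractf sum_distrib_right sum_distrib_left
          distrib_left mult_ac)
  qed
  then have "((\<lambda>s. \<Sum>j<n. ?P i j (t - s) * g s $ j) has_integral ?h t - ?h 0) {0..t}"
    using t by (intro fundamental_theorem_of_calculus)
      (auto simp: has_real_derivative_iff_has_vector_derivative)
  moreover have "?h t = y t $ i"
    using i mat_exp_0[OF M] by (simp add: one_mat_def if_distrib[of "\<lambda>x. x * _"] cong: if_cong)
  moreover have "?h 0 = (mat_exp (t \<cdot>\<^sub>m M) *\<^sub>v y 0) $ i"
    using mult_mat_vec_index[OF mat_exp_carrier yc[OF 0] i, of "t \<cdot>\<^sub>m M"] M by simp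
  moreover have "((\<lambda>s. (mat_exp ((t - s) \<cdot>\<^sub>m M) *\<^sub>v g s) $ i) has_integral I) {0..t} \<longleftrightarrow>
      ((\<lambda>s. \<Sum>j<n. ?P i j (t - s) * g s $ j) has_integral I) {0..t}" for I
    using i M gc sub by (intro has_integral_cong mult_mat_vec_index[OF mat_exp_carrier]) auto
  ultimately have "integral {0..t} (\<lambda>s. (mat_exp ((t - s) \<cdot>\<^sub>m M) *\<^sub>v g s) $ i) =
      y t $ i - (mat_exp (t \<cdot>\<^sub>m M) *\<^sub>v y 0) $ i"
    by (intro integral_unique) simp
  then show "y t $ i = (mat_exp (t \<cdot>\<^sub>m M) *\<^sub>v y 0 +
      integral_vec n {0..t} (\<lambda>s. mat_exp ((t - s) \<cdot>\<^sub>m M) *\<^sub>v g s)) $ i"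
    using i by (simp add: integral_vec_def)
qed

text \<open>In the convolution, t occurs both as integration limit and inside the integrand. The
  addition law takes exp(t M) out of the integral, leaving an integrand in s alone, to which the
  fundamental theorem and the product rule apply.\<close>

lemma linear_ode_exists:
  fixes M :: "real mat"
  assumes T: "0 < T" and M: "M \<in> carrier_mat n n"
    and g: "Ck_vec_on T 0 n g" and c: "c \<in> carrier_vec n"
  defines "y \<equiv> \<lambda>t. mat_exp (t \<cdot>\<^sub>m M) *\<^sub>v c +
    integral_vec n {0..t} (\<lambda>s. mat_exp ((t - s) \<cdot>\<^sub>m M) *\<^sub>v g s)"
  shows "Ck_vec_on T 1 n y"
    and "t \<in> {0..T} \<Longrightarrow> nderiv_vec T 1 y t = M *\<^sub>v y t + g t"
proof -
  let ?P = "\<lambda>i j t. mat_exp (t \<cdot>\<^sub>m M) $$ (i, j)"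
  let ?G = "\<lambda>l t. integral {0..t} (\<lambda>s. \<Sum>j<n. ?P l j (- s) * g s $ j)"
  have gc: "g s \<in> carrier_vec n" if "s \<in> {0..T}" for s
    using g that unfolding Ck_vec_on_def by auto
  have gj: "continuous_on {0..T} (\<lambda>s. g s $ j)" if "j < n" for j
    using g that unfolding Ck_vec_on_def by auto
  have yc: "y t \<in> carrier_vec n" for t
    unfolding y_def using mult_mat_vec_carrier[OF mat_exp_carrier[OF smult_carrier_mat[OF M]] c]
    by (intro add_carrier_vec) (auto simp: integral_vec_def)
  have cont: "continuous_on {0..T} (\<lambda>s. \<Sum>j<n. ?P l j (- s) * g s $ j)" if l: "l < n" for l
  proof -
    have "continuous_on {0..T} (\<lambda>s. ?P l j (- s))" if "j < n" for j
      by (rule continuous_on_compose2[OF mat_exp_continuous_on[OF M l that, of UNIV]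
            continuous_on_minus[OF continuous_on_id]]) auto
    then show ?thesis
      using gj by (intro continuous_on_sum continuous_on_mult) auto
  qed
  have G: "(?G l has_real_derivative (\<Sum>j<n. ?P l j (- t) * g t $ j)) (at t within {0..T})"
    if "l < n" "t \<in> {0..T}" for l t
    using integral_has_real_derivative[OF cont] that by blast
  have y_index: "y t $ i = (\<Sum>l<n. ?P i l t * (c $ l + ?G l t))" if i: "i < n" and t: "t \<in> {0..T}" for i t
  proof -
    have sub: "{0..t} \<subseteq> {0..T}" using t by auto
    have "integral {0..t} (\<lambda>s. (mat_exp ((t - s) \<cdot>\<^sub>m M) *\<^sub>v g s) $ i) =
      integral {0..t} (\<lambda>s. \<Sum>l<n. ?P i l t * (\<Sum>j<n. ?P l j (- s) * g s $ j))"
    proof (rule integral_cong)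
      fix s assume "s \<in> {0..t}"
      then have s: "s \<in> {0..T}" using sub by auto
      have "(mat_exp ((t - s) \<cdot>\<^sub>m M) *\<^sub>v g s) $ i = (\<Sum>j<n. ?P i j (t + - s) * g s $ j)"
        using M gc[OF s] i by (simp add: mult_mat_vec_index[OF mat_exp_carrier])
      also have "\<dots> = (\<Sum>j<n. (\<Sum>l<n. ?P i l t * ?P l j (- s)) * g s $ j)"
        by (intro sum.cong arg_cong2[where f = "(*)"] mat_exp_add[OF M i]) auto
      also have "\<dots> = (\<Sum>l<n. \<Sum>j<n. ?P i l t * ?P l j (- s) * g s $ j)"
        unfolding sum_distrib_right by (rule sum.swap)
      finally show "(mat_exp ((t - s) \<cdot>\<^sub>m M) *\<^sub>v g s) $ i =
          (\<Sum>l<n. ?P i l t * (\<Sum>j<n. ?P l j (- s) * g s $ j))"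
        by (simp add: sum_distrib_left mult_ac)
    qed
    also have "\<dots> = (\<Sum>l<n. integral {0..t} (\<lambda>s. ?P i l t * (\<Sum>j<n. ?P l j (- s) * g s $ j)))"
      by (rule integral_sum)
        (auto intro!: integrable_continuous_interval continuous_intros continuous_on_subset[OF cont sub])
    also have "\<dots> = (\<Sum>l<n. ?P i l t * ?G l t)"
      by simp
    finally show ?thesis
      using i M c mult_mat_vec_index[OF mat_exp_carrier c i, of "t \<cdot>\<^sub>m M"]
      by (simp add: y_def integral_vec_def sum.distrib distrib_left)
  qed
  have dy: "((\<lambda>t. y t $ i) has_real_derivative (M *\<^sub>v y t + g t) $ i) (at t within {0..T})"
    if i: "i < n" and t: "t \<in> {0..T}" for i t
  proof -
    have "((\<lambda>t. \<Sum>l<n. ?P i l t * (c $ l + ?G l t)) has_real_derivative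
      (\<Sum>l<n. (\<Sum>k<n. M $$ (i, k) * ?P k l t) * (c $ l + ?G l t)
        + (0 + (\<Sum>j<n. ?P l j (- t) * g t $ j)) * ?P i l t)) (at t within {0..T})"
      using i t by (intro DERIV_sum DERIV_mult DERIV_add DERIV_const G
          DERIV_subset[OF mat_exp_derivative_left[OF M]]) auto
    also have "(\<Sum>l<n. (\<Sum>k<n. M $$ (i, k) * ?P k l t) * (c $ l + ?G l t)
        + (0 + (\<Sum>j<n. ?P l j (- t) * g t $ j)) * ?P i l t) =
      (\<Sum>l<n. \<Sum>k<n. M $$ (i, k) * (?P k l t * (c $ l + ?G l t))) +
      (\<Sum>l<n. \<Sum>j<n. ?P i l t * ?P l j (- t) * g t $ j)"
      by (simp add: sum.distrib sum_distrib_right sum_distrib_left mult_ac)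
    also have "(\<Sum>l<n. \<Sum>k<n. M $$ (i, k) * (?P k l t * (c $ l + ?G l t))) =
        (\<Sum>k<n. M $$ (i, k) * y t $ k)"
      by (subst sum.swap) (auto simp: y_index[OF _ t] sum_distrib_left intro!: sum.cong)
    also have "(\<Sum>l<n. \<Sum>j<n. ?P i l t * ?P l j (- t) * g t $ j) =
        (\<Sum>j<n. (\<Sum>l<n. ?P i l t * ?P l j (- t)) * g t $ j)"
      by (subst sum.swap) (simp add: sum_distrib_right)
    \<comment> \<open>The factor taken out of the integral cancels again: exp(t M) exp(-t M) is the
      identity, which leaves g.\<close>
    also have "\<dots> = (\<Sum>j<n. ?P i j (t + - t) * g t $ j)"
      by (intro sum.cong arg_cong2[where f = "(*)"] mat_exp_add[symmetric, OF M i]) auto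
    also have "\<dots> = g t $ i"
      using i mat_exp_0[OF M] by (simp add: one_mat_def if_distrib[of "\<lambda>x. x * _"] cong: if_cong)
    also have "(\<Sum>k<n. M $$ (i, k) * y t $ k) + g t $ i = (M *\<^sub>v y t + g t) $ i"
      using mult_mat_vec_index[OF M yc i] i gc[OF t] by simp
    finally show ?thesis
      by (rule has_real_derivative_transform[OF _ t]) (simp add: y_index[OF i])
  qed
  have "Ck_on T 1 (\<lambda>t. y t $ i)" if i: "i < n" for i
  proof (rule Ck_on_1I[where g' = "\<lambda>t. (M *\<^sub>v y t + g t) $ i", OF T])
    have *: "continuous_on {0..T} (\<lambda>t. y t $ k)" if "k < n" for k
      using dy[OF that] by (rule DERIV_continuous_on)
    have "continuous_on {0..T} (\<lambda>t. (\<Sum>k<n. M $$ (i, k) * y t $ k) + g t $ i)"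
      using gj i * by (intro continuous_intros) auto
    then show "continuous_on {0..T} (\<lambda>t. (M *\<^sub>v y t + g t) $ i)"
      by (rule continuous_on_eq) (use mult_mat_vec_index[OF M yc i] i carrier_vecD[OF gc] in simp)
  qed (rule dy[OF i])
  then show "Ck_vec_on T 1 n y"
    unfolding Ck_vec_on_def using yc by simp
  assume t: "t \<in> {0..T}"
  show "nderiv_vec T 1 y t = M *\<^sub>v y t + g t"
    using deriv_on_eqI[OF T t dy[OF _ t]] yc[of t] gc[OF t] M
    by (intro eq_vecI) auto
qed

section \<open>Positions inside the blocks of a multi-index\<close>

text \<open>Positions count from \<open>0\<close>, so the last one in a block of size \<open>a\<close> is \<open>a - 1\<close>. The values at
  \<open>i \<ge> |\<alpha>|\<close> are junk.\<close>

fun block_pos :: "nat list \<Rightarrow> nat \<Rightarrow> nat" where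
  "block_pos [] i = 0"
| "block_pos (a # \<alpha>) i = (if i < a then i else block_pos \<alpha> (i - a))"

fun block_size :: "nat list \<Rightarrow> nat \<Rightarrow> nat" where
  "block_size [] i = 0"
| "block_size (a # \<alpha>) i = (if i < a then a else block_size \<alpha> (i - a))"

text \<open>Lets a flat index be replaced by a block number and an offset, so that later arguments
  need no induction over the multi-index.\<close>

lemma block_index_exhaust:
  fixes \<alpha> :: "nat list"
  assumes "i < sum_list \<alpha>"
  obtains k p where "k < length \<alpha>" "p < \<alpha> ! k" "i = sum_list (take k \<alpha>) + p"
proof -
  have "\<exists>k<length \<alpha>. \<exists>p<\<alpha> ! k. i = sum_list (take k \<alpha>) + p"
    using assms
  proof (induction \<alpha> arbitrary: i)
    case (Cons a \<alpha>)
    show ?case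
    proof (cases "i < a")
      case False
      then have "i - a < sum_list \<alpha>" using Cons.prems by auto
      then obtain k p where "k < length \<alpha>" "p < \<alpha> ! k" "i - a = sum_list (take k \<alpha>) + p"
        using Cons.IH by blast
      then show ?thesis using False by (intro exI[of _ "Suc k"] conjI exI[of _ p]) auto
    qed (auto intro: exI[of _ 0])
  qed simp
  then show ?thesis using that by blast
qed

lemma block_index:
  assumes "k < length \<alpha>" "p < \<alpha> ! k"
  shows "block_pos \<alpha> (sum_list (take k \<alpha>) + p) = p"
    and "block_size \<alpha> (sum_list (take k \<alpha>) + p) = \<alpha> ! k"
    and "sum_list (take k \<alpha>) + p < sum_list \<alpha>"
proof -
  have "block_pos \<alpha> (sum_list (take k \<alpha>) + p) = p \<and>
    block_size \<alpha> (sum_list (take k \<alpha>) + p) = \<alpha> ! k \<and> sum_list (take k \<alpha>) + p < sum_list \<alpha>"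
    using assms
  proof (induction \<alpha> arbitrary: k)
    case (Cons a \<alpha>)
    show ?case
    proof (cases k)
      case (Suc k')
      then show ?thesis using Cons.IH[of k'] Cons.prems by auto
    qed (use Cons.prems in auto)
  qed simp
  then show "block_pos \<alpha> (sum_list (take k \<alpha>) + p) = p"
    and "block_size \<alpha> (sum_list (take k \<alpha>) + p) = \<alpha> ! k"
    and "sum_list (take k \<alpha>) + p < sum_list \<alpha>" by auto
qed

lemma block_pos_less_size: "i < sum_list \<alpha> \<Longrightarrow> block_pos \<alpha> i < block_size \<alpha> i"
  by (metis block_index(1,2) block_index_exhaust)

text \<open>A nonzero offset forces \<open>0 < i\<close>, so that \<open>i - 1\<close> is a genuine
  predecessor under truncated subtraction.\<close>

lemma block_pos_le: "block_pos \<alpha> i \<le> i"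
proof (induction \<alpha> arbitrary: i)
  case (Cons a \<alpha>)
  then show ?case using Cons[of "i - a"] by (auto intro: le_trans[OF _ diff_le_self])
qed simp

lemma block_size_le_max_index: "i < sum_list \<alpha> \<Longrightarrow> block_size \<alpha> i \<le> max_index \<alpha>"
  by (metis block_index(2) block_index_exhaust max_index_def Max_ge finite_insert finite_set
      insertCI nth_mem)

text \<open>Going back by at most the offset stays inside the block, and hence within the same
  degree of smoothness.\<close>

lemma block_pos_diff:
  assumes "i < sum_list \<alpha>" "q \<le> block_pos \<alpha> i"
  shows "block_pos \<alpha> (i - q) = block_pos \<alpha> i - q" and "block_size \<alpha> (i - q) = block_size \<alpha> i"
proof -
  obtain k p where *: "k < length \<alpha>" "p < \<alpha> ! k" "i = sum_list (take k \<alpha>) + p"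
    using block_index_exhaust[OF assms(1)] .
  then have "q \<le> p" using assms(2) block_index(1)[of k \<alpha> p] by simp
  then have "i - q = sum_list (take k \<alpha>) + (p - q)" "p - q < \<alpha> ! k" using * by auto
  then show "block_pos \<alpha> (i - q) = block_pos \<alpha> i - q" "block_size \<alpha> (i - q) = block_size \<alpha> i"
    using block_index[of k \<alpha> "p - q"] block_index[of k \<alpha> p] * by auto
qed

section \<open>The canonical blocks\<close>

text \<open>Keeps the truncated subtraction in \<open>sum_list \<alpha> - length \<alpha>\<close>
  harmless when a block is split off.\<close>

lemma multi_index_length_le: "multi_index \<alpha> \<Longrightarrow> length \<alpha> \<le> sum_list \<alpha>"
  unfolding multi_index_def by (induction \<alpha>) auto

lemma block_carrier [simp]:
  "N_block a \<in> carrier_mat a a" "K_block a \<in> carrier_mat (a - 1) a" "L_block a \<in> carrier_mat (a - 1) a"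
  unfolding N_block_def K_block_def L_block_def by auto

lemma N_mat_carrier [simp]: "N_mat \<alpha> \<in> carrier_mat (sum_list \<alpha>) (sum_list \<alpha>)"
  unfolding N_mat_def carrier_mat_def
  by (simp add: dim_diag_block_mat comp_def N_block_def)

lemma sum_list_minus_1: "multi_index \<alpha> \<Longrightarrow> (\<Sum>a\<leftarrow>\<alpha>. a - 1) = sum_list \<alpha> - length \<alpha>"
proof (induction \<alpha>)
  case (Cons a \<alpha>)
  then show ?case
    using multi_index_length_le[of \<alpha>] by (auto simp: multi_index_def)
qed simp

lemma K_mat_carrier [simp]:
    "multi_index \<alpha> \<Longrightarrow> K_mat \<alpha> \<in> carrier_mat (sum_list \<alpha> - length \<alpha>) (sum_list \<alpha>)"
  and L_mat_carrier [simp]: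
    "multi_index \<alpha> \<Longrightarrow> L_mat \<alpha> \<in> carrier_mat (sum_list \<alpha> - length \<alpha>) (sum_list \<alpha>)"
  unfolding K_mat_def L_mat_def carrier_mat_def using sum_list_minus_1[of \<alpha>]
  by (auto simp: dim_diag_block_mat comp_def K_block_def L_block_def)

lemma diag_block_mat_Cons:
  "M \<in> carrier_mat p q \<Longrightarrow> diag_block_mat Ms \<in> carrier_mat p' q' \<Longrightarrow>
    diag_block_mat (M # Ms) = four_block_mat M (0\<^sub>m p q') (0\<^sub>m p' q) (diag_block_mat Ms)"
  by (auto simp: Let_def)

lemma N_mat_Cons: "N_mat (a # \<alpha>) =
    four_block_mat (N_block a) (0\<^sub>m a (sum_list \<alpha>)) (0\<^sub>m (sum_list \<alpha>) a) (N_mat \<alpha>)"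
  using diag_block_mat_Cons[OF block_carrier(1) N_mat_carrier[unfolded N_mat_def]]
  by (simp add: N_mat_def)

lemma K_mat_Cons: "multi_index \<alpha> \<Longrightarrow> K_mat (a # \<alpha>) = four_block_mat (K_block a)
    (0\<^sub>m (a - 1) (sum_list \<alpha>)) (0\<^sub>m (sum_list \<alpha> - length \<alpha>) a) (K_mat \<alpha>)"
  using diag_block_mat_Cons[OF block_carrier(2) K_mat_carrier[unfolded K_mat_def]]
  by (simp add: K_mat_def)

lemma L_mat_Cons: "multi_index \<alpha> \<Longrightarrow> L_mat (a # \<alpha>) = four_block_mat (L_block a)
    (0\<^sub>m (a - 1) (sum_list \<alpha>)) (0\<^sub>m (sum_list \<alpha> - length \<alpha>) a) (L_mat \<alpha>)"
  using diag_block_mat_Cons[OF block_carrier(3) L_mat_carrier[unfolded L_mat_def]]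
  by (simp add: L_mat_def)

text \<open>In flat indices the matrix is one long subdiagonal, interrupted at the first row of each
  block.\<close>

lemma N_mat_index:
  "i < sum_list \<alpha> \<Longrightarrow> j < sum_list \<alpha> \<Longrightarrow>
    N_mat \<alpha> $$ (i, j) = (if i = Suc j \<and> block_pos \<alpha> i \<noteq> 0 then 1 else 0)"
proof (induction \<alpha> arbitrary: i j)
  case (Cons a \<alpha>)
  have "dim_row (N_block a) = a" "dim_col (N_block a) = a"
    "dim_row (N_mat \<alpha>) = sum_list \<alpha>" "dim_col (N_mat \<alpha>) = sum_list \<alpha>"
    using carrier_matD[OF block_carrier(1)] carrier_matD[OF N_mat_carrier] by auto
  then show ?case
    using Cons block_pos_le[of \<alpha> 0]
    by (auto simp: N_mat_Cons N_block_def Suc_diff_le)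
qed simp

text \<open>A q-fold shift that would leave the block gives 0. This is the blockwise reading of the
  sums: high derivatives of a short block, which need not exist, are multiplied by zero.\<close>

lemma N_mat_pow_mult_vec_index:
  assumes v: "v \<in> carrier_vec (sum_list \<alpha>)" and i: "i < sum_list \<alpha>"
  shows "((N_mat \<alpha> ^\<^sub>m q) *\<^sub>v v) $ i = (if q \<le> block_pos \<alpha> i then v $ (i - q) else 0)"
  using i
proof (induction q arbitrary: i)
  case 0
  then show ?case using v by (simp add: carrier_matD[OF N_mat_carrier])
next
  case (Suc q)
  let ?n = "sum_list \<alpha>" and ?w = "(N_mat \<alpha> ^\<^sub>m q) *\<^sub>v v"
  have w: "?w \<in> carrier_vec ?n"
    using v by (intro mult_mat_vec_carrier pow_carrier_mat) auto
  note pow_mat_Suc_left[OF N_mat_carrier, of \<alpha> q]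
  then have "((N_mat \<alpha> ^\<^sub>m Suc q) *\<^sub>v v) $ i = (N_mat \<alpha> *\<^sub>v ?w) $ i"
    using assoc_mult_mat_vec[OF N_mat_carrier pow_carrier_mat[OF N_mat_carrier] v, of q] by simp
  also have "\<dots> = (\<Sum>j<?n. if i = Suc j \<and> block_pos \<alpha> i \<noteq> 0 then ?w $ j else 0)"
    unfolding mult_mat_vec_index[OF N_mat_carrier w Suc.prems]
    using Suc.prems by (intro sum.cong) (auto simp: N_mat_index)
  also have "\<dots> = (if block_pos \<alpha> i \<noteq> 0 then ?w $ (i - 1) else 0)"
  proof (cases i)
    case 0
    then show ?thesis using block_pos_le[of \<alpha> 0] by simp
  next
    case (Suc j)
    then show ?thesis using Suc.prems by (simp add: sum.delta)
  qed
  also have "\<dots> = (if Suc q \<le> block_pos \<alpha> i then v $ (i - Suc q) else 0)"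
  proof (cases "block_pos \<alpha> i = 0")
    case False
    then have "1 \<le> block_pos \<alpha> i" by simp
    with block_pos_diff[OF Suc.prems this] show ?thesis
      using Suc.IH[of "i - 1"] Suc.prems False by auto
  qed simp
  finally show ?case .
qed

section \<open>Relations between the matrices N, K and L\<close>

lemma K_mat_mult_transpose:
  "multi_index \<alpha> \<Longrightarrow> K_mat \<alpha> * transpose_mat (K_mat \<alpha>) = 1\<^sub>m (sum_list \<alpha> - length \<alpha>)"
proof (induction \<alpha>)
  case Nil
  then show ?case by (auto simp: K_mat_def)
next
  case (Cons a \<alpha>)
  then have \<alpha>: "multi_index \<alpha>" and a: "1 \<le> a" by (auto simp: multi_index_def)
  have "K_block a * transpose_mat (K_block a) = 1\<^sub>m (a - 1)"
    by (rule eq_matI)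
      (auto simp: K_block_def scalar_prod_def if_distrib[of "\<lambda>x. x * _"] cong: if_cong)
  moreover have "sum_list (a # \<alpha>) - length (a # \<alpha>) = a - 1 + (sum_list \<alpha> - length \<alpha>)"
    using a multi_index_length_le[OF \<alpha>] by simp
  ultimately show ?case
    unfolding K_mat_Cons[OF \<alpha>]
      transpose_four_block_mat[OF block_carrier(2) zero_carrier_mat zero_carrier_mat K_mat_carrier[OF \<alpha>]]
    using Cons.IH[OF \<alpha>] K_mat_carrier[OF \<alpha>] block_carrier(2)[of a]
    by (subst mult_four_block_mat[of _ "a - 1" a _ "sum_list \<alpha>" _ "sum_list \<alpha> - length \<alpha>" _ _
          "a - 1" _ "sum_list \<alpha> - length \<alpha>"]) (auto simp del: sum_list.Cons list.size)
qed

text \<open>The product is the projection that erases the last entry of each block, so a vector lies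
  in the range of the transposed K iff these entries vanish.\<close>

lemma K_mat_transpose_mult_index:
  "multi_index \<alpha> \<Longrightarrow> i < sum_list \<alpha> \<Longrightarrow> j < sum_list \<alpha> \<Longrightarrow>
    (transpose_mat (K_mat \<alpha>) * K_mat \<alpha>) $$ (i, j) =
      (if i = j \<and> Suc (block_pos \<alpha> i) < block_size \<alpha> i then 1 else 0)"
proof (induction \<alpha> arbitrary: i j)
  case (Cons a \<alpha>)
  then have \<alpha>: "multi_index \<alpha>" by (auto simp: multi_index_def)
  have *: "transpose_mat (K_block a) * K_block a =
      mat a a (\<lambda>(i, j). if i = j \<and> Suc i < a then 1 else 0)"
    by (rule eq_matI)
      (auto simp: K_block_def scalar_prod_def if_distrib[of "\<lambda>x. x * _"] cong: if_cong)
  note K = K_mat_carrier[OF \<alpha>]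
  have "transpose_mat (K_mat (a # \<alpha>)) * K_mat (a # \<alpha>) =
    four_block_mat (transpose_mat (K_block a) * K_block a) (0\<^sub>m a (sum_list \<alpha>))
      (0\<^sub>m (sum_list \<alpha>) a) (transpose_mat (K_mat \<alpha>) * K_mat \<alpha>)"
    unfolding K_mat_Cons[OF \<alpha>]
      transpose_four_block_mat[OF block_carrier(2) zero_carrier_mat zero_carrier_mat K]
    using K block_carrier(2)[of a]
    by (subst mult_four_block_mat[of _ a "a - 1" _ "sum_list \<alpha> - length \<alpha>" _ "sum_list \<alpha>" _ _
          a _ "sum_list \<alpha>"]) auto
  moreover have "dim_row (transpose_mat (K_mat \<alpha>) * K_mat \<alpha>) = sum_list \<alpha>"
    "dim_col (transpose_mat (K_mat \<alpha>) * K_mat \<alpha>) = sum_list \<alpha>"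
    using K by auto
  ultimately show ?case
    using Cons.IH[OF \<alpha>, of "i - a" "j - a"] Cons.prems by (auto simp: * )
qed simp

text \<open>Shifting the rows of the transposed K down by one moves its ones from the diagonal to
  the subdiagonal, where those of the transposed L are. The identity serves the overdetermined
  blocks as it stands and the underdetermined ones in transposed form.\<close>

lemma N_mat_mult_K_mat_transpose:
  "multi_index \<alpha> \<Longrightarrow> N_mat \<alpha> * transpose_mat (K_mat \<alpha>) = transpose_mat (L_mat \<alpha>)"
proof (induction \<alpha>)
  case Nil
  then show ?case by (auto simp: N_mat_def K_mat_def L_mat_def)
next
  case (Cons a \<alpha>)
  then have \<alpha>: "multi_index \<alpha>" by (auto simp: multi_index_def)
  have *: "N_block a * transpose_mat (K_block a) = transpose_mat (L_block a)"
  proof (rule eq_matI)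
    fix i j assume "i < dim_row (transpose_mat (L_block a))" "j < dim_col (transpose_mat (L_block a))"
    then have ij: "i < a" "j < a - 1" by (auto simp: L_block_def)
    have "(N_block a * transpose_mat (K_block a)) $$ (i, j) =
      (\<Sum>k<a. if k = j then (if i = Suc j then 1 else 0) else 0)"
      unfolding mult_mat_index[OF block_carrier(1) transpose_carrier_mat[THEN iffD2, OF block_carrier(2)] ij]
      using ij by (intro sum.cong) (auto simp: N_block_def K_block_def)
    also have "\<dots> = transpose_mat (L_block a) $$ (i, j)"
      using ij by (auto simp: L_block_def)
    finally show "(N_block a * transpose_mat (K_block a)) $$ (i, j) = transpose_mat (L_block a) $$ (i, j)" .
  qed (auto simp: N_block_def K_block_def L_block_def)
  note K = K_mat_carrier[OF \<alpha>] and L = L_mat_carrier[OF \<alpha>]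
  show ?case
    unfolding K_mat_Cons[OF \<alpha>] L_mat_Cons[OF \<alpha>] N_mat_Cons
      transpose_four_block_mat[OF block_carrier(2) zero_carrier_mat zero_carrier_mat K]
      transpose_four_block_mat[OF block_carrier(3) zero_carrier_mat zero_carrier_mat L]
    using K L Cons.IH[OF \<alpha>] block_carrier[of a]
    by (subst mult_four_block_mat[of _ a a _ "sum_list \<alpha>" _ "sum_list \<alpha>" _ _
          "a - 1" _ "sum_list \<alpha> - length \<alpha>"])
      (auto simp: * right_mult_zero_mat[OF block_carrier(1)] right_mult_zero_mat[OF N_mat_carrier])
qed

lemma K_mat_transpose_mult_vec_index:
  assumes "multi_index \<alpha>" "v \<in> carrier_vec (sum_list \<alpha>)" "i < sum_list \<alpha>"
  shows "(transpose_mat (K_mat \<alpha>) *\<^sub>v (K_mat \<alpha> *\<^sub>v v)) $ i =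
    (if Suc (block_pos \<alpha> i) < block_size \<alpha> i then v $ i else 0)"
proof -
  note K = K_mat_carrier[OF assms(1)]
  have KK: "transpose_mat (K_mat \<alpha>) * K_mat \<alpha> \<in> carrier_mat (sum_list \<alpha>) (sum_list \<alpha>)"
    using K by auto
  have "transpose_mat (K_mat \<alpha>) *\<^sub>v (K_mat \<alpha> *\<^sub>v v) = (transpose_mat (K_mat \<alpha>) * K_mat \<alpha>) *\<^sub>v v"
    using K assms(2) by (simp add: assoc_mult_mat_vec[of _ "sum_list \<alpha>"])
  also have "\<dots> $ i = (\<Sum>j<sum_list \<alpha>. if j = i then
      (if Suc (block_pos \<alpha> i) < block_size \<alpha> i then v $ i else 0) else 0)"
    unfolding mult_mat_vec_index[OF KK assms(2,3)]
    using assms by (intro sum.cong) (auto simp: K_mat_transpose_mult_index)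
  finally show ?thesis using assms(3) by simp
qed

lemma K_mat_mult_transpose_mult_vec:
  assumes "multi_index \<alpha>" "v \<in> carrier_vec (sum_list \<alpha> - length \<alpha>)"
  shows "K_mat \<alpha> *\<^sub>v (transpose_mat (K_mat \<alpha>) *\<^sub>v v) = v"
proof -
  note K = K_mat_carrier[OF assms(1)]
  have "K_mat \<alpha> *\<^sub>v (transpose_mat (K_mat \<alpha>) *\<^sub>v v) = (K_mat \<alpha> * transpose_mat (K_mat \<alpha>)) *\<^sub>v v"
    using assoc_mult_mat_vec[OF K transpose_carrier_mat[THEN iffD2, OF K] assms(2)] by simp
  then show ?thesis using assms by (simp add: K_mat_mult_transpose)
qed

text \<open>The projection of v vanishes, and applying K to it returns \<open>K v\<close>. This
  detour avoids numbering the rows of K, whose indices skip the last position of each block.\<close>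

lemma K_mat_mult_vec_eq_0:
  assumes \<alpha>: "multi_index \<alpha>" and v: "v \<in> carrier_vec (sum_list \<alpha>)"
    and 0: "\<And>i. i < sum_list \<alpha> \<Longrightarrow> Suc (block_pos \<alpha> i) < block_size \<alpha> i \<Longrightarrow> v $ i = 0"
  shows "K_mat \<alpha> *\<^sub>v v = 0\<^sub>v (sum_list \<alpha> - length \<alpha>)"
proof -
  note K = K_mat_carrier[OF \<alpha>]
  have "transpose_mat (K_mat \<alpha>) *\<^sub>v (K_mat \<alpha> *\<^sub>v v) = 0\<^sub>v (sum_list \<alpha>)"
    using K K_mat_transpose_mult_vec_index[OF \<alpha> v] 0 by (intro eq_vecI) auto
  then have "K_mat \<alpha> *\<^sub>v v = K_mat \<alpha> *\<^sub>v 0\<^sub>v (sum_list \<alpha>)"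
    using K_mat_mult_transpose_mult_vec[OF \<alpha>, of "K_mat \<alpha> *\<^sub>v v"] K v by simp
  also have "\<dots> = 0\<^sub>v (sum_list \<alpha> - length \<alpha>)"
    using K by (intro eq_vecI) auto
  finally show ?thesis .
qed

section \<open>Differential-algebraic equations with nilpotent coefficient\<close>

text \<open>Omits the boundary condition and extensionality, neither of which passes to the
  components belonging to the single blocks.\<close>

definition dae_solution ::
  "real mat \<Rightarrow> real mat \<Rightarrow> real \<Rightarrow> (real \<Rightarrow> real vec) \<Rightarrow> (real \<Rightarrow> real vec) \<Rightarrow> bool" where
  "dae_solution E A T f x \<longleftrightarrow> Ck_vec_on T 1 (dim_col E) x \<and>
     (\<forall>t\<in>{0<..<T}. E *\<^sub>v nderiv_vec T 1 x t = A *\<^sub>v x t + f t)"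

text \<open>The finite Neumann series of the operator I - N d/dt applied to -f.\<close>

definition nilpotent_solution ::
  "real \<Rightarrow> nat list \<Rightarrow> (real \<Rightarrow> real vec) \<Rightarrow> real \<Rightarrow> real vec" where
  "nilpotent_solution T \<alpha> f t =
     - finsum_vec TYPE(real) (sum_list \<alpha>) (\<lambda>i. N_term T \<alpha> f i t) {..<max_index \<alpha>}"

lemma dae_solution_cong:
  assumes "\<And>t. t \<in> {0..T} \<Longrightarrow> x t = y t"
  shows "dae_solution E A T f x \<longleftrightarrow> dae_solution E A T f y"
proof -
  have "nderiv_vec T 1 x t = nderiv_vec T 1 y t" if "t \<in> {0<..<T}" for t
    using that by (intro nderiv_vec_cong assms) auto
  then show ?thesis
    unfolding dae_solution_def using Ck_vec_on_cong[of T x y, OF assms] assms by auto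
qed

text \<open>The common form of (A1) and (A3) in flat indices: every component is as smooth as its
  own block is long.\<close>

definition blockwise_Ck :: "real \<Rightarrow> nat list \<Rightarrow> (real \<Rightarrow> real vec) \<Rightarrow> bool" where
  "blockwise_Ck T \<alpha> f \<longleftrightarrow> (\<forall>t\<in>{0..T}. f t \<in> carrier_vec (sum_list \<alpha>)) \<and>
     (\<forall>i<sum_list \<alpha>. Ck_on T (block_size \<alpha> i) (\<lambda>t. f t $ i))"

lemma blockwise_CkI:
  assumes "\<And>t. t \<in> {0..T} \<Longrightarrow> f t \<in> carrier_vec (sum_list \<alpha>)"
    and "\<And>k. k < length \<alpha> \<Longrightarrow> Ck_vec_on T (\<alpha> ! k) (\<alpha> ! k) (\<lambda>t. block_vec \<alpha> k (f t))"
  shows "blockwise_Ck T \<alpha> f"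
  unfolding blockwise_Ck_def
proof (intro conjI allI impI ballI)
  fix i assume "i < sum_list \<alpha>"
  then obtain k p where *: "k < length \<alpha>" "p < \<alpha> ! k" "i = sum_list (take k \<alpha>) + p"
    using block_index_exhaust by blast
  then have "Ck_on T (\<alpha> ! k) (\<lambda>t. block_vec \<alpha> k (f t) $ p)"
    using assms(2)[of k] unfolding Ck_vec_on_def by auto
  then show "Ck_on T (block_size \<alpha> i) (\<lambda>t. f t $ i)"
    using * block_index(2)[OF *(1,2)] by (simp add: block_vec_def subvec_def)
qed (use assms(1) in auto)

context
  fixes T :: real and \<alpha> :: "nat list" and f :: "real \<Rightarrow> real vec"
  assumes T: "0 < T" and f: "blockwise_Ck T \<alpha> f"
begin

lemma blockwise_Ck_carrier: "t \<in> {0..T} \<Longrightarrow> f t \<in> carrier_vec (sum_list \<alpha>)"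
  using f unfolding blockwise_Ck_def by auto

lemma blockwise_Ck_nth: "i < sum_list \<alpha> \<Longrightarrow> Ck_on T (block_size \<alpha> i) (\<lambda>t. f t $ i)"
  using f unfolding blockwise_Ck_def by auto

lemma N_term_carrier: "t \<in> {0..T} \<Longrightarrow> N_term T \<alpha> f i t \<in> carrier_vec (sum_list \<alpha>)"
  unfolding N_term_def using blockwise_Ck_carrier
  by (intro mult_mat_vec_carrier pow_carrier_mat nderiv_vec_carrier) auto

lemma nilpotent_solution_carrier:
  "t \<in> {0..T} \<Longrightarrow> nilpotent_solution T \<alpha> f t \<in> carrier_vec (sum_list \<alpha>)"
  unfolding nilpotent_solution_def uminus_carrier_vec using N_term_carrier
  by (intro finsum_vec_closed) auto

text \<open>Cuts the sum at the offset of the row. The remaining orders of differentiation are below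
  the block size, so one more derivative is available, which makes the solution continuously
  differentiable.\<close>

lemma nilpotent_solution_index:
  assumes t: "t \<in> {0..T}" and i: "i < sum_list \<alpha>"
  shows "nilpotent_solution T \<alpha> f t $ i =
    - (\<Sum>q\<le>block_pos \<alpha> i. (deriv_on T ^^ q) (\<lambda>s. f s $ (i - q)) t)"
proof -
  have *: "N_term T \<alpha> f q t $ i =
      (if q \<le> block_pos \<alpha> i then (deriv_on T ^^ q) (\<lambda>s. f s $ (i - q)) t else 0)" for q
    unfolding N_term_def
    using N_mat_pow_mult_vec_index[OF nderiv_vec_carrier[where g = f, OF blockwise_Ck_carrier[OF t]] i] blockwise_Ck_carrier[OF t] i
    by (auto simp: nderiv_vec_def)
  have "(\<Sum>q<max_index \<alpha>. N_term T \<alpha> f q t $ i) =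
      (\<Sum>q\<le>block_pos \<alpha> i. (deriv_on T ^^ q) (\<lambda>s. f s $ (i - q)) t)"
    unfolding * using block_pos_less_size[OF i] block_size_le_max_index[OF i]
    by (intro sum.mono_neutral_cong_right) auto
  moreover have "finsum_vec TYPE(real) (sum_list \<alpha>) (\<lambda>q. N_term T \<alpha> f q t) {..<max_index \<alpha>} \<in>
      carrier_vec (sum_list \<alpha>)"
    using N_term_carrier[OF t] by (intro finsum_vec_closed) auto
  ultimately show ?thesis
    unfolding nilpotent_solution_def
    using i index_finsum_vec[OF _ i, of "{..<max_index \<alpha>}" "\<lambda>q. N_term T \<alpha> f q t"]
      N_term_carrier[OF t] by auto
qed

lemma nilpotent_solution_derivative:
  assumes t: "t \<in> {0..T}" and i: "i < sum_list \<alpha>"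
  shows "((\<lambda>t. nilpotent_solution T \<alpha> f t $ i) has_real_derivative
    - (\<Sum>q\<le>block_pos \<alpha> i. (deriv_on T ^^ Suc q) (\<lambda>s. f s $ (i - q)) t)) (at t within {0..T})"
proof -
  have "((\<lambda>t. - (\<Sum>q\<le>block_pos \<alpha> i. (deriv_on T ^^ q) (\<lambda>s. f s $ (i - q)) t)) has_real_derivative
    - (\<Sum>q\<le>block_pos \<alpha> i. (deriv_on T ^^ Suc q) (\<lambda>s. f s $ (i - q)) t)) (at t within {0..T})"
  proof (intro DERIV_minus DERIV_sum)
    fix q assume "q \<in> {..block_pos \<alpha> i}"
    then have q: "q \<le> block_pos \<alpha> i" by simp
    show "((deriv_on T ^^ q) (\<lambda>s. f s $ (i - q)) has_real_derivative
        (deriv_on T ^^ Suc q) (\<lambda>s. f s $ (i - q)) t) (at t within {0..T})"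
      using i q block_pos_diff(2)[OF i q] block_pos_less_size[OF i] t blockwise_Ck_nth[of "i - q"]
      by (intro has_derivative_funpow_deriv_on[of _ "block_size \<alpha> i"]) auto
  qed
  then show ?thesis
    by (rule has_real_derivative_transform[OF _ t]) (simp add: nilpotent_solution_index[OF _ i])
qed

lemma nilpotent_solution_Ck: "Ck_vec_on T 1 (sum_list \<alpha>) (nilpotent_solution T \<alpha> f)"
  unfolding Ck_vec_on_def
proof (intro conjI ballI allI impI nilpotent_solution_carrier)
  fix i assume i: "i < sum_list \<alpha>"
  show "Ck_on T 1 (\<lambda>t. nilpotent_solution T \<alpha> f t $ i)"
  proof (rule Ck_on_1I[OF T _ nilpotent_solution_derivative[OF _ i]])
    show "continuous_on {0..T} (\<lambda>t. - (\<Sum>q\<le>block_pos \<alpha> i. (deriv_on T ^^ Suc q) (\<lambda>s. f s $ (i - q)) t))"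
    proof (intro continuous_on_minus continuous_on_sum)
      fix q assume "q \<in> {..block_pos \<alpha> i}"
      then have q: "q \<le> block_pos \<alpha> i" by simp
      show "continuous_on {0..T} ((deriv_on T ^^ Suc q) (\<lambda>s. f s $ (i - q)))"
        using i q block_pos_diff(2)[OF i q] block_pos_less_size[OF i] blockwise_Ck_nth[of "i - q"]
        by (intro continuous_on_funpow_deriv_on[of _ "block_size \<alpha> i"]) auto
    qed
  qed
qed

text \<open>Differentiating the sum for row \<open>i - 1\<close> raises every order by one and
  produces the sum for row i without its term of order 0, which is the component of f.\<close>

lemma nilpotent_solution_deriv:
  assumes t: "t \<in> {0..T}" and i: "i < sum_list \<alpha>" "block_pos \<alpha> i \<noteq> 0"
  shows "deriv_on T (\<lambda>t. nilpotent_solution T \<alpha> f t $ (i - 1)) t =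
    nilpotent_solution T \<alpha> f t $ i + f t $ i"
proof -
  have i': "i - 1 < sum_list \<alpha>" and pos: "block_pos \<alpha> i = Suc (block_pos \<alpha> (i - 1))"
    using i block_pos_diff(1)[of i \<alpha> 1] by auto
  have "deriv_on T (\<lambda>t. nilpotent_solution T \<alpha> f t $ (i - 1)) t =
      - (\<Sum>q\<le>block_pos \<alpha> (i - 1). (deriv_on T ^^ Suc q) (\<lambda>s. f s $ (i - 1 - q)) t)"
    by (rule deriv_on_eqI[OF T t nilpotent_solution_derivative[OF t i']])
  also have "\<dots> = nilpotent_solution T \<alpha> f t $ i + f t $ i"
    unfolding nilpotent_solution_index[OF t i(1)] pos sum.atMost_Suc_shift
    by simp
  finally show ?thesis .
qed

text \<open>The first row of a block reads 0 = y_i + f_i, every other row y_(i-1)' = y_i + f_i.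
  Hence each component is determined by its predecessor, and no initial value is free.\<close>

lemma nilpotent_dae_iff:
  "dae_solution (N_mat \<alpha>) (1\<^sub>m (sum_list \<alpha>)) T f y \<longleftrightarrow>
    (\<forall>t\<in>{0..T}. y t = nilpotent_solution T \<alpha> f t)"
proof -
  let ?n = "sum_list \<alpha>" and ?z = "nilpotent_solution T \<alpha> f"
  have eq: "N_mat \<alpha> *\<^sub>v nderiv_vec T 1 y t = 1\<^sub>m ?n *\<^sub>v y t + f t \<longleftrightarrow>
    (\<forall>i<?n. (if block_pos \<alpha> i = 0 then 0 else deriv_on T (\<lambda>t. y t $ (i - 1)) t) = y t $ i + f t $ i)"
    (is "?l = ?r \<longleftrightarrow> _")
    if y: "y t \<in> carrier_vec ?n" and t: "t \<in> {0..T}" for y t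
  proof -
    have dim: "dim_vec ?l = ?n" "dim_vec ?r = ?n"
      using carrier_matD(1)[OF N_mat_carrier] blockwise_Ck_carrier[OF t] by auto
    have "?l $ i = (if block_pos \<alpha> i = 0 then 0 else deriv_on T (\<lambda>t. y t $ (i - 1)) t)" if i: "i < ?n" for i
      using N_mat_pow_mult_vec_index[OF nderiv_vec_carrier[where g = y, OF y] i, of 1] i y
      by (auto simp: carrier_matD[OF N_mat_carrier] left_mult_one_mat[OF N_mat_carrier])
    moreover have "?r $ i = y t $ i + f t $ i" if i: "i < ?n" for i
      using i y blockwise_Ck_carrier[OF t] by simp
    ultimately show ?thesis
      using dim by (auto simp: vec_eq_iff)
  qed
  have zeq: "(if block_pos \<alpha> i = 0 then 0 else deriv_on T (\<lambda>t. ?z t $ (i - 1)) t) = ?z t $ i + f t $ i"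
    if "i < ?n" "t \<in> {0..T}" for i t
    using that nilpotent_solution_deriv[of t i] nilpotent_solution_index[of t i] by simp
  have N_col: "dim_col (N_mat \<alpha>) = ?n" using carrier_matD[OF N_mat_carrier] by simp
  have z: "dae_solution (N_mat \<alpha>) (1\<^sub>m ?n) T f ?z"
    unfolding dae_solution_def N_col
    using eq[of ?z, OF nilpotent_solution_carrier] nilpotent_solution_Ck zeq by simp
  show ?thesis
  proof
    assume y: "dae_solution (N_mat \<alpha>) (1\<^sub>m ?n) T f y"
    then have yCk: "Ck_vec_on T 1 ?n y" unfolding dae_solution_def N_col by simp
    note yc = Ck_vec_on_carrier[OF yCk]
    have yj: "Ck_on T 1 (\<lambda>t. y t $ j)" if "j < ?n" for j
      using yCk that unfolding Ck_vec_on_def by auto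
    \<comment> \<open>The rows are extended to the end points, so that the induction below yields
      equality on the whole closed interval and with it equality of the one-sided
      derivatives.\<close>
    have yeq: "(if block_pos \<alpha> i = 0 then 0 else deriv_on T (\<lambda>t. y t $ (i - 1)) t) = y t $ i + f t $ i"
      if i: "i < ?n" and t: "t \<in> {0..T}" for i t
    proof (rule eq_on_closed_interval[OF T _ _ _ t])
      show "continuous_on {0..T} (\<lambda>t. if block_pos \<alpha> i = 0 then 0 else deriv_on T (\<lambda>t. y t $ (i - 1)) t)"
        using yj[of "i - 1"] i by (cases "block_pos \<alpha> i = 0") auto
      show "continuous_on {0..T} (\<lambda>t. y t $ i + f t $ i)"
        using Ck_on_imp_continuous_on[OF yj[OF i]] Ck_on_imp_continuous_on[OF blockwise_Ck_nth[OF i]]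
        by (intro continuous_intros)
      show "(if block_pos \<alpha> i = 0 then 0 else deriv_on T (\<lambda>t. y t $ (i - 1)) t) = y t $ i + f t $ i"
        if "t \<in> {0<..<T}" for t
        using y that eq[where y = y, OF yc, of t] i unfolding dae_solution_def by auto
    qed
    have "\<forall>t\<in>{0..T}. y t $ i = ?z t $ i" if "i < ?n" for i
      using that
    proof (induction i rule: less_induct)
      case (less i)
      show ?case
      proof (cases "block_pos \<alpha> i = 0")
        case True
        then show ?thesis
          using yeq[OF less.prems] zeq[OF less.prems] by (metis add_right_cancel)
      next
        case False
        then have "i - 1 < i" using block_pos_le[of \<alpha> i] by auto
        then have "deriv_on T (\<lambda>t. y t $ (i - 1)) t = deriv_on T (\<lambda>t. ?z t $ (i - 1)) t"
          if "t \<in> {0..T}" for t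
          using less.IH[of "i - 1"] less.prems that by (intro deriv_on_cong) auto
        then show ?thesis using yeq[OF less.prems] zeq[OF less.prems] False by auto
      qed
    qed
    then show "\<forall>t\<in>{0..T}. y t = ?z t"
      using carrier_vecD[OF yc] carrier_vecD[OF nilpotent_solution_carrier]
      by (auto simp: vec_eq_iff)
  qed (use z dae_solution_cong[of T y ?z] in blast)
qed

end

section \<open>The overdetermined blocks\<close>

lemma multi_index_nth_pos: "multi_index \<alpha> \<Longrightarrow> k < length \<alpha> \<Longrightarrow> 0 < \<alpha> ! k"
  unfolding multi_index_def using nth_mem[of k \<alpha>] by fastforce

lemma nilpotent_solution_last:
  assumes T: "0 < T" and f: "blockwise_Ck T \<alpha> f" and k: "k < length \<alpha>" and t: "t \<in> {0..T}"
    and \<alpha>: "multi_index \<alpha>"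
  shows "nilpotent_solution T \<alpha> f t $ (sum_list (take k \<alpha>) + (\<alpha> ! k - 1)) =
    - (\<Sum>i = 1..\<alpha> ! k. (deriv_on T ^^ (\<alpha> ! k - i)) (\<lambda>s. block_vec \<alpha> k (f s) $ (i - 1)) t)"
proof -
  have *: "\<alpha> ! k - 1 < \<alpha> ! k" using multi_index_nth_pos[OF \<alpha> k] by simp
  let ?i = "sum_list (take k \<alpha>) + (\<alpha> ! k - 1)"
  \<comment> \<open>Substitution q = \<alpha>_k - i. Condition (b) counts components from 1, so its
    component i sits at offset \<open>i - 1\<close>.\<close>
  have "(\<Sum>q\<le>\<alpha> ! k - 1. (deriv_on T ^^ q) (\<lambda>s. f s $ (?i - q)) t) =
    (\<Sum>i = 1..\<alpha> ! k. (deriv_on T ^^ (\<alpha> ! k - i)) (\<lambda>s. block_vec \<alpha> k (f s) $ (i - 1)) t)"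
    by (rule sum.reindex_bij_witness[of _ "\<lambda>i. \<alpha> ! k - i" "\<lambda>q. \<alpha> ! k - q"])
      (use * in \<open>auto simp: block_vec_def subvec_def intro!: arg_cong[where f = "\<lambda>i. (deriv_on T ^^ _) (\<lambda>s. f s $ i) t"]\<close>)
  then show ?thesis
    using nilpotent_solution_index[OF T f t block_index(3)[OF k *]] block_index(1)[OF k *] by simp
qed

text \<open>The projection fixes z iff the last entry of each block of z is 0, and up to sign these
  entries are the sums in (b).\<close>

lemma nilpotent_solution_range_iff:
  assumes T: "0 < T" and f: "blockwise_Ck T \<alpha> f" and t: "t \<in> {0..T}" and \<alpha>: "multi_index \<alpha>"
  shows "transpose_mat (K_mat \<alpha>) *\<^sub>v (K_mat \<alpha> *\<^sub>v nilpotent_solution T \<alpha> f t) =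
      nilpotent_solution T \<alpha> f t \<longleftrightarrow>
    (\<forall>k<length \<alpha>. (\<Sum>i = 1..\<alpha> ! k.
      (deriv_on T ^^ (\<alpha> ! k - i)) (\<lambda>s. block_vec \<alpha> k (f s) $ (i - 1)) t) = 0)"
    (is "?l = ?z \<longleftrightarrow> (\<forall>k<_. ?S k = 0)")
proof -
  have z: "?z \<in> carrier_vec (sum_list \<alpha>)"
    using nilpotent_solution_carrier[OF T f t] .
  have dim: "dim_vec ?l = sum_list \<alpha>" "dim_vec ?z = sum_list \<alpha>"
    using K_mat_carrier[OF \<alpha>] z by auto
  have last: "?z $ (sum_list (take k \<alpha>) + (\<alpha> ! k - 1)) = - ?S k" if "k < length \<alpha>" for k
    using nilpotent_solution_last[OF T f that t \<alpha>] .
  have "?l = ?z \<longleftrightarrow> (\<forall>i<sum_list \<alpha>. Suc (block_pos \<alpha> i) < block_size \<alpha> i \<or> ?z $ i = 0)"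
    unfolding vec_eq_iff dim using K_mat_transpose_mult_vec_index[OF \<alpha> z] by auto
  also have "\<dots> \<longleftrightarrow> (\<forall>k<length \<alpha>. ?S k = 0)"
  proof safe
    fix k assume *: "\<forall>i<sum_list \<alpha>. Suc (block_pos \<alpha> i) < block_size \<alpha> i \<or> ?z $ i = 0"
      and k: "k < length \<alpha>"
    show "?S k = 0"
      using multi_index_nth_pos[OF \<alpha> k] *[rule_format, OF block_index(3)[OF k, of "\<alpha> ! k - 1"]] block_index(1,2)[OF k, of "\<alpha> ! k - 1"] last[OF k]
      by simp
  next
    fix i assume S: "\<forall>k<length \<alpha>. ?S k = 0" and i: "i < sum_list \<alpha>" and nz: "?z $ i \<noteq> 0"
    obtain k p where k: "k < length \<alpha>" "p < \<alpha> ! k" "i = sum_list (take k \<alpha>) + p"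
      using block_index_exhaust[OF i] .
    then have "p \<noteq> \<alpha> ! k - 1" using last[OF k(1)] S nz by auto
    then show "Suc (block_pos \<alpha> i) < block_size \<alpha> i"
      using block_index(1,2)[OF k(1,2)] k by simp
  qed
  finally show ?thesis .
qed

text \<open>Because \<open>L\<^sub>\<gamma>\<^sup>T = N\<^sub>\<gamma> K\<^sub>\<gamma>\<^sup>T\<close> and \<open>K\<^sub>\<gamma> K\<^sub>\<gamma>\<^sup>T = I\<close>, the substitution \<open>z = K\<^sub>\<gamma>\<^sup>T y\<close> turns the
  overdetermined equation into the nilpotent one with the side condition that \<open>z\<close> lies in the
  range of \<open>K\<^sub>\<gamma>\<^sup>T\<close>.\<close>

lemma overdetermined_dae_iff:
  assumes T: "0 < T" and f: "blockwise_Ck T \<gamma> f" and \<gamma>: "multi_index \<gamma>"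
  shows "dae_solution (transpose_mat (L_mat \<gamma>)) (transpose_mat (K_mat \<gamma>)) T f y \<longleftrightarrow>
    (\<forall>k<length \<gamma>. \<forall>t\<in>{0..T}. (\<Sum>i = 1..\<gamma> ! k.
      (deriv_on T ^^ (\<gamma> ! k - i)) (\<lambda>s. block_vec \<gamma> k (f s) $ (i - 1)) t) = 0) \<and>
    (\<forall>t\<in>{0..T}. y t = K_mat \<gamma> *\<^sub>v nilpotent_solution T \<gamma> f t)"
proof -
  let ?n = "sum_list \<gamma>" and ?r = "sum_list \<gamma> - length \<gamma>" and ?K = "K_mat \<gamma>"
  let ?z = "nilpotent_solution T \<gamma> f"
  note K = K_mat_carrier[OF \<gamma>]
  have KT: "transpose_mat ?K \<in> carrier_mat ?n ?r" using K by simp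
  have dim: "dim_col (transpose_mat (L_mat \<gamma>)) = ?r" "dim_col (N_mat \<gamma>) = ?n"
    using L_mat_carrier[OF \<gamma>] carrier_matD(2)[OF N_mat_carrier] by auto
  have L: "transpose_mat (L_mat \<gamma>) *\<^sub>v v = N_mat \<gamma> *\<^sub>v (transpose_mat ?K *\<^sub>v v)" if "v \<in> carrier_vec ?r" for v
    using assoc_mult_mat_vec[OF N_mat_carrier KT that] N_mat_mult_K_mat_transpose[OF \<gamma>] by simp
  have z: "dae_solution (N_mat \<gamma>) (1\<^sub>m ?n) T f ?z"
    using nilpotent_dae_iff[OF T f] by blast
  then have zCk: "Ck_vec_on T 1 ?n ?z" unfolding dae_solution_def dim by simp
  note zc = Ck_vec_on_carrier[OF zCk]
  show ?thesis
  proof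
    assume y: "dae_solution (transpose_mat (L_mat \<gamma>)) (transpose_mat ?K) T f y"
    then have yCk: "Ck_vec_on T 1 ?r y" unfolding dae_solution_def dim by simp
    note yc = Ck_vec_on_carrier[OF yCk]
    have "dae_solution (N_mat \<gamma>) (1\<^sub>m ?n) T f (\<lambda>t. transpose_mat ?K *\<^sub>v y t)"
      unfolding dae_solution_def dim
    proof (intro conjI ballI mult_mat_vec_Ck(1)[OF T KT yCk])
      fix t assume t: "t \<in> {0<..<T}"
      then have t': "t \<in> {0..T}" by simp
      have "N_mat \<gamma> *\<^sub>v nderiv_vec T 1 (\<lambda>t. transpose_mat ?K *\<^sub>v y t) t =
          transpose_mat (L_mat \<gamma>) *\<^sub>v nderiv_vec T 1 y t"
        using mult_mat_vec_Ck(2)[OF T KT yCk t'] L[OF nderiv_vec_carrier[where g = y, OF yc[OF t']]] by simp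
      also have "\<dots> = transpose_mat ?K *\<^sub>v y t + f t"
        using y t unfolding dae_solution_def by simp
      finally show "N_mat \<gamma> *\<^sub>v nderiv_vec T 1 (\<lambda>t. transpose_mat ?K *\<^sub>v y t) t =
          1\<^sub>m ?n *\<^sub>v (transpose_mat ?K *\<^sub>v y t) + f t"
        using one_mult_mat_vec[OF mult_mat_vec_carrier[OF KT yc[OF t']]] by simp
    qed
    then have eq: "transpose_mat ?K *\<^sub>v y t = ?z t" if "t \<in> {0..T}" for t
      using nilpotent_dae_iff[OF T f, of "\<lambda>t. transpose_mat ?K *\<^sub>v y t"] that by blast
    have y_eq: "y t = ?K *\<^sub>v ?z t" if "t \<in> {0..T}" for t
      using K_mat_mult_transpose_mult_vec[OF \<gamma> yc[OF that]] eq[OF that] by simp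
    then have "transpose_mat ?K *\<^sub>v (?K *\<^sub>v ?z t) = ?z t" if "t \<in> {0..T}" for t
      using eq that by simp
    then show "(\<forall>k<length \<gamma>. \<forall>t\<in>{0..T}. (\<Sum>i = 1..\<gamma> ! k.
        (deriv_on T ^^ (\<gamma> ! k - i)) (\<lambda>s. block_vec \<gamma> k (f s) $ (i - 1)) t) = 0) \<and>
      (\<forall>t\<in>{0..T}. y t = ?K *\<^sub>v ?z t)"
      using nilpotent_solution_range_iff[OF T f _ \<gamma>] y_eq by blast
  next
    assume *: "(\<forall>k<length \<gamma>. \<forall>t\<in>{0..T}. (\<Sum>i = 1..\<gamma> ! k.
        (deriv_on T ^^ (\<gamma> ! k - i)) (\<lambda>s. block_vec \<gamma> k (f s) $ (i - 1)) t) = 0) \<and>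
      (\<forall>t\<in>{0..T}. y t = ?K *\<^sub>v ?z t)"
    \<comment> \<open>By (b) nothing is lost in passing from z to \<open>K z\<close>, so the
      equation for z can be read as one for \<open>K z\<close>.\<close>
    then have eq: "transpose_mat ?K *\<^sub>v (?K *\<^sub>v ?z t) = ?z t" if "t \<in> {0..T}" for t
      using nilpotent_solution_range_iff[OF T f that \<gamma>] that by blast
    note wCk = mult_mat_vec_Ck(1)[OF T K zCk]
    note wc = Ck_vec_on_carrier[OF wCk]
    have "dae_solution (transpose_mat (L_mat \<gamma>)) (transpose_mat ?K) T f (\<lambda>t. ?K *\<^sub>v ?z t)"
      unfolding dae_solution_def dim
    proof (intro conjI ballI wCk)
      fix t assume t: "t \<in> {0<..<T}"
      then have t': "t \<in> {0..T}" by simp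
      have "transpose_mat (L_mat \<gamma>) *\<^sub>v nderiv_vec T 1 (\<lambda>t. ?K *\<^sub>v ?z t) t =
          N_mat \<gamma> *\<^sub>v nderiv_vec T 1 (\<lambda>t. transpose_mat ?K *\<^sub>v (?K *\<^sub>v ?z t)) t"
        using mult_mat_vec_Ck(2)[OF T KT wCk t'] L[OF nderiv_vec_carrier[where g = "\<lambda>t. ?K *\<^sub>v ?z t", OF wc[OF t']]]
        by simp
      also have "nderiv_vec T 1 (\<lambda>t. transpose_mat ?K *\<^sub>v (?K *\<^sub>v ?z t)) t = nderiv_vec T 1 ?z t"
        using eq t' by (rule nderiv_vec_cong)
      also have "N_mat \<gamma> *\<^sub>v nderiv_vec T 1 ?z t = ?z t + f t"
        using z t one_mult_mat_vec[OF zc[OF t']] unfolding dae_solution_def by simp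
      finally show "transpose_mat (L_mat \<gamma>) *\<^sub>v nderiv_vec T 1 (\<lambda>t. ?K *\<^sub>v ?z t) t =
          transpose_mat ?K *\<^sub>v (?K *\<^sub>v ?z t) + f t"
        using eq[OF t'] by simp
    qed
    then show "dae_solution (transpose_mat (L_mat \<gamma>)) (transpose_mat ?K) T f y"
      using * dae_solution_cong[of T y "\<lambda>t. ?K *\<^sub>v ?z t"] by blast
  qed
qed

section \<open>The underdetermined blocks\<close>

text \<open>Differentiation lowers the multiplicity of a factor by at most one.\<close>

lemma power_dvd_pderiv:
  fixes p q :: "real poly"
  assumes "q ^ Suc k dvd p"
  shows "q ^ k dvd pderiv p"
proof -
  obtain r where p: "p = q ^ Suc k * r" using assms by (elim dvdE)
  have "pderiv p = q ^ k * (q * pderiv r + Polynomial.smult (real (Suc k)) (pderiv q) * r)"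
    unfolding p pderiv_mult pderiv_power_Suc by (simp add: algebra_simps)
  then show ?thesis by simp
qed

lemma power_dvd_pderiv_funpow:
  fixes p q :: "real poly"
  shows "q ^ (k + j) dvd p \<Longrightarrow> q ^ k dvd (pderiv ^^ j) p"
proof (induction j arbitrary: k)
  case (Suc j)
  have "q ^ Suc k dvd (pderiv ^^ j) p"
    using Suc.prems by (intro Suc.IH) simp
  then show ?case
    using power_dvd_pderiv by simp
qed simp

lemma block_pos_Suc:
  assumes "i < sum_list \<alpha>" "Suc (block_pos \<alpha> i) < block_size \<alpha> i"
  shows "Suc i < sum_list \<alpha>" "block_pos \<alpha> (Suc i) = Suc (block_pos \<alpha> i)"
    "block_size \<alpha> (Suc i) = block_size \<alpha> i"
proof -
  obtain k p where *: "k < length \<alpha>" "p < \<alpha> ! k" "i = sum_list (take k \<alpha>) + p"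
    using block_index_exhaust[OF assms(1)] .
  then have "Suc p < \<alpha> ! k" using assms(2) block_index(1,2)[OF *(1,2)] by simp
  then show "Suc i < sum_list \<alpha>" "block_pos \<alpha> (Suc i) = Suc (block_pos \<alpha> i)"
    "block_size \<alpha> (Suc i) = block_size \<alpha> i"
    using block_index[of k \<alpha> "Suc p"] block_index[of k \<alpha> p] * by auto
qed

text \<open>In each block the last component may be chosen freely, and the others are its successive
  derivatives. Taking \<open>t\<^sup>M (t - T)\<^sup>M\<close> with large \<open>M\<close> makes all of them vanish at both end points.\<close>

lemma underdetermined_dae_kernel:
  assumes T: "0 < T" and \<beta>: "multi_index \<beta>" "\<beta> \<noteq> []"
  obtains h t where "dae_solution (L_mat \<beta>) (K_mat \<beta>) T (\<lambda>_. 0\<^sub>v (sum_list \<beta> - length \<beta>)) h"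
    and "h 0 = 0\<^sub>v (sum_list \<beta>)" "h T = 0\<^sub>v (sum_list \<beta>)"
    and "t \<in> {0..T}" "h t \<noteq> 0\<^sub>v (sum_list \<beta>)"
proof
  let ?n = "sum_list \<beta>" and ?r = "sum_list \<beta> - length \<beta>"
  \<comment> \<open>Only derivatives of order below \<open>max_index \<beta>\<close> occur, so zeros
    of this multiplicity at the end points survive all of them.\<close>
  define M where "M = Suc (max_index \<beta>)"
  \<comment> \<open>The zero is written out to give both end points the form
    \<open>[:-a, 1:]\<close> expected by \<open>vanish\<close> below.\<close>
  define p where "p = [:-0, 1:] ^ M * [:-T, 1:] ^ M"
  define \<phi> where "\<phi> i = poly ((pderiv ^^ (block_size \<beta> i - Suc (block_pos \<beta> i))) p)" for i
  define h where "h t = vec ?n (\<lambda>i. \<phi> i t)" for t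
  note K = K_mat_carrier[OF \<beta>(1)] and L = L_mat_carrier[OF \<beta>(1)]
  have deriv: "(poly q has_real_derivative poly (pderiv q) t) (at t within {0..T})" for q :: "real poly" and t
    using poly_DERIV DERIV_subset by blast
  have hCk: "Ck_vec_on T 1 ?n h"
    unfolding Ck_vec_on_def
  proof (intro conjI ballI allI impI)
    fix i assume "i < ?n"
    then have "(\<lambda>t. h t $ i) = \<phi> i" by (simp add: h_def)
    moreover have "Ck_on T 1 (\<phi> i)"
      unfolding \<phi>_def by (rule Ck_on_1I[OF T _ deriv]) (intro continuous_intros)
    ultimately show "Ck_on T 1 (\<lambda>t. h t $ i)" by simp
  qed (simp add: h_def)
  show "dae_solution (L_mat \<beta>) (K_mat \<beta>) T (\<lambda>_. 0\<^sub>v ?r) h"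
    unfolding dae_solution_def carrier_matD(2)[OF L]
  proof (intro conjI ballI hCk)
    fix t assume "t \<in> {0<..<T}"
    then have t: "t \<in> {0..T}" by simp
    let ?w = "nderiv_vec T 1 h t"
    have hc: "h t \<in> carrier_vec ?n" by (simp add: h_def)
    have w: "?w \<in> carrier_vec ?n" using nderiv_vec_carrier[where g = h, OF hc] .
    have NT: "transpose_mat (N_mat \<beta>) \<in> carrier_mat ?n ?n" by simp
    have NTw: "transpose_mat (N_mat \<beta>) *\<^sub>v ?w \<in> carrier_vec ?n" using mult_mat_vec_carrier[OF NT w] .
    \<comment> \<open>With L factored through K, it suffices to compare entries that are not last in
      their block. There the transposed N reads the next entry, whose derivative is the current
      one.\<close>
    have "L_mat \<beta> = K_mat \<beta> * transpose_mat (N_mat \<beta>)"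
      using transpose_mult[OF N_mat_carrier transpose_carrier_mat[THEN iffD2, OF K]]
      unfolding N_mat_mult_K_mat_transpose[OF \<beta>(1)] by simp
    then have Lw: "L_mat \<beta> *\<^sub>v ?w = K_mat \<beta> *\<^sub>v (transpose_mat (N_mat \<beta>) *\<^sub>v ?w)"
      using assoc_mult_mat_vec[OF K NT w] by simp
    have "K_mat \<beta> *\<^sub>v (transpose_mat (N_mat \<beta>) *\<^sub>v ?w - h t) = 0\<^sub>v ?r"
    proof (rule K_mat_mult_vec_eq_0[OF \<beta>(1)])
      fix i assume i: "i < ?n" and nonlast: "Suc (block_pos \<beta> i) < block_size \<beta> i"
      note Suc_i = block_pos_Suc[OF i nonlast]
      have "(transpose_mat (N_mat \<beta>) *\<^sub>v ?w) $ i = (\<Sum>j<?n. if j = Suc i then ?w $ j else 0)"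
        unfolding mult_mat_vec_index[OF NT w i]
        using i Suc_i by (intro sum.cong) (auto simp: N_mat_index carrier_matD[OF N_mat_carrier])
      also have "\<dots> = ?w $ Suc i" using Suc_i by simp
      also have "\<dots> = deriv_on T (\<phi> (Suc i)) t"
        using Suc_i by (simp add: h_def)
      also have "\<dots> = poly (pderiv ((pderiv ^^ (block_size \<beta> i - Suc (Suc (block_pos \<beta> i)))) p)) t"
        unfolding \<phi>_def Suc_i using deriv_on_eqI[OF T t deriv] .
      also have "\<dots> = h t $ i"
        using i nonlast by (simp add: h_def \<phi>_def Suc_diff_Suc flip: funpow.simps(2)[THEN fun_cong, unfolded comp_def])
      finally show "(transpose_mat (N_mat \<beta>) *\<^sub>v ?w - h t) $ i = 0"
        using i hc by simp
    qed (use hc NTw in simp)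
    then have "K_mat \<beta> *\<^sub>v (transpose_mat (N_mat \<beta>) *\<^sub>v ?w) - K_mat \<beta> *\<^sub>v h t = 0\<^sub>v ?r"
      using mult_minus_distrib_mat_vec[OF K NTw hc] by simp
    moreover have "K_mat \<beta> *\<^sub>v (transpose_mat (N_mat \<beta>) *\<^sub>v ?w) \<in> carrier_vec ?r" "K_mat \<beta> *\<^sub>v h t \<in> carrier_vec ?r"
      using K NTw hc by auto
    ultimately show "L_mat \<beta> *\<^sub>v ?w = K_mat \<beta> *\<^sub>v h t + 0\<^sub>v ?r"
      unfolding Lw by (auto simp: vec_eq_iff)
  qed
  have vanish: "h a = 0\<^sub>v ?n" if a: "[:-a, 1:] ^ M dvd p" for a
  proof (rule eq_vecI)
    fix i assume "i < dim_vec (0\<^sub>v ?n :: real vec)"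
    then have i: "i < ?n" by simp
    have "[:-a, 1:] ^ 1 dvd (pderiv ^^ (block_size \<beta> i - Suc (block_pos \<beta> i))) p"
      by (rule power_dvd_pderiv_funpow, rule dvd_trans[OF le_imp_power_dvd a])
        (use block_size_le_max_index[OF i] in \<open>simp add: M_def\<close>)
    then show "h a $ i = 0\<^sub>v ?n $ i"
      using i by (simp add: h_def \<phi>_def poly_eq_0_iff_dvd)
  qed (simp add: h_def)
  show "h 0 = 0\<^sub>v ?n" "h T = 0\<^sub>v ?n"
    by (rule vanish; simp add: p_def)+
  \<comment> \<open>The witness is the midpoint, where p is nonzero; the entry inspected is the last
    one of the first block, which is p itself, without differentiation.\<close>
  show "T / 2 \<in> {0..T}" using T by simp
  have len: "0 < length \<beta>" using \<beta>(2) by simp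
  have pos: "\<beta> ! 0 - 1 < \<beta> ! 0" using \<beta> unfolding multi_index_def by (cases \<beta>) auto
  have "h (T / 2) $ (\<beta> ! 0 - 1) = poly p (T / 2)"
    using block_index[OF len pos] by (simp add: h_def \<phi>_def)
  also have "\<dots> \<noteq> 0" using T by (simp add: p_def)
  finally show "h (T / 2) \<noteq> 0\<^sub>v ?n"
    using block_index(3)[OF len pos] by auto
qed

section \<open>Decoupling\<close>

lemma Ck_vec_on_append_iff:
  assumes "\<And>t. t \<in> {0..T} \<Longrightarrow> x1 t \<in> carrier_vec q1" "\<And>t. t \<in> {0..T} \<Longrightarrow> x2 t \<in> carrier_vec q2"
  shows "Ck_vec_on T k (q1 + q2) (\<lambda>t. x1 t @\<^sub>v x2 t) \<longleftrightarrow> Ck_vec_on T k q1 x1 \<and> Ck_vec_on T k q2 x2"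
proof -
  have 1: "Ck_on T k (\<lambda>t. (x1 t @\<^sub>v x2 t) $ j) \<longleftrightarrow> Ck_on T k (\<lambda>t. x1 t $ j)" if "j < q1" for j
    by (rule Ck_on_cong) (use that assms[THEN carrier_vecD] in auto)
  have 2: "Ck_on T k (\<lambda>t. (x1 t @\<^sub>v x2 t) $ (q1 + j)) \<longleftrightarrow> Ck_on T k (\<lambda>t. x2 t $ j)" if "j < q2" for j
    by (rule Ck_on_cong) (use that assms[THEN carrier_vecD] in auto)
  have "(\<forall>j<q1 + q2. Ck_on T k (\<lambda>t. (x1 t @\<^sub>v x2 t) $ j)) \<longleftrightarrow>
    (\<forall>j<q1. Ck_on T k (\<lambda>t. x1 t $ j)) \<and> (\<forall>j<q2. Ck_on T k (\<lambda>t. x2 t $ j))"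
    (is "?a \<longleftrightarrow> ?b")
  proof
    assume ?b
    then show ?a
      using 1 2 by (metis add.commute le_add_diff_inverse less_diff_conv2 not_le)
  qed (use 1 2 in \<open>auto dest: spec[of _ "q1 + _"]\<close>)
  then show ?thesis
    unfolding Ck_vec_on_def using assms by auto
qed

lemma nderiv_vec_append:
  assumes "\<And>t. t \<in> {0..T} \<Longrightarrow> x1 t \<in> carrier_vec q1" "\<And>t. t \<in> {0..T} \<Longrightarrow> x2 t \<in> carrier_vec q2"
    and t: "t \<in> {0..T}"
  shows "nderiv_vec T i (\<lambda>t. x1 t @\<^sub>v x2 t) t = nderiv_vec T i x1 t @\<^sub>v nderiv_vec T i x2 t"
proof (rule eq_vecI)
  note dim = assms(1)[THEN carrier_vecD] assms(2)[THEN carrier_vecD]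
  fix j assume "j < dim_vec (nderiv_vec T i x1 t @\<^sub>v nderiv_vec T i x2 t)"
  then have j: "j < q1 + q2" using dim[OF t] by simp
  have "(deriv_on T ^^ i) (\<lambda>s. (x1 s @\<^sub>v x2 s) $ j) t =
    (deriv_on T ^^ i) (\<lambda>s. if j < q1 then x1 s $ j else x2 s $ (j - q1)) t"
    by (rule deriv_on_funpow_cong) (use j dim t in auto)
  then show "nderiv_vec T i (\<lambda>t. x1 t @\<^sub>v x2 t) t $ j = (nderiv_vec T i x1 t @\<^sub>v nderiv_vec T i x2 t) $ j"
    using j dim[OF t] by (auto simp: nderiv_vec_def)
qed simp

lemma four_block_mat_diag_mult_vec:
  assumes "M1 \<in> carrier_mat p1 q1" "M2 \<in> carrier_mat p2 q2" "v1 \<in> carrier_vec q1" "v2 \<in> carrier_vec q2"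
  shows "four_block_mat M1 (0\<^sub>m p1 q2) (0\<^sub>m p2 q1) M2 *\<^sub>v (v1 @\<^sub>v v2) = (M1 *\<^sub>v v1) @\<^sub>v (M2 *\<^sub>v v2)"
  using assms by (subst four_block_mat_mult_vec[of _ p1 q1 _ q2 _ p2]) auto

text \<open>Block diagonal matrices act on the two parts of an appended vector separately. All
  dimensions are explicit because a block may have no rows or no columns.\<close>

lemma dae_solution_append_iff:
  fixes E1 E2 A1 A2 :: "real mat"
  assumes E1: "E1 \<in> carrier_mat p1 q1" and A1: "A1 \<in> carrier_mat p1 q1"
    and E2: "E2 \<in> carrier_mat p2 q2" and A2: "A2 \<in> carrier_mat p2 q2"
    and f: "\<And>t. t \<in> {0..T} \<Longrightarrow> f1 t \<in> carrier_vec p1" "\<And>t. t \<in> {0..T} \<Longrightarrow> f2 t \<in> carrier_vec p2"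
    and x: "\<And>t. t \<in> {0..T} \<Longrightarrow> x1 t \<in> carrier_vec q1" "\<And>t. t \<in> {0..T} \<Longrightarrow> x2 t \<in> carrier_vec q2"
  shows "dae_solution (four_block_mat E1 (0\<^sub>m p1 q2) (0\<^sub>m p2 q1) E2)
      (four_block_mat A1 (0\<^sub>m p1 q2) (0\<^sub>m p2 q1) A2) T (\<lambda>t. f1 t @\<^sub>v f2 t) (\<lambda>t. x1 t @\<^sub>v x2 t) \<longleftrightarrow>
    dae_solution E1 A1 T f1 x1 \<and> dae_solution E2 A2 T f2 x2"
proof -
  have "four_block_mat E1 (0\<^sub>m p1 q2) (0\<^sub>m p2 q1) E2 *\<^sub>v nderiv_vec T 1 (\<lambda>t. x1 t @\<^sub>v x2 t) t =
      four_block_mat A1 (0\<^sub>m p1 q2) (0\<^sub>m p2 q1) A2 *\<^sub>v (x1 t @\<^sub>v x2 t) + (f1 t @\<^sub>v f2 t) \<longleftrightarrow>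
    E1 *\<^sub>v nderiv_vec T 1 x1 t = A1 *\<^sub>v x1 t + f1 t \<and> E2 *\<^sub>v nderiv_vec T 1 x2 t = A2 *\<^sub>v x2 t + f2 t"
    if "t \<in> {0<..<T}" for t
  proof -
    have t: "t \<in> {0..T}" using that by simp
    note w = nderiv_vec_carrier[where g = x1, OF x(1)[OF t]] nderiv_vec_carrier[where g = x2, OF x(2)[OF t]]
    have nd: "nderiv_vec T 1 (\<lambda>t. x1 t @\<^sub>v x2 t) t = nderiv_vec T 1 x1 t @\<^sub>v nderiv_vec T 1 x2 t"
      by (rule nderiv_vec_append[OF x t])
    show ?thesis
      unfolding nd four_block_mat_diag_mult_vec[OF E1 E2 w]
        four_block_mat_diag_mult_vec[OF A1 A2 x(1)[OF t] x(2)[OF t]]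
        append_vec_add[OF mult_mat_vec_carrier[OF A1 x(1)[OF t]] f(1)[OF t]
          mult_mat_vec_carrier[OF A2 x(2)[OF t]] f(2)[OF t]]
      by (rule append_vec_eq[OF mult_mat_vec_carrier[OF E1 w(1)]
          add_carrier_vec[OF mult_mat_vec_carrier[OF A1 x(1)[OF t]] f(1)[OF t]]])
  qed
  then show ?thesis
    unfolding dae_solution_def using E1 E2 Ck_vec_on_append_iff[of T x1 q1 x2 q2, OF x] by auto
qed

lemma dae_solution_diag_block_iff:
  fixes E0 E1 E2 E3 A0 A1 A2 A3 :: "real mat"
  assumes "E0 \<in> carrier_mat p0 q0" "A0 \<in> carrier_mat p0 q0"
    and "E1 \<in> carrier_mat p1 q1" "A1 \<in> carrier_mat p1 q1"
    and "E2 \<in> carrier_mat p2 q2" "A2 \<in> carrier_mat p2 q2"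
    and "E3 \<in> carrier_mat p3 q3" "A3 \<in> carrier_mat p3 q3"
    and "\<And>t. t \<in> {0..T} \<Longrightarrow> f0 t \<in> carrier_vec p0" "\<And>t. t \<in> {0..T} \<Longrightarrow> f1 t \<in> carrier_vec p1"
    and "\<And>t. t \<in> {0..T} \<Longrightarrow> f2 t \<in> carrier_vec p2" "\<And>t. t \<in> {0..T} \<Longrightarrow> f3 t \<in> carrier_vec p3"
    and "\<And>t. t \<in> {0..T} \<Longrightarrow> x0 t \<in> carrier_vec q0" "\<And>t. t \<in> {0..T} \<Longrightarrow> x1 t \<in> carrier_vec q1"
    and "\<And>t. t \<in> {0..T} \<Longrightarrow> x2 t \<in> carrier_vec q2" "\<And>t. t \<in> {0..T} \<Longrightarrow> x3 t \<in> carrier_vec q3"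
  shows "dae_solution (diag_block_mat [E0, E1, E2, E3]) (diag_block_mat [A0, A1, A2, A3]) T
      (\<lambda>t. f0 t @\<^sub>v f1 t @\<^sub>v f2 t @\<^sub>v f3 t) (\<lambda>t. x0 t @\<^sub>v x1 t @\<^sub>v x2 t @\<^sub>v x3 t) \<longleftrightarrow>
    dae_solution E0 A0 T f0 x0 \<and> dae_solution E1 A1 T f1 x1 \<and>
    dae_solution E2 A2 T f2 x2 \<and> dae_solution E3 A3 T f3 x3"
proof -
  \<comment> \<open>Nested to the right, like the appended components, so that the statement for two
    blocks applies three times.\<close>
  have *: "diag_block_mat [M1, M2, M3, M4] = four_block_mat M1 (0\<^sub>m p0 (q1 + (q2 + q3))) (0\<^sub>m (p1 + (p2 + p3)) q0)
      (four_block_mat M2 (0\<^sub>m p1 (q2 + q3)) (0\<^sub>m (p2 + p3) q1)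
      (four_block_mat M3 (0\<^sub>m p2 q3) (0\<^sub>m p3 q2) M4))"
    if "M1 \<in> carrier_mat p0 q0" "M2 \<in> carrier_mat p1 q1" "M3 \<in> carrier_mat p2 q2" "M4 \<in> carrier_mat p3 q3"
    for M1 M2 M3 M4 :: "real mat"
    using that diag_block_mat_singleton[of M4] by (simp add: Let_def)
  show ?thesis
    unfolding *[OF assms(1,3,5,7)] *[OF assms(2,4,6,8)]
    by (subst dae_solution_append_iff; (subst dae_solution_append_iff)?; (subst dae_solution_append_iff)?)
      (use assms in \<open>auto intro!: append_carrier_vec\<close>)
qed

text \<open>Injectivity of W allows it to be cancelled from the equation, and the inverse of V
  carries differentiability of \<open>V y\<close> back to y.\<close>

lemma dae_solution_transform_iff:
  fixes E A W V :: "real mat"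
  assumes T: "0 < T" and E: "E \<in> carrier_mat m n" and A: "A \<in> carrier_mat m n"
    and W: "W \<in> carrier_mat m m" and Wi: "Wi \<in> carrier_mat m m" "Wi * W = 1\<^sub>m m"
    and V: "V \<in> carrier_mat n n" and Vi: "Vi \<in> carrier_mat n n" "Vi * V = 1\<^sub>m n"
    and f: "\<And>t. t \<in> {0..T} \<Longrightarrow> f t \<in> carrier_vec m"
    and y: "\<And>t. t \<in> {0..T} \<Longrightarrow> y t \<in> carrier_vec n"
  shows "dae_solution (W * E * V) (W * A * V) T (\<lambda>t. W *\<^sub>v f t) y \<longleftrightarrow>
    dae_solution E A T f (\<lambda>t. V *\<^sub>v y t)"
proof -
  have Vy: "V *\<^sub>v y t \<in> carrier_vec n" "Vi *\<^sub>v (V *\<^sub>v y t) = y t" if "t \<in> {0..T}" for t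
    using assoc_mult_mat_vec[OF Vi(1) V y[OF that]] y[OF that] V Vi by auto
  have Ck: "Ck_vec_on T 1 n y \<longleftrightarrow> Ck_vec_on T 1 n (\<lambda>t. V *\<^sub>v y t)"
  proof
    assume "Ck_vec_on T 1 n (\<lambda>t. V *\<^sub>v y t)"
    from mult_mat_vec_Ck(1)[OF T Vi(1) this] show "Ck_vec_on T 1 n y"
      using Ck_vec_on_cong[of T "\<lambda>t. Vi *\<^sub>v (V *\<^sub>v y t)" y] Vy(2) by blast
  qed (rule mult_mat_vec_Ck(1)[OF T V])
  have W_inj: "W *\<^sub>v u = W *\<^sub>v v \<longleftrightarrow> u = v" if "u \<in> carrier_vec m" "v \<in> carrier_vec m" for u v
    using assoc_mult_mat_vec[OF Wi(1) W that(1)] assoc_mult_mat_vec[OF Wi(1) W that(2)] that Wi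
    by (metis one_mult_mat_vec)
  have eq: "(W * E * V) *\<^sub>v nderiv_vec T 1 y t = (W * A * V) *\<^sub>v y t + W *\<^sub>v f t \<longleftrightarrow>
      E *\<^sub>v nderiv_vec T 1 (\<lambda>t. V *\<^sub>v y t) t = A *\<^sub>v (V *\<^sub>v y t) + f t"
    if yCk: "Ck_vec_on T 1 n y" and t: "t \<in> {0<..<T}" for t
  proof -
    have t': "t \<in> {0..T}" using t by simp
    note w = nderiv_vec_carrier[where g = y, OF y[OF t']]
    have mult: "(W * M * V) *\<^sub>v v = W *\<^sub>v (M *\<^sub>v (V *\<^sub>v v))" if "M \<in> carrier_mat m n" "v \<in> carrier_vec n" for M v
      using assoc_mult_mat_vec[OF mult_carrier_mat[OF W that(1)] V that(2)]
        assoc_mult_mat_vec[OF W that(1) mult_mat_vec_carrier[OF V that(2)]] by simp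
    show ?thesis
      unfolding mult[OF E w] mult[OF A y[OF t']] mult_mat_vec_Ck(2)[OF T V yCk t']
        mult_add_distrib_mat_vec[OF W mult_mat_vec_carrier[OF A Vy(1)[OF t']] f[OF t'], symmetric]
      by (intro W_inj add_carrier_vec mult_mat_vec_carrier[OF E] mult_mat_vec_carrier[OF A]
          mult_mat_vec_carrier[OF V] w f[OF t'] y[OF t'])
  qed
  show ?thesis
    unfolding dae_solution_def using Ck eq E V by auto
qed

section \<open>Full column rank\<close>

text \<open>Rank is tied to linear independence of the set of columns, which forgets repetitions.
  Distinctness of the columns is therefore established in both directions.\<close>

lemma full_column_rank_iff:
  fixes Q :: "real mat"
  assumes Q: "Q \<in> carrier_mat l k"
  shows "vec_space.rank l Q = k \<longleftrightarrow> (\<forall>v\<in>carrier_vec k. Q *\<^sub>v v = 0\<^sub>v l \<longrightarrow> v = 0\<^sub>v k)"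
proof -
  interpret vec_space "TYPE(real)" l .
  show ?thesis
  proof
    assume rank: "rank Q = k"
    have "distinct (cols Q)"
    proof (rule ccontr)
      \<comment> \<open>With a repeated column there are fewer than k vectors to choose from, and a
        maximal independent subset of them cannot have k elements.\<close>
      assume "\<not> distinct (cols Q)"
      then have "card (set (cols Q)) < k"
        using Q card_distinct[of "cols Q"] card_length[of "cols Q"] by (auto simp: le_less)
      moreover obtain S where S: "maximal S (\<lambda>T. T \<subseteq> set (cols Q) \<and> lin_indpt T)"
        using maximal_exists[of "\<lambda>T. T \<subseteq> set (cols Q) \<and> lin_indpt T" "card (set (cols Q))" "{}"]
        by (meson List.finite_set card_mono empty_iff empty_subsetI finite_lin_indpt2 rev_finite_subset)
      moreover have "card S \<le> card (set (cols Q))"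
        using S by (auto simp: maximal_def intro: card_mono)
      ultimately show False
        using rank rank_card_indpt[OF Q S] by simp
    qed
    then show "\<forall>v\<in>carrier_vec k. Q *\<^sub>v v = 0\<^sub>v l \<longrightarrow> v = 0\<^sub>v k"
      using full_rank_lin_indpt[OF Q rank] lin_depI[OF Q] by blast
  next
    assume inj: "\<forall>v\<in>carrier_vec k. Q *\<^sub>v v = 0\<^sub>v l \<longrightarrow> v = 0\<^sub>v k"
    have unit: "Q *\<^sub>v unit_vec k i = col Q i" if "i < k" for i
      by (rule eq_vecI) (use Q that in \<open>auto simp: scalar_prod_right_unit\<close>)
    have "distinct (cols Q)"
      unfolding distinct_conv_nth
    proof (intro allI impI notI)
      fix i j assume i: "i < length (cols Q)" and j: "j < length (cols Q)" and ij: "i \<noteq> j"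
        and eq: "cols Q ! i = cols Q ! j"
      have ij': "i < k" "j < k" using i j Q by auto
      \<comment> \<open>Equal columns i and j would put this nonzero vector into the kernel.\<close>
      let ?v = "unit_vec k i - unit_vec k j :: real vec"
      have "Q *\<^sub>v ?v = Q *\<^sub>v unit_vec k i - Q *\<^sub>v unit_vec k j"
        by (rule mult_minus_distrib_mat_vec[OF Q]) auto
      also have "\<dots> = col Q i - col Q j"
        using unit ij' by simp
      also have "\<dots> = 0\<^sub>v l"
        using eq ij' Q by simp
      finally have "?v = 0\<^sub>v k" using inj by simp
      then have "?v $ i = 0" using ij' by simp
      then show False using ij ij' by simp
    qed
    then show "rank Q = k"
      using lin_indpt_full_rank[OF Q] lin_depE[OF Q] inj by metis
  qed
qed

text \<open>Membership in the range is existence. Uniqueness is triviality of the kernel, since a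
  kernel vector can be added to any solution.\<close>

lemma unique_solution_iff:
  fixes Q :: "real mat"
  assumes Q: "Q \<in> carrier_mat l k" and b: "b \<in> carrier_vec l"
  shows "(\<exists>!c. c \<in> carrier_vec k \<and> Q *\<^sub>v c = b) \<longleftrightarrow>
    b \<in> vec_space.col_space l Q \<and> vec_space.rank l Q = k"
proof -
  interpret vec_space "TYPE(real)" l .
  have range: "b \<in> col_space Q \<longleftrightarrow> (\<exists>c. c \<in> carrier_vec k \<and> Q *\<^sub>v c = b)"
    unfolding col_space_eq[OF Q] using Q b by auto
  show ?thesis
    unfolding range full_column_rank_iff[OF Q]
  proof (intro iffI conjI ballI impI)
    fix v assume ex1: "\<exists>!c. c \<in> carrier_vec k \<and> Q *\<^sub>v c = b"
      and v: "v \<in> carrier_vec k" "Q *\<^sub>v v = 0\<^sub>v l"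
    obtain c where c: "c \<in> carrier_vec k" "Q *\<^sub>v c = b"
      and uniq: "\<And>c'. c' \<in> carrier_vec k \<Longrightarrow> Q *\<^sub>v c' = b \<Longrightarrow> c' = c"
      using ex1 by blast
    have "Q *\<^sub>v (c + v) = b"
      using mult_add_distrib_mat_vec[OF Q c(1) v(1)] v(2) c(2) b by simp
    then have "c + v = c" using uniq[of "c + v"] c(1) v(1) by simp
    then have "(c + v) $ i = c $ i" for i by simp
    then have "v $ i = 0" if "i < k" for i
      using that index_add_vec(1)[of i v c] carrier_vecD[OF v(1)] by simp
    then show "v = 0\<^sub>v k" using v(1) by (intro eq_vecI) auto
  next
    assume *: "(\<exists>c. c \<in> carrier_vec k \<and> Q *\<^sub>v c = b) \<and> (\<forall>v\<in>carrier_vec k. Q *\<^sub>v v = 0\<^sub>v l \<longrightarrow> v = 0\<^sub>v k)"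
    have "c = c'" if c: "c \<in> carrier_vec k" "c' \<in> carrier_vec k" "Q *\<^sub>v c = b" "Q *\<^sub>v c' = b" for c c'
    proof -
      have "Q *\<^sub>v (c - c') = 0\<^sub>v l"
        using mult_minus_distrib_mat_vec[OF Q c(1,2)] c b by simp
      then have "c - c' = 0\<^sub>v k" using * c by simp
      then have "(c - c') $ i = 0" if "i < k" for i using that by simp
      then show ?thesis using c by (intro eq_vecI) auto
    qed
    then show "\<exists>!c. c \<in> carrier_vec k \<and> Q *\<^sub>v c = b" using * by blast
  qed blast
qed

text \<open>For v in the kernel of the Gram matrix, the squared norm of \<open>Q v\<close> is 0, so
  full column rank makes this matrix invertible and yields a left inverse of Q.\<close>

lemma normal_equation_solution:
  fixes Q :: "real mat"
  assumes Q: "Q \<in> carrier_mat l k" and rank: "vec_space.rank l Q = k" and c: "c \<in> carrier_vec k"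
  shows "the (mat_inverse (transpose_mat Q * Q)) *\<^sub>v (transpose_mat Q *\<^sub>v (Q *\<^sub>v c)) = c"
proof -
  let ?G = "transpose_mat Q * Q"
  have QT: "transpose_mat Q \<in> carrier_mat k l" using Q by simp
  have G: "?G \<in> carrier_mat k k" using Q by simp
  have "det ?G \<noteq> 0"
  proof
    assume "det ?G = 0"
    then obtain v where v: "v \<in> carrier_vec k" "v \<noteq> 0\<^sub>v k" "?G *\<^sub>v v = 0\<^sub>v k"
      using det_0_iff_vec_prod_zero_field[OF G] by blast
    have Qv: "Q *\<^sub>v v \<in> carrier_vec l" using Q v by simp
    have z: "transpose_mat Q *\<^sub>v (Q *\<^sub>v v) = 0\<^sub>v k"
      using assoc_mult_mat_vec[OF QT Q v(1)] v(3) by simp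
    have "(Q *\<^sub>v v) \<bullet> (Q *\<^sub>v v) = (transpose_mat Q *\<^sub>v (Q *\<^sub>v v)) \<bullet> v"
      using transpose_vec_mult_scalar[OF Q v(1) Qv] by simp
    also have "\<dots> = 0"
      unfolding z using v(1) by simp
    finally have "(\<Sum>i\<in>{0..<l}. (Q *\<^sub>v v) $ i * (Q *\<^sub>v v) $ i) = 0"
      using carrier_vecD[OF Qv] unfolding scalar_prod_def by simp
    then have "\<forall>i\<in>{0..<l}. (Q *\<^sub>v v) $ i * (Q *\<^sub>v v) $ i = 0"
      by (subst (asm) sum_nonneg_eq_0_iff) auto
    then have "Q *\<^sub>v v = 0\<^sub>v l"
      using Qv Q by (intro eq_vecI) auto
    then show False using v full_column_rank_iff[OF Q] rank by blast
  qed
  then have "mat_inverse ?G \<noteq> None"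
    \<comment> \<open>The value \<open>undefined\<close> fills the extension field of the matrix
      ring record, on which its units do not depend.\<close>
    using mat_inverse(1)[OF G, of undefined] det_non_zero_imp_unit[OF G, of undefined] by blast
  then obtain H where H: "mat_inverse ?G = Some H" by blast
  have "H * ?G = 1\<^sub>m k" "H \<in> carrier_mat k k" using mat_inverse(2)[OF G H] by auto
  then have "H *\<^sub>v (?G *\<^sub>v c) = c"
    using assoc_mult_mat_vec[OF _ G c, of H k] c by simp
  then show ?thesis
    using H assoc_mult_mat_vec[OF QT Q c] by simp
qed

section \<open>Splitting of vectors and matrices\<close>

lemma subvec_carrier [simp]: "subvec p k v \<in> carrier_vec k"
  by (simp add: subvec_def)

lemma subvec_append: "subvec p (a + b) v = subvec p a v @\<^sub>v subvec (p + a) b v"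
  by (rule eq_vecI) (auto simp: subvec_def)

lemma subvec_all: "v \<in> carrier_vec n \<Longrightarrow> subvec 0 n v = v"
  by (rule eq_vecI) (auto simp: subvec_def)

lemma subcols_carrier [simp]: "M \<in> carrier_mat l n \<Longrightarrow> subcols p k M \<in> carrier_mat l k"
  by (simp add: subcols_def)

lemma subcols_all: "M \<in> carrier_mat l n \<Longrightarrow> subcols 0 n M = M"
  by (rule eq_matI) (auto simp: subcols_def)

lemma subcols_append_mult_vec:
  assumes M: "M \<in> carrier_mat l n" and u: "u \<in> carrier_vec a" and v: "v \<in> carrier_vec b"
  shows "subcols p (a + b) M *\<^sub>v (u @\<^sub>v v) = subcols p a M *\<^sub>v u + subcols (p + a) b M *\<^sub>v v"
proof (rule eq_vecI)
  fix i assume "i < dim_vec (subcols p a M *\<^sub>v u + subcols (p + a) b M *\<^sub>v v)"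
  then have i: "i < l" using M by (simp add: subcols_def)
  have "row (subcols p (a + b) M) i = row (subcols p a M) i @\<^sub>v row (subcols (p + a) b M) i"
    by (rule eq_vecI) (use i M in \<open>auto simp: subcols_def add.assoc\<close>)
  then show "(subcols p (a + b) M *\<^sub>v (u @\<^sub>v v)) $ i =
      (subcols p a M *\<^sub>v u + subcols (p + a) b M *\<^sub>v v) $ i"
    using i M scalar_prod_append[OF _ _ u v, of "row (subcols p a M) i" "row (subcols (p + a) b M) i"]
    by (simp add: subcols_def)
qed (use M in \<open>simp add: subcols_def\<close>)

text \<open>Takes the boundary matrices out of the sums defining \<open>d1\<close> and
  \<open>d3\<close>, so that what remains are the values of the nilpotent solution at 0 and
  T.\<close>

lemma finsum_vec_mult_mat:
  fixes M M' :: "real mat"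
  assumes F: "finite F" and M: "M \<in> carrier_mat l p" "M' \<in> carrier_mat l p"
    and u: "\<And>i. u i \<in> carrier_vec p" "\<And>i. u' i \<in> carrier_vec p"
  shows "- finsum_vec TYPE(real) l (\<lambda>i. M *\<^sub>v u i + M' *\<^sub>v u' i) F =
    M *\<^sub>v (- finsum_vec TYPE(real) p u F) + M' *\<^sub>v (- finsum_vec TYPE(real) p u' F)"
proof (rule eq_vecI)
  have c: "M *\<^sub>v u i + M' *\<^sub>v u' i \<in> carrier_vec l" for i
    using mult_mat_vec_carrier[OF M(1) u(1)] mult_mat_vec_carrier[OF M(2) u(2)] by simp
  have s: "- finsum_vec TYPE(real) p u F \<in> carrier_vec p" "- finsum_vec TYPE(real) p u' F \<in> carrier_vec p"
    "finsum_vec TYPE(real) l (\<lambda>i. M *\<^sub>v u i + M' *\<^sub>v u' i) F \<in> carrier_vec l"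
    unfolding uminus_carrier_vec using u c by (auto intro!: finsum_vec_closed)
  have s_index: "(- finsum_vec TYPE(real) p u F) $ j = - (\<Sum>i\<in>F. u i $ j)"
      "(- finsum_vec TYPE(real) p u' F) $ j = - (\<Sum>i\<in>F. u' i $ j)" if "j < p" for j
    using that s(1,2) index_finsum_vec[OF F that] u by auto
  fix r assume "r < dim_vec (M *\<^sub>v (- finsum_vec TYPE(real) p u F) + M' *\<^sub>v (- finsum_vec TYPE(real) p u' F))"
  then have r: "r < l" using M by simp
  have "(- finsum_vec TYPE(real) l (\<lambda>i. M *\<^sub>v u i + M' *\<^sub>v u' i) F) $ r =
      - (\<Sum>i\<in>F. (M *\<^sub>v u i + M' *\<^sub>v u' i) $ r)"
    using s(3) r index_finsum_vec[OF F r, of "\<lambda>i. M *\<^sub>v u i + M' *\<^sub>v u' i"] c by auto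
  also have "\<dots> = - (\<Sum>i\<in>F. \<Sum>j<p. M $$ (r, j) * u i $ j) - (\<Sum>i\<in>F. \<Sum>j<p. M' $$ (r, j) * u' i $ j)"
    using r M mult_mat_vec_index[OF M(1) u(1) r] mult_mat_vec_index[OF M(2) u(2) r]
    by (simp add: sum.distrib)
  also have "\<dots> = - (\<Sum>j<p. \<Sum>i\<in>F. M $$ (r, j) * u i $ j) - (\<Sum>j<p. \<Sum>i\<in>F. M' $$ (r, j) * u' i $ j)"
    by (simp only: sum.swap[where A = F])
  also have "\<dots> = (M *\<^sub>v (- finsum_vec TYPE(real) p u F)) $ r + (M' *\<^sub>v (- finsum_vec TYPE(real) p u' F)) $ r"
    unfolding mult_mat_vec_index[OF M(1) s(1) r] mult_mat_vec_index[OF M(2) s(2) r]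
    by (simp add: s_index sum_distrib_left sum_negf)
  also have "\<dots> = (M *\<^sub>v (- finsum_vec TYPE(real) p u F) + M' *\<^sub>v (- finsum_vec TYPE(real) p u' F)) $ r"
    using r M by simp
  finally show "(- finsum_vec TYPE(real) l (\<lambda>i. M *\<^sub>v u i + M' *\<^sub>v u' i) F) $ r =
      (M *\<^sub>v (- finsum_vec TYPE(real) p u F) + M' *\<^sub>v (- finsum_vec TYPE(real) p u' F)) $ r" .
next
  have "finsum_vec TYPE(real) l (\<lambda>i. M *\<^sub>v u i + M' *\<^sub>v u' i) F \<in> carrier_vec l"
    using mult_mat_vec_carrier[OF M(1) u(1)] mult_mat_vec_carrier[OF M(2) u(2)]
    by (auto intro!: finsum_vec_closed)
  then show "dim_vec (- finsum_vec TYPE(real) l (\<lambda>i. M *\<^sub>v u i + M' *\<^sub>v u' i) F) =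
      dim_vec (M *\<^sub>v (- finsum_vec TYPE(real) p u F) + M' *\<^sub>v (- finsum_vec TYPE(real) p u' F))"
    using M by auto
qed

section \<open>Solutions of the boundary value problem\<close>

lemma bvp_solution_iff:
  "bvp_solution E A B C d T f x \<longleftrightarrow>
    x \<in> extensional {0..T} \<and> dae_solution E A T f x \<and> B *\<^sub>v x 0 + C *\<^sub>v x T = d"
  unfolding bvp_solution_def dae_solution_def PiE_def Ck_vec_on_def by auto

lemma dae_solution_cong_rhs:
  "(\<And>t. t \<in> {0..T} \<Longrightarrow> f t = g t) \<Longrightarrow> dae_solution E A T f x \<longleftrightarrow> dae_solution E A T g x"
  unfolding dae_solution_def by auto

text \<open>Superposition, by which a given solution is perturbed in the underdetermined
  blocks.\<close>

lemma dae_solution_add_kernel: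
  fixes E A :: "real mat"
  assumes T: "0 < T" and E: "E \<in> carrier_mat p q" and A: "A \<in> carrier_mat p q"
    and f: "\<And>t. t \<in> {0..T} \<Longrightarrow> f t \<in> carrier_vec p"
    and x: "dae_solution E A T f x" and h: "dae_solution E A T (\<lambda>_. 0\<^sub>v p) h"
  shows "dae_solution E A T f (\<lambda>t. x t + h t)"
proof -
  have xCk: "Ck_vec_on T 1 q x" and hCk: "Ck_vec_on T 1 q h"
    using x h E unfolding dae_solution_def by auto
  note xc = Ck_vec_on_carrier[OF xCk] and hc = Ck_vec_on_carrier[OF hCk]
  have d: "((\<lambda>t. (x t + h t) $ j) has_real_derivative
      deriv_on T (\<lambda>t. x t $ j) t + deriv_on T (\<lambda>t. h t $ j) t) (at t within {0..T})"
    if j: "j < q" and t: "t \<in> {0..T}" for j t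
  proof (rule has_real_derivative_transform[OF _ t])
    show "((\<lambda>t. x t $ j + h t $ j) has_real_derivative
      deriv_on T (\<lambda>t. x t $ j) t + deriv_on T (\<lambda>t. h t $ j) t) (at t within {0..T})"
      using xCk hCk j t unfolding Ck_vec_on_def
      by (intro DERIV_add has_derivative_deriv_on) auto
  qed (use j carrier_vecD[OF hc] in auto)
  have Ck: "Ck_vec_on T 1 q (\<lambda>t. x t + h t)"
    unfolding Ck_vec_on_def
  proof (intro conjI ballI allI impI add_carrier_vec xc hc)
    fix j assume j: "j < q"
    show "Ck_on T 1 (\<lambda>t. (x t + h t) $ j)"
      by (rule Ck_on_1I[OF T _ d[OF j]])
        (use xCk hCk j in \<open>auto simp: Ck_vec_on_def intro!: continuous_on_add\<close>)
  qed
  have nd: "nderiv_vec T 1 (\<lambda>t. x t + h t) t = nderiv_vec T 1 x t + nderiv_vec T 1 h t" if t: "t \<in> {0..T}" for t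
    using xc[OF t] hc[OF t] deriv_on_eqI[OF T t d[OF _ t]] by (intro eq_vecI) auto
  have "E *\<^sub>v nderiv_vec T 1 (\<lambda>t. x t + h t) t = A *\<^sub>v (x t + h t) + f t" if "t \<in> {0<..<T}" for t
  proof -
    have t: "t \<in> {0..T}" using that by simp
    have "E *\<^sub>v nderiv_vec T 1 (\<lambda>t. x t + h t) t = E *\<^sub>v nderiv_vec T 1 x t + E *\<^sub>v nderiv_vec T 1 h t"
      unfolding nd[OF t]
      by (rule mult_add_distrib_mat_vec[OF E nderiv_vec_carrier[where g = x, OF xc[OF t]]
            nderiv_vec_carrier[where g = h, OF hc[OF t]]])
    also have "\<dots> = (A *\<^sub>v x t + f t) + (A *\<^sub>v h t + 0\<^sub>v p)"
      using x h that unfolding dae_solution_def by simp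
    also have "\<dots> = (A *\<^sub>v x t + A *\<^sub>v h t) + f t"
      using mult_mat_vec_carrier[OF A xc[OF t]] mult_mat_vec_carrier[OF A hc[OF t]] f[OF t] A
      by (intro eq_vecI) auto
    also have "A *\<^sub>v x t + A *\<^sub>v h t = A *\<^sub>v (x t + h t)"
      using mult_add_distrib_mat_vec[OF A xc[OF t] hc[OF t]] by simp
    finally show ?thesis .
  qed
  then show ?thesis
    unfolding dae_solution_def using E Ck by simp
qed

text \<open>The parameter c is the initial value \<open>y 0\<close>, the only freedom left once the
  underdetermined blocks are absent.\<close>

lemma linear_ode_iff:
  fixes M :: "real mat"
  assumes T: "0 < T" and M: "M \<in> carrier_mat n n" and g: "Ck_vec_on T 0 n g"
  shows "dae_solution (1\<^sub>m n) M T g y \<longleftrightarrow>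
    (\<exists>c\<in>carrier_vec n. \<forall>t\<in>{0..T}. y t = mat_exp (t \<cdot>\<^sub>m M) *\<^sub>v c +
      integral_vec n {0..t} (\<lambda>s. mat_exp ((t - s) \<cdot>\<^sub>m M) *\<^sub>v g s))"
proof
  assume y: "dae_solution (1\<^sub>m n) M T g y"
  then have yCk: "Ck_vec_on T 1 n y" unfolding dae_solution_def by simp
  note yc = Ck_vec_on_carrier[OF yCk]
  have ode: "nderiv_vec T 1 y t = M *\<^sub>v y t + g t" if "t \<in> {0<..<T}" for t
  proof -
    have t: "t \<in> {0..T}" using that by simp
    show ?thesis
      using y that one_mult_mat_vec[OF nderiv_vec_carrier[where g = y, OF yc[OF t]]]
      unfolding dae_solution_def by metis
  qed
  show "\<exists>c\<in>carrier_vec n. \<forall>t\<in>{0..T}. y t = mat_exp (t \<cdot>\<^sub>m M) *\<^sub>v c +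
      integral_vec n {0..t} (\<lambda>s. mat_exp ((t - s) \<cdot>\<^sub>m M) *\<^sub>v g s)"
  proof (intro bexI ballI)
    show "y 0 \<in> carrier_vec n" using yc[of 0] T by simp
  qed (rule linear_ode_unique[OF T M g yCk ode])
next
  assume "\<exists>c\<in>carrier_vec n. \<forall>t\<in>{0..T}. y t = mat_exp (t \<cdot>\<^sub>m M) *\<^sub>v c +
      integral_vec n {0..t} (\<lambda>s. mat_exp ((t - s) \<cdot>\<^sub>m M) *\<^sub>v g s)"
  then obtain c where c: "c \<in> carrier_vec n" and y: "\<And>t. t \<in> {0..T} \<Longrightarrow> y t = mat_exp (t \<cdot>\<^sub>m M) *\<^sub>v c +
      integral_vec n {0..t} (\<lambda>s. mat_exp ((t - s) \<cdot>\<^sub>m M) *\<^sub>v g s)" (is "\<And>t. _ \<Longrightarrow> _ = ?y t")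
    by blast
  note yCk = linear_ode_exists(1)[OF T M g c] and yd = linear_ode_exists(2)[OF T M g c]
  have "1\<^sub>m n *\<^sub>v nderiv_vec T 1 ?y t = M *\<^sub>v ?y t + g t" if "t \<in> {0<..<T}" for t
  proof -
    have t: "t \<in> {0..T}" using that by simp
    show ?thesis
      using one_mult_mat_vec[OF nderiv_vec_carrier[where g = ?y, OF Ck_vec_on_carrier[OF yCk t]]]
        yd[OF t] by (rule trans)
  qed
  then have "dae_solution (1\<^sub>m n) M T g ?y"
    unfolding dae_solution_def using yCk by simp
  then show "dae_solution (1\<^sub>m n) M T g y"
    using dae_solution_cong[of T y ?y, OF y] by blast
qed

lemma invertible_matE:
  fixes M :: "real mat"
  assumes "M \<in> carrier_mat n n" "invertible_mat M"
  obtains N where "N \<in> carrier_mat n n" "N * M = 1\<^sub>m n" "M * N = 1\<^sub>m n"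
proof -
  obtain N where N: "M * N = 1\<^sub>m (dim_row M)" "N * M = 1\<^sub>m (dim_row N)"
    using assms unfolding invertible_mat_def inverts_mat_def by blast
  \<comment> \<open>The dimensions of the inverse are read off from the two identity matrices it
    produces.\<close>
  have "N \<in> carrier_mat n n"
    using arg_cong[OF N(1), of dim_col] arg_cong[OF N(2), of dim_col] assms by auto
  then show ?thesis using that N assms by auto
qed

lemma integral_vec_refl: "integral_vec n {a..a} g = 0\<^sub>v n"
  by (rule eq_vecI) (simp_all add: integral_vec_def)

text \<open>To be read with \<open>Q c\<close> for a + c, \<open>d0\<close> for e, \<open>d1\<close>
  for b1 + c1 and \<open>d3\<close> for b3 + c3; the zero vectors are the contributions of the
  absent underdetermined component.\<close>

lemma boundary_sum_eq_iff:
  fixes a c e b1 b2 b3 c1 c2 c3 d :: "real vec"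
  assumes "a \<in> carrier_vec l" "c \<in> carrier_vec l" "e \<in> carrier_vec l" "b1 \<in> carrier_vec l"
    "b3 \<in> carrier_vec l" "c1 \<in> carrier_vec l" "c3 \<in> carrier_vec l" "d \<in> carrier_vec l"
  shows "(a + (b1 + (0\<^sub>v l + b3))) + ((c + e) + (c1 + (0\<^sub>v l + c3))) = d \<longleftrightarrow>
    a + c = d - e - (b1 + c1) - (b3 + c3)"
  (is "?u = d \<longleftrightarrow> ?v = ?w")
proof -
  note dim = assms[THEN carrier_vecD]
  have "?u = d \<longleftrightarrow> (\<forall>i<l. a $ i + (b1 $ i + b3 $ i) + (c $ i + e $ i + (c1 $ i + c3 $ i)) = d $ i)"
    unfolding vec_eq_iff by (simp add: dim del: assoc_add_vec)
  also have "\<dots> \<longleftrightarrow>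
    (\<forall>i<l. a $ i + c $ i = d $ i - e $ i - (b1 $ i + c1 $ i) - (b3 $ i + c3 $ i))"
    by (simp add: algebra_simps)
  also have "\<dots> \<longleftrightarrow> ?v = ?w"
    unfolding vec_eq_iff by (simp add: dim del: assoc_add_vec)
  finally show ?thesis .
qed

theorem theorem4p3:
  fixes E A B C W V A0 :: "real mat" and d :: "real vec" and T :: real
    and f :: "real \<Rightarrow> real vec"
    and m n l n0 :: nat and \<alpha> \<beta> \<gamma> :: "nat list"
  assumes E: "E \<in> carrier_mat m n" and A: "A \<in> carrier_mat m n"
    and B: "B \<in> carrier_mat l n" and C: "C \<in> carrier_mat l n"
    and d: "d \<in> carrier_vec l" and T: "0 < T"
    and f: "\<And>t. t \<in> {0..T} \<Longrightarrow> f t \<in> carrier_vec m"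
    and f_C1: "\<And>i. i < m \<Longrightarrow> (\<lambda>t. f t $ i) C1_differentiable_on {0<..<T}"
    and W: "W \<in> carrier_mat m m" "invertible_mat W"
    and V: "V \<in> carrier_mat n n" "invertible_mat V"
    and qkf: "quasi_Kronecker_form (W * E * V) (W * A * V) n0 A0 \<alpha> \<beta> \<gamma>"
  defines "f0 \<equiv> \<lambda>t. subvec 0 n0 (W *\<^sub>v f t)"
    and "f1 \<equiv> \<lambda>t. subvec n0 (sum_list \<alpha>) (W *\<^sub>v f t)"
    and "f3 \<equiv> \<lambda>t. subvec (n0 + sum_list \<alpha> + (sum_list \<beta> - length \<beta>)) (sum_list \<gamma>) (W *\<^sub>v f t)"
    and "B0 \<equiv> subcols 0 n0 (B * V)"
    and "B1 \<equiv> subcols n0 (sum_list \<alpha>) (B * V)"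
    and "B3 \<equiv> subcols (n0 + sum_list \<alpha> + sum_list \<beta>) (sum_list \<gamma> - length \<gamma>) (B * V)"
    and "C0 \<equiv> subcols 0 n0 (C * V)"
    and "C1 \<equiv> subcols n0 (sum_list \<alpha>) (C * V)"
    and "C3 \<equiv> subcols (n0 + sum_list \<alpha> + sum_list \<beta>) (sum_list \<gamma> - length \<gamma>) (C * V)"
  assumes A0: "Ck_vec_on T 0 n0 f0"
    and A1: "\<And>k. k < length \<alpha> \<Longrightarrow> Ck_vec_on T (\<alpha> ! k) (\<alpha> ! k) (\<lambda>t. block_vec \<alpha> k (f1 t))"
    and A3: "\<And>k. k < length \<gamma> \<Longrightarrow> Ck_vec_on T (\<gamma> ! k) (\<gamma> ! k) (\<lambda>t. block_vec \<gamma> k (f3 t))"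
  defines "conv0 \<equiv> \<lambda>t. integral_vec n0 {0..t} (\<lambda>s. mat_exp ((t - s) \<cdot>\<^sub>m A0) *\<^sub>v f0 s)"
    and "Q \<equiv> B0 + C0 * mat_exp (T \<cdot>\<^sub>m A0)"
  defines "d0 \<equiv> C0 *\<^sub>v conv0 T"
    and "d1 \<equiv> - finsum_vec TYPE(real) l
                 (\<lambda>i. B1 *\<^sub>v N_term T \<alpha> f1 i 0 + C1 *\<^sub>v N_term T \<alpha> f1 i T)
                 {..<max_index \<alpha>}"
    and "d3 \<equiv> (if length \<gamma> < sum_list \<gamma> then
               - finsum_vec TYPE(real) l
                 (\<lambda>i. B3 *\<^sub>v (K_mat \<gamma> *\<^sub>v N_term T \<gamma> f3 i 0)
                      + C3 *\<^sub>v (K_mat \<gamma> *\<^sub>v N_term T \<gamma> f3 i T))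
                 {..<max_index \<gamma>}
              else 0\<^sub>v l)"
  defines "dhat \<equiv> d - d0 - d1 - d3"
  defines "conditions \<equiv>
       \<beta> = []
     \<and> (\<forall>k<length \<gamma>. \<forall>t\<in>{0..T}.
          (\<Sum>i = 1..\<gamma> ! k. (deriv_on T ^^ (\<gamma> ! k - i)) (\<lambda>s. block_vec \<gamma> k (f3 s) $ (i - 1)) t) = 0)
     \<and> dhat \<in> vec_space.col_space l Q
     \<and> vec_space.rank l Q = n0"
  shows "((\<exists>!x. bvp_solution E A B C d T f x) \<longleftrightarrow> conditions)
    \<and> (conditions \<longrightarrow> (\<forall>x. bvp_solution E A B C d T f x \<longrightarrow> (\<forall>t\<in>{0..T}.
         x t = V *\<^sub>v
           ((mat_exp (t \<cdot>\<^sub>m A0)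
               *\<^sub>v (the (mat_inverse (transpose_mat Q * Q)) *\<^sub>v (transpose_mat Q *\<^sub>v dhat)) + conv0 t)
            @\<^sub>v (- finsum_vec TYPE(real) (sum_list \<alpha>) (\<lambda>i. N_term T \<alpha> f1 i t) {..<max_index \<alpha>})
            @\<^sub>v (- (K_mat \<gamma> *\<^sub>v
                  finsum_vec TYPE(real) (sum_list \<gamma>) (\<lambda>i. N_term T \<gamma> f3 i t) {..<max_index \<gamma>}))))))"
proof -
  let ?na = "sum_list \<alpha>" and ?nb = "sum_list \<beta>" and ?ng = "sum_list \<gamma>"
  let ?rb = "sum_list \<beta> - length \<beta>" and ?rg = "sum_list \<gamma> - length \<gamma>"
  have A0c: "A0 \<in> carrier_mat n0 n0" and \<alpha>: "multi_index \<alpha>" and \<beta>: "multi_index \<beta>" and \<gamma>: "multi_index \<gamma>"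
    and E': "W * E * V = diag_block_mat [1\<^sub>m n0, N_mat \<alpha>, L_mat \<beta>, transpose_mat (L_mat \<gamma>)]"
    and A': "W * A * V = diag_block_mat [A0, 1\<^sub>m ?na, K_mat \<beta>, transpose_mat (K_mat \<gamma>)]"
    using qkf unfolding quasi_Kronecker_form_def by auto
  note Kb = K_mat_carrier[OF \<beta>] and Lb = L_mat_carrier[OF \<beta>]
  have KTg: "transpose_mat (K_mat \<gamma>) \<in> carrier_mat ?ng ?rg" and LTg: "transpose_mat (L_mat \<gamma>) \<in> carrier_mat ?ng ?rg"
    using \<gamma> by simp_all
  \<comment> \<open>The sizes of the blocks add up to m and n only because of the quasi-Kronecker
    form; comparing dimensions extracts this.\<close>
  have "dim_row (W * E * V) = m" "dim_col (W * E * V) = n" using W V by auto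
  then have m: "m = n0 + (?na + (?rb + ?ng))" and n: "n = n0 + (?na + (?nb + ?rg))"
    unfolding E' using carrier_matD[OF N_mat_carrier] carrier_matD[OF Lb] carrier_matD[OF LTg]
    by (auto simp: dim_diag_block_mat)
  obtain Wi where Wi: "Wi \<in> carrier_mat m m" "Wi * W = 1\<^sub>m m" by (rule invertible_matE[OF W])
  obtain Vi where Vi: "Vi \<in> carrier_mat n n" "Vi * V = 1\<^sub>m n" "V * Vi = 1\<^sub>m n" by (rule invertible_matE[OF V])
  define f2 where "f2 t = subvec (n0 + ?na) ?rb (W *\<^sub>v f t)" for t
  have fc: "f0 t \<in> carrier_vec n0" "f1 t \<in> carrier_vec ?na" "f2 t \<in> carrier_vec ?rb" "f3 t \<in> carrier_vec ?ng" for t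
    unfolding f0_def f1_def f2_def f3_def by simp_all
  have Wf: "W *\<^sub>v f t = f0 t @\<^sub>v f1 t @\<^sub>v f2 t @\<^sub>v f3 t" if "t \<in> {0..T}" for t
  proof -
    have "W *\<^sub>v f t \<in> carrier_vec m" using W f[OF that] by simp
    then have "W *\<^sub>v f t = subvec 0 (n0 + (?na + (?rb + ?ng))) (W *\<^sub>v f t)"
      unfolding m using subvec_all by simp
    then show ?thesis
      by (simp add: subvec_append f0_def f1_def f2_def f3_def add.assoc)
  qed
  have bf1: "blockwise_Ck T \<alpha> f1" and bf3: "blockwise_Ck T \<gamma> f3"
    using A1 A3 fc by (auto intro!: blockwise_CkI)
  let ?Z1 = "nilpotent_solution T \<alpha> f1" and ?Z3 = "\<lambda>t. K_mat \<gamma> *\<^sub>v nilpotent_solution T \<gamma> f3 t"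
  have Z1c: "?Z1 t \<in> carrier_vec ?na" if "t \<in> {0..T}" for t
    using nilpotent_solution_carrier[OF T bf1 that] .
  have Z3c: "?Z3 t \<in> carrier_vec ?rg" if "t \<in> {0..T}" for t
    using mult_mat_vec_carrier[OF K_mat_carrier[OF \<gamma>] nilpotent_solution_carrier[OF T bf3 that]] .
  have T0: "0 \<in> {0..T}" "T \<in> {0..T}" using T by auto
  define B2 where "B2 = subcols (n0 + ?na) ?nb (B * V)"
  define C2 where "C2 = subcols (n0 + ?na) ?nb (C * V)"
  have BV: "B * V \<in> carrier_mat l n" and CV: "C * V \<in> carrier_mat l n" using B C V by auto
  have Bc: "B0 \<in> carrier_mat l n0" "B1 \<in> carrier_mat l ?na" "B2 \<in> carrier_mat l ?nb" "B3 \<in> carrier_mat l ?rg"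
    and Cc: "C0 \<in> carrier_mat l n0" "C1 \<in> carrier_mat l ?na" "C2 \<in> carrier_mat l ?nb" "C3 \<in> carrier_mat l ?rg"
    unfolding B0_def B1_def B2_def B3_def C0_def C1_def C2_def C3_def using BV CV by auto
  have B_mult: "B *\<^sub>v (V *\<^sub>v (v0 @\<^sub>v v1 @\<^sub>v v2 @\<^sub>v v3)) = B0 *\<^sub>v v0 + (B1 *\<^sub>v v1 + (B2 *\<^sub>v v2 + B3 *\<^sub>v v3))"
    and C_mult: "C *\<^sub>v (V *\<^sub>v (v0 @\<^sub>v v1 @\<^sub>v v2 @\<^sub>v v3)) = C0 *\<^sub>v v0 + (C1 *\<^sub>v v1 + (C2 *\<^sub>v v2 + C3 *\<^sub>v v3))"
    if v: "v0 \<in> carrier_vec n0" "v1 \<in> carrier_vec ?na" "v2 \<in> carrier_vec ?nb" "v3 \<in> carrier_vec ?rg" for v0 v1 v2 v3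
  proof -
    have split: "M *\<^sub>v (V *\<^sub>v (v0 @\<^sub>v v1 @\<^sub>v v2 @\<^sub>v v3)) =
        subcols 0 n0 (M * V) *\<^sub>v v0 + (subcols n0 ?na (M * V) *\<^sub>v v1 +
        (subcols (n0 + ?na) ?nb (M * V) *\<^sub>v v2 + subcols (n0 + ?na + ?nb) ?rg (M * V) *\<^sub>v v3))"
      if M: "M \<in> carrier_mat l n" for M
    proof -
      have MV: "M * V \<in> carrier_mat l n" using M V by simp
      have v': "v2 @\<^sub>v v3 \<in> carrier_vec (?nb + ?rg)" "v1 @\<^sub>v v2 @\<^sub>v v3 \<in> carrier_vec (?na + (?nb + ?rg))"
        "v0 @\<^sub>v v1 @\<^sub>v v2 @\<^sub>v v3 \<in> carrier_vec n"
        unfolding n using v by (auto intro!: append_carrier_vec)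
      have "M *\<^sub>v (V *\<^sub>v (v0 @\<^sub>v v1 @\<^sub>v v2 @\<^sub>v v3)) =
          subcols 0 (n0 + (?na + (?nb + ?rg))) (M * V) *\<^sub>v (v0 @\<^sub>v v1 @\<^sub>v v2 @\<^sub>v v3)"
        using assoc_mult_mat_vec[OF M V(1) v'(3)] subcols_all[OF MV] n by simp
      then show ?thesis
        unfolding subcols_append_mult_vec[OF MV v(1) v'(2)] subcols_append_mult_vec[OF MV v(2) v'(1)]
          subcols_append_mult_vec[OF MV v(3) v(4)] by (simp add: add.assoc)
    qed
    show "B *\<^sub>v (V *\<^sub>v (v0 @\<^sub>v v1 @\<^sub>v v2 @\<^sub>v v3)) = B0 *\<^sub>v v0 + (B1 *\<^sub>v v1 + (B2 *\<^sub>v v2 + B3 *\<^sub>v v3))"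
      and "C *\<^sub>v (V *\<^sub>v (v0 @\<^sub>v v1 @\<^sub>v v2 @\<^sub>v v3)) = C0 *\<^sub>v v0 + (C1 *\<^sub>v v1 + (C2 *\<^sub>v v2 + C3 *\<^sub>v v3))"
      unfolding split[OF B] split[OF C] B0_def B1_def B2_def B3_def C0_def C1_def C2_def C3_def by simp_all
  qed
  have V_inj: "u = v" if "V *\<^sub>v u = V *\<^sub>v v" "u \<in> carrier_vec n" "v \<in> carrier_vec n" for u v
    using assoc_mult_mat_vec[OF Vi(1) V(1) that(2)] assoc_mult_mat_vec[OF Vi(1) V(1) that(3)] that Vi(2)
    by simp
  \<comment> \<open>The components have to match x on the interval only. The equivalence thus serves
    both to analyse a given solution and to verify one that is assembled from components.\<close>
  have decouple: "bvp_solution E A B C d T f x \<longleftrightarrow>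
      dae_solution (1\<^sub>m n0) A0 T f0 y0 \<and> dae_solution (N_mat \<alpha>) (1\<^sub>m ?na) T f1 y1 \<and>
      dae_solution (L_mat \<beta>) (K_mat \<beta>) T f2 y2 \<and>
      dae_solution (transpose_mat (L_mat \<gamma>)) (transpose_mat (K_mat \<gamma>)) T f3 y3 \<and>
      (B0 *\<^sub>v y0 0 + (B1 *\<^sub>v y1 0 + (B2 *\<^sub>v y2 0 + B3 *\<^sub>v y3 0))) +
      (C0 *\<^sub>v y0 T + (C1 *\<^sub>v y1 T + (C2 *\<^sub>v y2 T + C3 *\<^sub>v y3 T))) = d"
    if ext: "x \<in> extensional {0..T}"
      and xy: "\<forall>t\<in>{0..T}. y0 t \<in> carrier_vec n0 \<and> y1 t \<in> carrier_vec ?na \<and>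
        y2 t \<in> carrier_vec ?nb \<and> y3 t \<in> carrier_vec ?rg \<and>
        x t = V *\<^sub>v (y0 t @\<^sub>v y1 t @\<^sub>v y2 t @\<^sub>v y3 t)"
    for x y0 y1 y2 y3
  proof -
    have x: "x t = V *\<^sub>v (y0 t @\<^sub>v y1 t @\<^sub>v y2 t @\<^sub>v y3 t)"
      and y: "y0 t \<in> carrier_vec n0" "y1 t \<in> carrier_vec ?na" "y2 t \<in> carrier_vec ?nb" "y3 t \<in> carrier_vec ?rg"
      if "t \<in> {0..T}" for t
      using xy that by auto
    let ?y = "\<lambda>t. y0 t @\<^sub>v y1 t @\<^sub>v y2 t @\<^sub>v y3 t"
    have yc: "?y t \<in> carrier_vec n" if "t \<in> {0..T}" for t
      unfolding n using y[OF that] by (auto intro!: append_carrier_vec)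
    have "dae_solution E A T f x \<longleftrightarrow> dae_solution E A T f (\<lambda>t. V *\<^sub>v ?y t)"
      by (rule dae_solution_cong[OF x])
    also have "\<dots> \<longleftrightarrow> dae_solution (W * E * V) (W * A * V) T (\<lambda>t. W *\<^sub>v f t) ?y"
      by (rule dae_solution_transform_iff[OF T E A W(1) Wi V(1) Vi(1,2) f yc, symmetric])
    also have "\<dots> \<longleftrightarrow> dae_solution (W * E * V) (W * A * V) T (\<lambda>t. f0 t @\<^sub>v f1 t @\<^sub>v f2 t @\<^sub>v f3 t) ?y"
      by (rule dae_solution_cong_rhs[OF Wf])
    also have "\<dots> \<longleftrightarrow> dae_solution (1\<^sub>m n0) A0 T f0 y0 \<and> dae_solution (N_mat \<alpha>) (1\<^sub>m ?na) T f1 y1 \<and>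
        dae_solution (L_mat \<beta>) (K_mat \<beta>) T f2 y2 \<and>
        dae_solution (transpose_mat (L_mat \<gamma>)) (transpose_mat (K_mat \<gamma>)) T f3 y3"
      unfolding E' A'
      by (rule dae_solution_diag_block_iff[OF one_carrier_mat A0c N_mat_carrier one_carrier_mat Lb Kb LTg KTg fc y])
    finally show ?thesis
      unfolding bvp_solution_iff x[OF T0(1)] x[OF T0(2)] B_mult[OF y[OF T0(1)]] C_mult[OF y[OF T0(2)]]
      using ext by blast
  qed
  \<comment> \<open>The components are the consecutive slices of the inverse of V applied to
    x.\<close>
  have parts: "\<exists>y0 y1 y2 y3. (\<forall>t\<in>{0..T}. y0 t \<in> carrier_vec n0 \<and> y1 t \<in> carrier_vec ?na \<and>
      y2 t \<in> carrier_vec ?nb \<and> y3 t \<in> carrier_vec ?rg \<and>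
      x t = V *\<^sub>v (y0 t @\<^sub>v y1 t @\<^sub>v y2 t @\<^sub>v y3 t))"
    if x: "bvp_solution E A B C d T f x" for x
  proof (intro exI ballI conjI)
    fix t assume t: "t \<in> {0..T}"
    let ?v = "Vi *\<^sub>v x t"
    have xc: "x t \<in> carrier_vec n"
      using x t E unfolding bvp_solution_def by auto
    then have "?v \<in> carrier_vec n" using Vi by simp
    then have "?v = subvec 0 (n0 + (?na + (?nb + ?rg))) ?v"
      unfolding n using subvec_all by simp
    moreover have "x t = V *\<^sub>v ?v"
      using assoc_mult_mat_vec[OF V(1) Vi(1) xc] Vi(3) xc by simp
    ultimately show "x t = V *\<^sub>v (subvec 0 n0 ?v @\<^sub>v subvec n0 ?na ?v @\<^sub>v
        subvec (n0 + ?na) ?nb ?v @\<^sub>v subvec (n0 + (?na + ?nb)) ?rg ?v)"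
      by (simp add: subvec_append add.assoc)
  qed simp_all
  show ?thesis
  proof (cases "\<beta> = []")
    case False
    \<comment> \<open>Solvability is not decided here: if some solution exists, adding h to its
      underdetermined component gives a different one. The boundary condition is kept since h
      vanishes at both ends.\<close>
    have "\<not> (\<exists>!x. bvp_solution E A B C d T f x)"
    proof
      assume ex1: "\<exists>!x. bvp_solution E A B C d T f x"
      then obtain x where x: "bvp_solution E A B C d T f x" by blast
      from parts[OF x] obtain y0 y1 y2 y3 where
        y_x: "\<forall>t\<in>{0..T}. y0 t \<in> carrier_vec n0 \<and> y1 t \<in> carrier_vec ?na \<and>
          y2 t \<in> carrier_vec ?nb \<and> y3 t \<in> carrier_vec ?rg \<and>
          x t = V *\<^sub>v (y0 t @\<^sub>v y1 t @\<^sub>v y2 t @\<^sub>v y3 t)"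
        by blast
      then have xy: "x t = V *\<^sub>v (y0 t @\<^sub>v y1 t @\<^sub>v y2 t @\<^sub>v y3 t)"
        and y: "y0 t \<in> carrier_vec n0" "y1 t \<in> carrier_vec ?na" "y2 t \<in> carrier_vec ?nb" "y3 t \<in> carrier_vec ?rg"
        if "t \<in> {0..T}" for t
        using that by auto
      have ext: "x \<in> extensional {0..T}" using x unfolding bvp_solution_iff by blast
      obtain h t where h: "dae_solution (L_mat \<beta>) (K_mat \<beta>) T (\<lambda>_. 0\<^sub>v ?rb) h"
        "h 0 = 0\<^sub>v ?nb" "h T = 0\<^sub>v ?nb" and t: "t \<in> {0..T}" "h t \<noteq> 0\<^sub>v ?nb"
        by (rule underdetermined_dae_kernel[OF T \<beta> False])
      have "Ck_vec_on T 1 ?nb h"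
        using h(1) unfolding dae_solution_def carrier_matD(2)[OF Lb] by blast
      note hc = Ck_vec_on_carrier[OF this]
      let ?x' = "restrict (\<lambda>t. V *\<^sub>v (y0 t @\<^sub>v y1 t @\<^sub>v (y2 t + h t) @\<^sub>v y3 t)) {0..T}"
      have y2h: "y2 0 + h 0 = y2 0" "y2 T + h T = y2 T"
        using h y(3)[OF T0(1)] y(3)[OF T0(2)] by simp_all
      note sol = decouple[OF ext y_x, THEN iffD1, OF x]
      have "dae_solution (L_mat \<beta>) (K_mat \<beta>) T f2 (\<lambda>t. y2 t + h t)"
        using sol h(1) by (intro dae_solution_add_kernel[OF T Lb Kb fc(3)]) auto
      moreover have "bvp_solution E A B C d T f ?x' \<longleftrightarrow>
        dae_solution (1\<^sub>m n0) A0 T f0 y0 \<and> dae_solution (N_mat \<alpha>) (1\<^sub>m ?na) T f1 y1 \<and>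
        dae_solution (L_mat \<beta>) (K_mat \<beta>) T f2 (\<lambda>t. y2 t + h t) \<and>
        dae_solution (transpose_mat (L_mat \<gamma>)) (transpose_mat (K_mat \<gamma>)) T f3 y3 \<and>
        (B0 *\<^sub>v y0 0 + (B1 *\<^sub>v y1 0 + (B2 *\<^sub>v (y2 0 + h 0) + B3 *\<^sub>v y3 0))) +
        (C0 *\<^sub>v y0 T + (C1 *\<^sub>v y1 T + (C2 *\<^sub>v (y2 T + h T) + C3 *\<^sub>v y3 T))) = d"
        using y hc by (intro decouple) auto
      ultimately have "bvp_solution E A B C d T f ?x'"
        using sol unfolding y2h by blast
      then have "x = ?x'" using ex1 x by blast
      then have "x t = ?x' t" by (rule fun_cong)
      then have "V *\<^sub>v (y0 t @\<^sub>v y1 t @\<^sub>v y2 t @\<^sub>v y3 t) = V *\<^sub>v (y0 t @\<^sub>v y1 t @\<^sub>v (y2 t + h t) @\<^sub>v y3 t)"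
        unfolding xy[OF t(1)] using t(1) by simp
      then have "y0 t @\<^sub>v y1 t @\<^sub>v y2 t @\<^sub>v y3 t = y0 t @\<^sub>v y1 t @\<^sub>v (y2 t + h t) @\<^sub>v y3 t"
        by (rule V_inj) (use y[OF t(1)] hc[OF t(1)] in \<open>auto simp: n intro!: append_carrier_vec\<close>)
      then have "y2 t = y2 t + h t"
        using append_vec_eq[OF y(1)[OF t(1)] y(1)[OF t(1)]] append_vec_eq[OF y(2)[OF t(1)] y(2)[OF t(1)]]
          append_vec_eq[OF y(3)[OF t(1)] add_carrier_vec[OF y(3)[OF t(1)] hc[OF t(1)]]] by metis
      then have "(y2 t + h t) $ i = y2 t $ i" for i by simp
      then have "h t $ i = 0" if "i < ?nb" for i
        using that index_add_vec(1)[of i "h t" "y2 t"] carrier_vecD[OF hc[OF t(1)]] by simp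
      then have "h t = 0\<^sub>v ?nb" using hc[OF t(1)] by (intro eq_vecI) auto
      then show False using t(2) by simp
    qed
    then show ?thesis unfolding conditions_def using False by blast
  next
    case True
    let ?cond = "\<forall>k<length \<gamma>. \<forall>t\<in>{0..T}. (\<Sum>i = 1..\<gamma> ! k.
      (deriv_on T ^^ (\<gamma> ! k - i)) (\<lambda>s. block_vec \<gamma> k (f3 s) $ (i - 1)) t) = 0"
    let ?y0 = "\<lambda>c t. mat_exp (t \<cdot>\<^sub>m A0) *\<^sub>v c + conv0 t"
    \<comment> \<open>The candidate with initial value c in the differential block; the restriction
      makes it extensional, as \<open>bvp_solution\<close> demands.\<close>
    define X where "X c = restrict (\<lambda>t. V *\<^sub>v (?y0 c t @\<^sub>v ?Z1 t @\<^sub>v ?Z3 t)) {0..T}" for c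
    have nb: "?nb = 0" "?rb = 0" using True by simp_all
    have conv0c: "conv0 t \<in> carrier_vec n0" for t
      unfolding conv0_def integral_vec_def by simp
    have expc: "mat_exp (t \<cdot>\<^sub>m A0) \<in> carrier_mat n0 n0" for t
      using A0c by simp
    have y0c: "?y0 c t \<in> carrier_vec n0" if "c \<in> carrier_vec n0" for c t
      using mult_mat_vec_carrier[OF expc that] conv0c by simp
    have y0_0: "?y0 c 0 = c" if "c \<in> carrier_vec n0" for c
      unfolding conv0_def integral_vec_refl mat_exp_0[OF A0c] using that by simp
    have Qc: "Q \<in> carrier_mat l n0"
      unfolding Q_def using Bc(1) Cc(1) expc by simp
    have d1_eq: "d1 = B1 *\<^sub>v ?Z1 0 + C1 *\<^sub>v ?Z1 T"
      unfolding d1_def nilpotent_solution_def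
      by (rule finsum_vec_mult_mat[OF finite_lessThan Bc(2) Cc(2)
            N_term_carrier[OF T bf1 T0(1)] N_term_carrier[OF T bf1 T0(2)]])
    have d3_eq: "d3 = B3 *\<^sub>v ?Z3 0 + C3 *\<^sub>v ?Z3 T"
    proof (cases "length \<gamma> < ?ng")
      case True
      note K = K_mat_carrier[OF \<gamma>]
      note N = N_term_carrier[OF T bf3 T0(1)] N_term_carrier[OF T bf3 T0(2)]
      have "d3 = - finsum_vec TYPE(real) l
          (\<lambda>i. (B3 * K_mat \<gamma>) *\<^sub>v N_term T \<gamma> f3 i 0 + (C3 * K_mat \<gamma>) *\<^sub>v N_term T \<gamma> f3 i T)
          {..<max_index \<gamma>}"
        unfolding d3_def assoc_mult_mat_vec[OF Bc(4) K N(1)] assoc_mult_mat_vec[OF Cc(4) K N(2)]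
        using True by simp
      also have "\<dots> = (B3 * K_mat \<gamma>) *\<^sub>v nilpotent_solution T \<gamma> f3 0 +
          (C3 * K_mat \<gamma>) *\<^sub>v nilpotent_solution T \<gamma> f3 T"
        unfolding nilpotent_solution_def
        by (rule finsum_vec_mult_mat[OF finite_lessThan mult_carrier_mat[OF Bc(4) K]
              mult_carrier_mat[OF Cc(4) K] N])
      finally show ?thesis
        unfolding assoc_mult_mat_vec[OF Bc(4) K nilpotent_solution_carrier[OF T bf3 T0(1)]]
          assoc_mult_mat_vec[OF Cc(4) K nilpotent_solution_carrier[OF T bf3 T0(2)]] .
    next
      case False
      then have rg: "?rg = 0" by simp
      \<comment> \<open>All blocks of \<gamma> have size 1 and contribute no unknowns. The products
        are empty sums, in agreement with the value prescribed for \<open>d3\<close> in this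
        case.\<close>
      have "M *\<^sub>v w = 0\<^sub>v l" if "M \<in> carrier_mat l ?rg" "w \<in> carrier_vec ?rg" for M :: "real mat" and w
        using that unfolding rg by (intro eq_vecI) (auto simp: scalar_prod_def)
      then show ?thesis
        using False Bc(4) Cc(4) Z3c[OF T0(1)] Z3c[OF T0(2)] unfolding d3_def by simp
    qed
    have d0c: "d0 \<in> carrier_vec l" unfolding d0_def using mult_mat_vec_carrier[OF Cc(1) conv0c] .
    have d1c: "d1 \<in> carrier_vec l" unfolding d1_eq
      using mult_mat_vec_carrier[OF Bc(2) Z1c[OF T0(1)]] mult_mat_vec_carrier[OF Cc(2) Z1c[OF T0(2)]] by simp
    have d3c: "d3 \<in> carrier_vec l" unfolding d3_eq
      using mult_mat_vec_carrier[OF Bc(4) Z3c[OF T0(1)]] mult_mat_vec_carrier[OF Cc(4) Z3c[OF T0(2)]] by simp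
    have dhatc: "dhat \<in> carrier_vec l"
      unfolding dhat_def using d d0c d1c d3c by simp
    have Q_mult: "Q *\<^sub>v c = B0 *\<^sub>v c + C0 *\<^sub>v (mat_exp (T \<cdot>\<^sub>m A0) *\<^sub>v c)" if c: "c \<in> carrier_vec n0" for c
      unfolding Q_def
      using add_mult_distrib_mat_vec[OF Bc(1) mult_carrier_mat[OF Cc(1) expc] c]
        assoc_mult_mat_vec[OF Cc(1) expc c] by simp
    \<comment> \<open>At time 0 the exponential is the identity and the integral vanishes, so B0
      acts on c itself. At T the terms in c complete \<open>Q c\<close>, and the others move to the
      right into \<open>dhat\<close>.\<close>
    have bc_iff: "(B0 *\<^sub>v ?y0 c 0 + (B1 *\<^sub>v ?Z1 0 + (B2 *\<^sub>v 0\<^sub>v ?nb + B3 *\<^sub>v ?Z3 0))) +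
      (C0 *\<^sub>v ?y0 c T + (C1 *\<^sub>v ?Z1 T + (C2 *\<^sub>v 0\<^sub>v ?nb + C3 *\<^sub>v ?Z3 T))) = d \<longleftrightarrow> Q *\<^sub>v c = dhat"
      if c: "c \<in> carrier_vec n0" for c
    proof -
      have 0: "B2 *\<^sub>v 0\<^sub>v ?nb = 0\<^sub>v l" "C2 *\<^sub>v 0\<^sub>v ?nb = 0\<^sub>v l" using Bc(3) Cc(3) by auto
      have C0: "C0 *\<^sub>v ?y0 c T = C0 *\<^sub>v (mat_exp (T \<cdot>\<^sub>m A0) *\<^sub>v c) + d0"
        unfolding d0_def by (rule mult_add_distrib_mat_vec[OF Cc(1) mult_mat_vec_carrier[OF expc c] conv0c])
      show ?thesis
        unfolding y0_0[OF c] 0 C0 Q_mult[OF c] dhat_def d1_eq d3_eq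
        by (rule boundary_sum_eq_iff)
          (intro mult_mat_vec_carrier[OF Bc(1) c] mult_mat_vec_carrier[OF Cc(1) mult_mat_vec_carrier[OF expc c]]
            d0c d mult_mat_vec_carrier[OF Bc(2) Z1c[OF T0(1)]] mult_mat_vec_carrier[OF Cc(2) Z1c[OF T0(2)]]
            mult_mat_vec_carrier[OF Bc(4) Z3c[OF T0(1)]] mult_mat_vec_carrier[OF Cc(4) Z3c[OF T0(2)]])+
    qed
    have append0: "0\<^sub>v ?nb @\<^sub>v v = v" for v :: "real vec"
      unfolding nb by (rule eq_vecI) auto
    have ode: "dae_solution (1\<^sub>m n0) A0 T f0 y \<longleftrightarrow> (\<exists>c\<in>carrier_vec n0. \<forall>t\<in>{0..T}. y t = ?y0 c t)" for y
      unfolding conv0_def by (rule linear_ode_iff[OF T A0c A0])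
    \<comment> \<open>A complete description of the solution set; both the equivalence and the
      explicit formula are derived from it.\<close>
    have sol_iff: "bvp_solution E A B C d T f x \<longleftrightarrow>
      ?cond \<and> (\<exists>c. c \<in> carrier_vec n0 \<and> Q *\<^sub>v c = dhat \<and> x = X c)" for x
    proof
      assume x: "bvp_solution E A B C d T f x"
      from parts[OF x] obtain y0 y1 y2 y3 where
        y_x: "\<forall>t\<in>{0..T}. y0 t \<in> carrier_vec n0 \<and> y1 t \<in> carrier_vec ?na \<and>
          y2 t \<in> carrier_vec ?nb \<and> y3 t \<in> carrier_vec ?rg \<and>
          x t = V *\<^sub>v (y0 t @\<^sub>v y1 t @\<^sub>v y2 t @\<^sub>v y3 t)"
        by blast
      then have xy: "x t = V *\<^sub>v (y0 t @\<^sub>v y1 t @\<^sub>v y2 t @\<^sub>v y3 t)"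
        and y: "y0 t \<in> carrier_vec n0" "y1 t \<in> carrier_vec ?na" "y2 t \<in> carrier_vec ?nb" "y3 t \<in> carrier_vec ?rg"
        if "t \<in> {0..T}" for t
        using that by auto
      have ext: "x \<in> extensional {0..T}" using x unfolding bvp_solution_iff by blast
      note sol = decouple[OF ext y_x, THEN iffD1, OF x]
      obtain c where c: "c \<in> carrier_vec n0" and y0: "\<And>t. t \<in> {0..T} \<Longrightarrow> y0 t = ?y0 c t"
        using sol ode[of y0] by blast
      have y1: "y1 t = ?Z1 t" if "t \<in> {0..T}" for t
        using sol nilpotent_dae_iff[OF T bf1, of y1] that by blast
      have y2: "y2 t = 0\<^sub>v ?nb" if "t \<in> {0..T}" for t
        using y(3)[OF that] unfolding nb(1) by auto
      have y3: "?cond" "\<And>t. t \<in> {0..T} \<Longrightarrow> y3 t = ?Z3 t"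
        using sol overdetermined_dae_iff[OF T bf3 \<gamma>, of y3] by blast+
      have "Q *\<^sub>v c = dhat"
        using sol bc_iff[OF c] y0[OF T0(1)] y0[OF T0(2)] y1[OF T0(1)] y1[OF T0(2)] y2[OF T0(1)] y2[OF T0(2)]
          y3(2)[OF T0(1)] y3(2)[OF T0(2)] by simp
      moreover have "x = X c"
        using ext unfolding X_def
        by (intro extensionalityI[of _ "{0..T}"]) (auto simp: xy y0 y1 y2 y3(2) append0)
      ultimately show "?cond \<and> (\<exists>c. c \<in> carrier_vec n0 \<and> Q *\<^sub>v c = dhat \<and> x = X c)"
        using c y3(1) by blast
    next
      assume "?cond \<and> (\<exists>c. c \<in> carrier_vec n0 \<and> Q *\<^sub>v c = dhat \<and> x = X c)"
      then obtain c where cond: ?cond and c: "c \<in> carrier_vec n0" "Q *\<^sub>v c = dhat" and x: "x = X c"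
        by blast
      have "dae_solution (1\<^sub>m n0) A0 T f0 (?y0 c)" using ode c(1) by blast
      moreover have "dae_solution (N_mat \<alpha>) (1\<^sub>m ?na) T f1 ?Z1"
        using nilpotent_dae_iff[OF T bf1] by blast
      moreover have "dae_solution (L_mat \<beta>) (K_mat \<beta>) T f2 (\<lambda>t. 0\<^sub>v ?nb)"
      proof -
        \<comment> \<open>Both sides of the equation are vectors of length 0, hence equal.\<close>
        have empty: "v = w" if "v \<in> carrier_vec ?rb" "w \<in> carrier_vec ?rb" for v w :: "real vec"
          using that unfolding nb(2) by (intro eq_vecI) simp_all
        have "Ck_vec_on T 1 ?nb (\<lambda>t. 0\<^sub>v ?nb)"
          unfolding nb(1) Ck_vec_on_def by simp
        moreover have "nderiv_vec T 1 (\<lambda>t. 0\<^sub>v ?nb) t \<in> carrier_vec ?nb" for t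
          by (rule nderiv_vec_carrier) simp
        ultimately show ?thesis
          unfolding dae_solution_def carrier_matD(2)[OF Lb]
          by (intro conjI ballI empty mult_mat_vec_carrier[OF Lb] add_carrier_vec
              mult_mat_vec_carrier[OF Kb] fc(3) zero_carrier_vec)
      qed
      moreover have "dae_solution (transpose_mat (L_mat \<gamma>)) (transpose_mat (K_mat \<gamma>)) T f3 ?Z3"
        using overdetermined_dae_iff[OF T bf3 \<gamma>] cond by blast
      ultimately show "bvp_solution E A B C d T f x"
        using bc_iff[OF c(1)] c(2)
          decouple[of "X c" "?y0 c" ?Z1 "\<lambda>t. 0\<^sub>v ?nb" ?Z3] y0c[OF c(1)] Z1c Z3c
        unfolding x by (simp add: X_def append0)
    qed
    \<comment> \<open>The value at time 0 recovers c. This makes uniqueness of the solution the same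
      as uniqueness of its parameter.\<close>
    have X_inj: "c = c'" if "X c = X c'" "c \<in> carrier_vec n0" "c' \<in> carrier_vec n0" for c c'
    proof -
      have "V *\<^sub>v (?y0 c 0 @\<^sub>v ?Z1 0 @\<^sub>v ?Z3 0) = V *\<^sub>v (?y0 c' 0 @\<^sub>v ?Z1 0 @\<^sub>v ?Z3 0)"
        using fun_cong[OF that(1), of 0] T unfolding X_def by simp
      then have "?y0 c 0 @\<^sub>v ?Z1 0 @\<^sub>v ?Z3 0 = ?y0 c' 0 @\<^sub>v ?Z1 0 @\<^sub>v ?Z3 0"
        by (rule V_inj) (use y0c[OF that(2)] y0c[OF that(3)] Z1c[OF T0(1)] Z3c[OF T0(1)] in
            \<open>auto simp: n nb(1) intro!: append_carrier_vec\<close>)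
      then show ?thesis
        using append_vec_eq[OF y0c[OF that(2)] y0c[OF that(3)]] y0_0 that by metis
    qed
    have ex1: "(\<exists>!x. bvp_solution E A B C d T f x) \<longleftrightarrow> conditions"
    proof -
      have "(\<exists>!x. bvp_solution E A B C d T f x) \<longleftrightarrow>
          ?cond \<and> (\<exists>!c. c \<in> carrier_vec n0 \<and> Q *\<^sub>v c = dhat)"
        unfolding sol_iff using X_inj by blast
      then show ?thesis
        unfolding unique_solution_iff[OF Qc dhatc] conditions_def using True by blast
    qed
    have "x t = V *\<^sub>v
           ((mat_exp (t \<cdot>\<^sub>m A0)
               *\<^sub>v (the (mat_inverse (transpose_mat Q * Q)) *\<^sub>v (transpose_mat Q *\<^sub>v dhat)) + conv0 t)
            @\<^sub>v (- finsum_vec TYPE(real) (sum_list \<alpha>) (\<lambda>i. N_term T \<alpha> f1 i t) {..<max_index \<alpha>})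
            @\<^sub>v (- (K_mat \<gamma> *\<^sub>v
                  finsum_vec TYPE(real) (sum_list \<gamma>) (\<lambda>i. N_term T \<gamma> f3 i t) {..<max_index \<gamma>})))"
      if cond: conditions and x: "bvp_solution E A B C d T f x" and t: "t \<in> {0..T}" for x t
    proof -
      obtain c where c: "c \<in> carrier_vec n0" "Q *\<^sub>v c = dhat" "x = X c"
        using x unfolding sol_iff by blast
      have rank: "vec_space.rank l Q = n0" using cond unfolding conditions_def by blast
      \<comment> \<open>Since \<open>dhat\<close> equals \<open>Q c\<close>, the left inverse of Q
        provided by (d) returns the initial value.\<close>
      have c_eq: "the (mat_inverse (transpose_mat Q * Q)) *\<^sub>v (transpose_mat Q *\<^sub>v dhat) = c"
        using normal_equation_solution[OF Qc rank c(1)] c(2) by simp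
      have s: "finsum_vec TYPE(real) ?ng (\<lambda>i. N_term T \<gamma> f3 i t) {..<max_index \<gamma>} \<in> carrier_vec ?ng"
        using N_term_carrier[OF T bf3 t] by (intro finsum_vec_closed) auto
      have "?Z3 t = - (K_mat \<gamma> *\<^sub>v finsum_vec TYPE(real) ?ng (\<lambda>i. N_term T \<gamma> f3 i t) {..<max_index \<gamma>})"
        unfolding nilpotent_solution_def using s K_mat_carrier[OF \<gamma>] by (intro eq_vecI) auto
      then show ?thesis
        unfolding c_eq c(3) using t by (simp add: X_def nilpotent_solution_def)
    qed
    then show ?thesis using ex1 by blast
  qed
qed

end
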